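(* Let $n\ge 1$ and let $$\frac{dY}{dx}=A(x)Y,\qquad A(x)=\sum_{i=1}^{n+2}\frac{A_i}{x-t_i}\qquad (A_0)$$ be a non-resonant Fuchsian system normalized at infinity, with $t_{n+1}=0$, $t_{n+2}=1$, $t_{n+3}=\infty$. Assume that $(t_1,\dots,t_n)\in\pi^n=\{t\in\mathbb R^n:t_1<\dots<t_n<0\}$, that for $i=1,\dots,n+2$ the eigenvalues $\theta_i^+$ and $\theta_i^-$ of $A_i$ are real or complex conjugate to each other, and that the eigenvalues $\theta_\infty^+,\theta_\infty^-$ of $A_\infty$ are real. Then the following three assertions are equivalent: (1) the Fuchsian second-order equation associated with $(A_0)$ is real; (2) there is a real number $\eta$ such that for every $i=1,\dots,n+2$, $A_i=\begin{pmatrix}a_i& b_ie^{i\eta}\\ c_ie^{-i\eta}& d_i\end{pmatrix}$ with $a_i,d_i\in\mathbb R$ and $b_i,c_i\in[0,+\infty[$; (3) (condition C1) for every system of generators $(M_1,\dots,M_{n+3})$ of the monodromy of $(A_0)$ along the loops $\gamma_1,\dots,\gamma_{n+3}$, there is a matrix $C\in GL_2(\mathbb C)$ such that for every $j=1,\dots,n+3$ $$C^{-1}\overline{M_j}\,C=(M_j\cdots M_1)^{-1}M_j^{-1}(M_j\cdots M_1).$$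
   Context: All systems are $2\times2$. $A_\infty:=-\sum_{i=1}^{n+2}A_i$ (also denoted $A_{n+3}$). "Normalized at infinity" means $A_\infty=\mathrm{diag}(\theta_\infty^+,\theta_\infty^-)$ is diagonal; "non-resonant" means $\theta_i^+-\theta_i^-\notin\mathbb Z$ for $i=1,\dots,n+3$ (with $\theta_{n+3}^\pm=\theta_\infty^\pm$). The second-order equation associated with the system (with $A_{12}\not\equiv0$) is the equation satisfied by the first component of all its solutions: $y''+py'+qy=0$ with $p=-A_{12}'/A_{12}-\operatorname{Tr}A$, $q=-A_{11}'+A_{11}A_{12}'/A_{12}+\det A$; it is real if $p,q$ are real-valued on the real axis. Fix $x_0$ in the upper half-plane. With $S(t)=\{t_1,\dots,t_{n+3}\}$, $\gamma_i\in\pi_1(\mathbb P^1\smallsetminus S(t),x_0)$ is the class of the loop going once positively around $t_i$, crossing $\mathbb R\cup\{\infty\}$ first in $]t_{i-1},t_i[$ and then in $]t_i,t_{i+1}[$ (indices cyclic mod $n+3$). A system of generators of the monodromy is the tuple of matrices $M_i$ defined by $\gamma_i*\mathbf Y=\mathbf Y M_i$ for some fundamental matrix of solutions $\mathbf Y$, where $\gamma_i*\mathbf Y$ is analytic continuation along $\gamma_i$; it satisfies $M_{n+3}\cdots M_1=\mathrm I_2$. $\overline{M}$ denotes the entrywise complex conjugate.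
   Formalization: In (2) the numbers b_i, c_i are taken to be real of arbitrary sign instead of in [0,+∞[; since A_∞ is diagonal the b_i sum to zero, so nonnegativity would force A_12≡0 and make the equivalence false. *)

theory Defs
  imports "HOL-Analysis.Analysis"
begin

section \<open>Fuchsian systems of size two\<close>

definition mat2 :: "complex \<Rightarrow> complex \<Rightarrow> complex \<Rightarrow> complex \<Rightarrow> complex^2^2" where
  "mat2 a b c d = vector [vector [a, b], vector [c, d]]"

text \<open>Eigenvalues are listed with multiplicity, as the roots of the characteristic polynomial.\<close>

definition has_eigenvalues :: "complex^2^2 \<Rightarrow> complex \<Rightarrow> complex \<Rightarrow> bool" where
  "has_eigenvalues B u v \<longleftrightarrow> (\<forall>z. det (mat z - B) = (z - u) * (z - v))"

text \<open>The positions of the finite singular points: the tuples \<open>(t\<^sub>1, \<dots>, t\<^sub>n)\<close> with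
  \<open>t\<^sub>1 < \<dots> < t\<^sub>n < 0\<close>.  Only the values at the indices in \<open>{1..n}\<close> are constrained.\<close>

definition positions :: "nat \<Rightarrow> (nat \<Rightarrow> real) set" where
  "positions n = {t. strict_mono_on {1..n} t \<and> (\<forall>i\<in>{1..n}. t i < 0)}"

definition sing :: "nat \<Rightarrow> (nat \<Rightarrow> real) \<Rightarrow> complex set" where
  "sing n t = (\<lambda>i. of_real (t i)) ` {1..n+2}"

definition system_matrix ::
    "nat \<Rightarrow> (nat \<Rightarrow> real) \<Rightarrow> (nat \<Rightarrow> complex^2^2) \<Rightarrow> complex \<Rightarrow> complex^2^2" where
  "system_matrix n t A x = (\<chi> k l. \<Sum>i=1..n+2. A i $ k $ l / (x - of_real (t i)))"

definition A_infinity :: "nat \<Rightarrow> (nat \<Rightarrow> complex^2^2) \<Rightarrow> complex^2^2" where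
  "A_infinity n A = - (\<Sum>i=1..n+2. A i)"


section \<open>The associated second-order equation\<close>

text \<open>If the matrix function \<open>B\<close> has \<open>B\<^sub>1\<^sub>2\<close> not identically zero, then eliminating \<open>y\<^sub>2\<close> from
  \<open>Y' = B Y\<close> gives \<open>y'' + p y' + q y = 0\<close> for the first component \<open>y\<close> of every solution,
  with the following coefficients.\<close>

definition coeff_p :: "(complex \<Rightarrow> complex^2^2) \<Rightarrow> complex \<Rightarrow> complex" where
  "coeff_p B x = - deriv (\<lambda>z. B z $ 1 $ 2) x / (B x $ 1 $ 2) - trace (B x)"

definition coeff_q :: "(complex \<Rightarrow> complex^2^2) \<Rightarrow> complex \<Rightarrow> complex" where
  "coeff_q B x = - deriv (\<lambda>z. B z $ 1 $ 1) x
     + B x $ 1 $ 1 * deriv (\<lambda>z. B z $ 1 $ 2) x / (B x $ 1 $ 2) + det (B x)"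

text \<open>The coefficients are rational functions; they are evaluated only where the defining
  formulas involve no division by zero, that is, off the singular points and the zeros of the
  upper right entry.\<close>

definition real_second_order_equation ::
    "nat \<Rightarrow> (nat \<Rightarrow> real) \<Rightarrow> (nat \<Rightarrow> complex^2^2) \<Rightarrow> bool" where
  "real_second_order_equation n t A \<longleftrightarrow>
     (\<forall>x::real. of_real x \<notin> sing n t \<longrightarrow> system_matrix n t A (of_real x) $ 1 $ 2 \<noteq> 0 \<longrightarrow>
        coeff_p (system_matrix n t A) (of_real x) \<in> \<real> \<and>
        coeff_q (system_matrix n t A) (of_real x) \<in> \<real>)"


section \<open>Monodromy\<close>

definition fundamental_matrix_near ::
    "(complex \<Rightarrow> complex^2^2) \<Rightarrow> complex \<Rightarrow> (complex \<Rightarrow> complex^2^2) \<Rightarrow> bool" where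
  "fundamental_matrix_near B x0 Y \<longleftrightarrow>
     (\<forall>\<^sub>F x in nhds x0. invertible (Y x) \<and>
        (\<forall>k l. ((\<lambda>z. Y z $ k $ l) has_field_derivative (B x ** Y x) $ k $ l) (at x)))"

text \<open>Analytic continuation along \<open>g\<close> of the germ of \<open>Y\<close> at \<open>g 0\<close> is the germ of \<open>Z\<close> at \<open>g 1\<close>:
  there is a family of analytic germs \<open>F s\<close> at \<open>g s\<close> such that, for \<open>s'\<close> close to \<open>s\<close>, the germ
  of \<open>F s'\<close> at \<open>g s'\<close> is the one induced by \<open>F s\<close>.\<close>

definition continues_along ::
    "(real \<Rightarrow> complex) \<Rightarrow> (complex \<Rightarrow> complex^2^2) \<Rightarrow> (complex \<Rightarrow> complex^2^2) \<Rightarrow> bool" where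
  "continues_along g Y Z \<longleftrightarrow>
     (\<exists>F :: real \<Rightarrow> complex \<Rightarrow> complex^2^2.
        (\<forall>s\<in>{0..1}.
           (\<forall>k l. (\<lambda>x. F s x $ k $ l) analytic_on {g s}) \<and>
           (\<forall>\<^sub>F s' in at s within {0..1}. \<forall>\<^sub>F x in nhds (g s'). F s' x = F s x)) \<and>
        (\<forall>\<^sub>F x in nhds (g 0). F 0 x = Y x) \<and>
        (\<forall>\<^sub>F x in nhds (g 1). F 1 x = Z x))"

text \<open>The open arc \<open>]t\<^bsub>i-1\<^esub>, t\<^bsub>i\<^esub>[\<close> of the real projective line, where \<open>t\<^bsub>n+3\<^esub> = \<infinity>\<close> and indices are
  cyclic modulo \<open>n + 3\<close>; used for \<open>1 \<le> i \<le> n + 4\<close>.\<close>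

definition arc_before :: "nat \<Rightarrow> (nat \<Rightarrow> real) \<Rightarrow> nat \<Rightarrow> real set" where
  "arc_before n t i =
     (if i = 1 \<or> i = n + 4 then {..<t 1}
      else if i = n + 3 then {t (n+2)<..}
      else {t (i-1)<..<t i})"

text \<open>The loops representing \<open>\<gamma>\<^sub>i\<close>.  The base point lies in the upper half-plane, so the
  first crossing of the real line goes downwards and the second one upwards.  Since both
  half-planes are simply connected, the two arcs that are crossed determine the homotopy class.
  For \<open>i \<le> n + 2\<close> the loop goes once counterclockwise around \<open>t\<^sub>i\<close> and around no other finite
  singular point; for \<open>i = n + 3\<close> it goes once clockwise around all of them, that is, once
  positively around \<open>\<infinity>\<close>.\<close>

definition gamma_loop :: "nat \<Rightarrow> (nat \<Rightarrow> real) \<Rightarrow> complex \<Rightarrow> nat \<Rightarrow> (real \<Rightarrow> complex) \<Rightarrow> bool" where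
  "gamma_loop n t x0 i g \<longleftrightarrow>
     path g \<and> pathstart g = x0 \<and> pathfinish g = x0 \<and>
     (\<exists>s1 s2. 0 < s1 \<and> s1 < s2 \<and> s2 < 1 \<and>
        g s1 \<in> of_real ` arc_before n t i \<and> g s2 \<in> of_real ` arc_before n t (i+1) \<and>
        (\<forall>s\<in>{0..<s1} \<union> {s2<..1}. Im (g s) > 0) \<and>
        (\<forall>s\<in>{s1<..<s2}. Im (g s) < 0))"

text \<open>The matrices \<open>M 1, \<dots>, M (n+3)\<close> form a system of generators of the monodromy with base
  point \<open>x0\<close>; the same fundamental matrix is used for all loops.\<close>

definition monodromy_generators ::
    "nat \<Rightarrow> (nat \<Rightarrow> real) \<Rightarrow> (nat \<Rightarrow> complex^2^2) \<Rightarrow> complex \<Rightarrow> (nat \<Rightarrow> complex^2^2) \<Rightarrow> bool" where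
  "monodromy_generators n t A x0 M \<longleftrightarrow>
     (\<exists>Y. fundamental_matrix_near (system_matrix n t A) x0 Y \<and>
        (\<forall>j\<in>{1..n+3}. \<exists>g. gamma_loop n t x0 j g \<and> continues_along g Y (\<lambda>x. Y x ** M j)))"

text \<open>\<open>rev_prod M j\<close> is the product \<open>M j ** \<dots> ** M 1\<close>, with decreasing indices.\<close>

primrec rev_prod :: "(nat \<Rightarrow> complex^2^2) \<Rightarrow> nat \<Rightarrow> complex^2^2" where
  "rev_prod M 0 = mat 1"
| "rev_prod M (Suc j) = M (Suc j) ** rev_prod M j"

definition condition_C1 :: "nat \<Rightarrow> (nat \<Rightarrow> complex^2^2) \<Rightarrow> bool" where
  "condition_C1 n M \<longleftrightarrow>
     (\<exists>C. invertible C \<and>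
        (\<forall>j\<in>{1..n+3}. matrix_inv C ** map_matrix cnj (M j) ** C =
           matrix_inv (rev_prod M j) ** matrix_inv (M j) ** rev_prod M j))"


section \<open>The normal form of the residues\<close>

text \<open>The numbers \<open>b\<close> and \<open>c\<close> are real of arbitrary sign.  They cannot be required to be
  nonnegative: as \<open>A_infinity\<close> is diagonal, the numbers \<open>b\<close> belonging to the different residues
  add up to zero, so they would all vanish and there would be no associated second-order
  equation.\<close>

definition real_up_to_phase :: "nat \<Rightarrow> (nat \<Rightarrow> complex^2^2) \<Rightarrow> bool" where
  "real_up_to_phase n A \<longleftrightarrow>
     (\<exists>\<eta>::real. \<forall>i\<in>{1..n+2}. \<exists>a b c d :: real.
        A i = mat2 (of_real a) (of_real b * cis \<eta>) (of_real c * cis (- \<eta>)) (of_real d))"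

end

theory Submission
  imports Defs "HOL-Complex_Analysis.Complex_Analysis"
begin

text \<open>
  Write \<open>A(x)\<close> for the coefficient matrix and \<open>A\<^sup>c(x)\<close> for the one whose residues are the complex
  conjugates of the \<open>A\<^sub>i\<close>; as the poles are real, \<open>A\<^sup>c(x)\<close> is the conjugate of \<open>A\<close> at the conjugate of
  \<open>x\<close>.  Each of the three assertions says that the two systems are gauge equivalent, that is, that there
  is an invertible holomorphic \<open>T\<close> with \<open>T' = A\<^sup>c T - T A\<close> off a finite set of points, and the whole proof
  rests on one rigidity statement (lemma \<open>rigidity\<close>, applied in \<open>gauge_constant\<close>): such a \<open>T\<close> is constant.

  For the rigidity, regard \<open>T' = A\<^sup>c T - T A\<close> as a linear system of size four with simple poles.  A
  Gronwall estimate along rays shows that a single-valued solution has at most a pole at each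
  singular point, infinity included.  The leading coefficient \<open>X\<close> of a pole of order \<open>m\<close> would satisfy
  \<open>-m X = A\<^sup>c\<^sub>i X - X A\<^sub>i\<close>.  Since the eigenvalues of \<open>A\<^sub>i\<close> are real or conjugate to each other, \<open>A\<^sub>i\<close> and its
  conjugate have the same eigenvalues, and by non-resonance these do not differ by a nonzero integer;
  so there is no pole, and Liouville's theorem applies.  A constant invertible \<open>T\<close> intertwines all
  residues; it commutes with the residue at infinity, which is real and diagonal with distinct
  entries, hence it is diagonal, and its ratio of diagonal entries gives the phase \<open>\<eta>\<close>
  (\<open>real_up_to_phase_iff\<close>).

  If the second-order equation is real, then the systems of \<open>A\<close> and of \<open>A\<^sup>c\<close> have the same first
  components of solutions, and the triangular gauge matrix between them is explicit; it is
  holomorphic off the poles and the zeros of \<open>A\<^sub>1\<^sub>2\<close>, which suffices for the rigidity.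

  For the monodromy, the plane without the real line, together with one of the intervals between
  neighbouring poles, is starlike, so a fundamental matrix extends over it.  The extensions across the
  different intervals agree in the upper half-plane and differ in the lower one by constant
  connection matrices \<open>N\<^sub>i\<close>, and the monodromy matrices are \<open>M\<^sub>j = N\<^sub>j\<^sub>+\<^sub>1\<^sup>-\<^sup>1 N\<^sub>j\<close>.  In these terms the condition on
  the monodromy says that some invertible \<open>C\<close> satisfies \<open>N\<^sup>c\<^sub>i C N\<^sub>i = C\<close> for all \<open>i\<close>, where \<open>N\<^sup>c\<^sub>i\<close> is the
  conjugate of \<open>N\<^sub>i\<close> (\<open>C1_condition_iff\<close>), and this is exactly the condition under which the local gauge
  transformations glue to a single-valued \<open>T\<close> (\<open>real_up_to_phase_iff_connection\<close>).
\<close>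

(* Otherwise every occurrence of the vector component sign is ambiguous. *)
unbundle no Formal_Power_Series.fps_syntax

section \<open>Linear systems of holomorphic differential equations\<close>

definition solves_system ::
    "(complex \<Rightarrow> 'n::finite \<Rightarrow> 'n \<Rightarrow> complex) \<Rightarrow> (complex \<Rightarrow> 'n \<Rightarrow> complex) \<Rightarrow> complex set \<Rightarrow> bool" where
  "solves_system a y U \<longleftrightarrow>
     (\<forall>z\<in>U. \<forall>k. ((\<lambda>w. y w k) has_field_derivative (\<Sum>l\<in>UNIV. a z k l * y z l)) (at z))"

lemma starlike_primitive_vanishing_at:
  assumes "open U" "z0 \<in> U" "\<And>z. z \<in> U \<Longrightarrow> closed_segment z0 z \<subseteq> U" "f holomorphic_on U"
  shows "\<exists>g. g z0 = 0 \<and> (\<forall>z\<in>U. (g has_field_derivative f z) (at z))"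
proof -
  have "starlike U" using assms(2,3) unfolding starlike_def by blast
  then obtain g where g: "\<forall>x\<in>U. (g has_field_derivative f x) (at x)"
    using holomorphic_starlike_primitive[of U f "{}"] assms
    by (metis DiffD1 finite.emptyI holomorphic_on_imp_continuous_on holomorphic_on_imp_differentiable_at)
  show ?thesis
    by (rule exI[of _ "\<lambda>z. g z - g z0"]) (use g in \<open>auto intro!: derivative_eq_intros\<close>)
qed

text \<open>The inductive step of the estimate for Picard iterates along a segment: integrating the bound
  \<open>L\<^sup>m s\<^sup>m / m!\<close> for the derivative produces the next factorial.\<close>

lemma segment_derivative_power_bound:
  fixes f :: "complex \<Rightarrow> complex"
  assumes f: "\<And>s. s \<in> {0..1} \<Longrightarrow>
                (f has_field_derivative f' (z0 + of_real s * (w - z0))) (at (z0 + of_real s * (w - z0)))"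
    and "f z0 = 0"
    and bound: "\<And>s. s \<in> {0..1} \<Longrightarrow> cmod (f' (z0 + of_real s * (w - z0))) * cmod (w - z0)
                  \<le> V * L ^ Suc m * s ^ m / fact m"
    and s: "s \<in> {0..1}"
  shows "cmod (f (z0 + of_real s * (w - z0))) \<le> V * L ^ Suc m * s ^ Suc m / fact (Suc m)"
proof (cases "s = 0")
  case True
  then show ?thesis using assms(2) by simp
next
  case False
  with s have s0: "0 < s" by simp
  let ?p = "\<lambda>u::real. z0 + of_real u * (w - z0)"
  let ?\<phi> = "\<lambda>u::real. V * L ^ Suc m * u ^ Suc m / fact (Suc m)"
  have der: "((\<lambda>u. f (?p u)) has_vector_derivative (w - z0) * f' (?p u)) (at u)" if "u \<in> {0..1}" for u
  proof -
    have 1: "(?p has_vector_derivative (w - z0)) (at u)"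
      by (auto intro!: derivative_eq_intros simp: has_vector_derivative_def scaleR_conv_of_real)
    show ?thesis
      using field_vector_diff_chain_at[OF 1 f[OF that]] by (simp add: o_def)
  qed
  have \<phi>: "(?\<phi> has_vector_derivative V * L ^ Suc m * u ^ m / fact m) (at u)" for u
  proof -
    have "(?\<phi> has_field_derivative V * L ^ Suc m * (real (Suc m) * u ^ m) / fact (Suc m)) (at u)"
      using DERIV_cdivide[OF DERIV_cmult[OF DERIV_pow[of "Suc m" u]], of "V * L ^ Suc m" "fact (Suc m)"]
      by simp
    also have "V * L ^ Suc m * (real (Suc m) * u ^ m) / fact (Suc m) = V * L ^ Suc m * u ^ m / fact m"
      by (simp add: field_simps del: of_nat_Suc)
    finally show ?thesis by (simp add: has_real_derivative_iff_has_vector_derivative)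
  qed
  have "cmod (f (?p s) - f (?p 0)) \<le> ?\<phi> s - ?\<phi> 0"
  proof (rule differentiable_bound_general[OF s0])
    show "continuous_on {0..s} (\<lambda>u. f (?p u))"
      using s by (intro continuous_at_imp_continuous_on ballI has_vector_derivative_continuous[OF der]) auto
    show "continuous_on {0..s} ?\<phi>"
      by (intro continuous_intros) auto
    show "cmod ((w - z0) * f' (?p u)) \<le> V * L ^ Suc m * u ^ m / fact m" if "0 < u" "u < s" for u
      using bound[of u] that s by (simp add: norm_mult mult.commute)
  qed (use der \<phi> s in auto)
  then show ?thesis using assms(2) by simp
qed

text \<open>The Picard series converges globally because the system is linear: the \<open>m\<close>-th iterate is bounded by
  \<open>V L\<^sup>m / m!\<close> on the compact set swept out by the segments from the centre to a small disc.\<close>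

lemma linear_system_exists:
  fixes a :: "complex \<Rightarrow> 'n::finite \<Rightarrow> 'n \<Rightarrow> complex" and v :: "'n \<Rightarrow> complex"
  assumes U: "open U" "z0 \<in> U" and star: "\<And>z. z \<in> U \<Longrightarrow> closed_segment z0 z \<subseteq> U"
    and hol: "\<And>k l. (\<lambda>z. a z k l) holomorphic_on U"
  shows "\<exists>y. y z0 = v \<and> solves_system a y U"
proof -
  define prim where "prim f = (SOME g. g z0 = 0 \<and> (\<forall>z\<in>U. (g has_field_derivative f z) (at z)))"
    for f :: "complex \<Rightarrow> complex"
  have prim: "prim f z0 = 0" "\<And>z. z \<in> U \<Longrightarrow> (prim f has_field_derivative f z) (at z)"
    if "f holomorphic_on U" for f
    using someI_ex[OF starlike_primitive_vanishing_at[OF U star that]] unfolding prim_def by auto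
  \<comment> \<open>The solution is the sum over \<open>m\<close> of the iterates \<open>D m\<close>: start with
    the initial value, apply the coefficient matrix and integrate from \<open>z0\<close>.\<close>
  define D where "D = rec_nat (\<lambda>k z. v k) (\<lambda>_ d k. prim (\<lambda>z. \<Sum>l\<in>UNIV. a z k l * d l z))"
  define E where "E m k z = (\<Sum>l\<in>UNIV. a z k l * D m l z)" for m k z
  have D0: "D 0 k = (\<lambda>z. v k)" and DSuc: "D (Suc m) k = prim (E m k)" for m k
    by (simp_all add: D_def E_def[abs_def] fun_eq_iff)
  have Dhol: "D m k holomorphic_on U" for m k
  proof (induction m arbitrary: k)
    case (Suc m)
    have "E m k holomorphic_on U" unfolding E_def by (intro holomorphic_intros hol Suc)
    then show ?case
      using prim(2) unfolding DSuc holomorphic_on_def field_differentiable_def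
      by (meson has_field_derivative_at_within)
  qed (simp add: D0)
  have Ehol: "E m k holomorphic_on U" for m k
    unfolding E_def by (intro holomorphic_intros hol Dhol)
  have Dder: "(D (Suc m) k has_field_derivative E m k z) (at z)" if "z \<in> U" for m k z
    using prim(2)[OF Ehol that] by (simp add: DSuc)
  define y where "y z k = (\<Sum>m. D m k z)" for z k
  have D_z0: "D (Suc m) k z0 = 0" for m k using prim(1)[OF Ehol] by (simp add: DSuc)
  have y0: "y z0 = v"
  proof
    fix k
    have "(\<lambda>m. D m k z0) sums (\<Sum>m\<in>{0}. D m k z0)"
      by (rule sums_finite) (auto simp: D_z0 gr0_conv_Suc)
    then show "y z0 k = v k" unfolding y_def by (simp add: sums_iff D0)
  qed
  have "((\<lambda>w. y w k) has_field_derivative (\<Sum>l\<in>UNIV. a z k l * y z l)) (at z)" if z: "z \<in> U" for z k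
  proof -
    obtain r where r: "r > 0" "cball z r \<subseteq> U"
      using U(1) z open_contains_cball by blast
    define p where "p = (\<lambda>(s::real, w::complex). z0 + of_real s * (w - z0))"
    \<comment> \<open>The derivative of an iterate at a point of the disc depends on the whole segment from \<open>z0\<close>.\<close>
    define W where "W = p ` ({0..1} \<times> cball z r)"
    have "compact W" unfolding W_def p_def
      by (intro compact_continuous_image compact_Times)
         (auto simp: case_prod_unfold intro!: continuous_intros)
    have WU: "W \<subseteq> U"
    proof
      fix x assume "x \<in> W"
      then obtain s w where sw: "s \<in> {0..1}" "w \<in> cball z r" "x = z0 + of_real s * (w - z0)"
        unfolding W_def p_def by auto
      then have "x \<in> closed_segment z0 w"
        unfolding closed_segment_def by (auto simp: scaleR_conv_of_real algebra_simps intro!: exI[of _ s])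
      then show "x \<in> U" using star[of w] sw(2) r(2) by blast
    qed
    have "\<exists>K. \<forall>x\<in>W. cmod (a x k l) \<le> K" for k l
    proof -
      have "continuous_on W (\<lambda>x. a x k l)"
        by (rule continuous_on_subset[OF holomorphic_on_imp_continuous_on[OF hol] WU])
      then have "bounded ((\<lambda>x. a x k l) ` W)"
        using compact_continuous_image[OF _ \<open>compact W\<close>] compact_imp_bounded by blast
      then show ?thesis by (auto simp: bounded_iff)
    qed
    then obtain Kf where Kf: "\<And>k l x. x \<in> W \<Longrightarrow> cmod (a x k l) \<le> Kf k l" by metis
    define K where "K = (\<Sum>k\<in>UNIV. \<Sum>l\<in>UNIV. \<bar>Kf k l\<bar>)"
    have K: "cmod (a x k l) \<le> K" if "x \<in> W" for x k l
    proof -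
      have "Kf k l \<le> \<bar>Kf k l\<bar>" by simp
      also have "\<dots> \<le> (\<Sum>l\<in>UNIV. \<bar>Kf k l\<bar>)" by (rule member_le_sum) auto
      also have "\<dots> \<le> K" unfolding K_def by (rule member_le_sum) (auto intro: sum_nonneg)
      finally show ?thesis using Kf[OF that, of k l] by linarith
    qed
    have K0: "K \<ge> 0" unfolding K_def by (intro sum_nonneg) auto
    define V where "V = (\<Sum>k\<in>UNIV. cmod (v k))"
    have V: "cmod (v k) \<le> V" for k unfolding V_def by (rule member_le_sum) auto
    have V0: "V \<ge> 0" unfolding V_def by (intro sum_nonneg) auto
    define R where "R = cmod (z - z0) + r"
    define L where "L = real (CARD('n)) * K * R"
    have R0: "R \<ge> 0" using r(1) by (simp add: R_def)
    have L0: "L \<ge> 0" using R0 K0 by (simp add: L_def)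
    have wR: "cmod (w - z0) \<le> R" if "w \<in> cball z r" for w
      using that norm_triangle_ineq[of "w - z" "z - z0"] by (simp add: R_def dist_norm norm_minus_commute)
    have bound: "cmod (D m k (z0 + of_real s * (w - z0))) \<le> V * L ^ m * s ^ m / fact m"
      and Ebound: "cmod (E m k (z0 + of_real s * (w - z0))) \<le> real (CARD('n)) * K * (V * L ^ m * s ^ m / fact m)"
      if w: "w \<in> cball z r" and s: "s \<in> {0..1}" for m k w s
    proof -
      have inW: "z0 + of_real s * (w - z0) \<in> W" if "s \<in> {0..1}" for s
        using that w unfolding W_def p_def by force
      have E: "cmod (E m k (z0 + of_real s * (w - z0))) \<le> real (CARD('n)) * K * B"
        if "\<And>l. cmod (D m l (z0 + of_real s * (w - z0))) \<le> B" "s \<in> {0..1}" for m k s B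
      proof -
        have "cmod (E m k (z0 + of_real s * (w - z0))) \<le> (\<Sum>l\<in>(UNIV::'n set). K * B)"
          unfolding E_def
        proof (rule sum_norm_le)
          fix l
          show "cmod (a (z0 + of_real s * (w - z0)) k l * D m l (z0 + of_real s * (w - z0))) \<le> K * B"
            unfolding norm_mult using K[OF inW[OF that(2)]] that(1) K0 by (intro mult_mono) auto
        qed
        then show ?thesis by simp
      qed
      have D: "\<And>k s. s \<in> {0..1} \<Longrightarrow> cmod (D m k (z0 + of_real s * (w - z0))) \<le> V * L ^ m * s ^ m / fact m"
      proof (induction m)
        case 0
        then show ?case using V by (simp add: D0)
      next
        case (Suc m)
        show ?case
        proof (rule segment_derivative_power_bound[where f' = "E m k"])
          fix u :: real assume u: "u \<in> {0..1}"
          show "(D (Suc m) k has_field_derivative E m k (z0 + of_real u * (w - z0)))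
                  (at (z0 + of_real u * (w - z0)))"
            using Dder inW[OF u] WU by auto
          have "cmod (E m k (z0 + of_real u * (w - z0))) * cmod (w - z0)
                 \<le> real (CARD('n)) * K * (V * L ^ m * u ^ m / fact m) * R"
            using E[OF Suc.IH[OF u] u] wR[OF w] K0 V0 L0 u by (intro mult_mono) auto
          also have "\<dots> = V * L ^ Suc m * u ^ m / fact m"
            by (simp add: L_def field_simps)
          finally show "cmod (E m k (z0 + of_real u * (w - z0))) * cmod (w - z0)
                 \<le> V * L ^ Suc m * u ^ m / fact m" .
        qed (use Suc.prems D_z0 in auto)
      qed
      show "cmod (D m k (z0 + of_real s * (w - z0))) \<le> V * L ^ m * s ^ m / fact m" by (rule D[OF s])
      show "cmod (E m k (z0 + of_real s * (w - z0))) \<le> real (CARD('n)) * K * (V * L ^ m * s ^ m / fact m)"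
        by (rule E[OF D[OF s] s])
    qed
    have sumL: "summable (\<lambda>m. L ^ m / fact m)" using summable_exp[of L] by (simp add: field_simps)
    define f' where "f' m w = (case m of 0 \<Rightarrow> 0 | Suc m' \<Rightarrow> E m' k w)" for m w
    have Dsum: "summable (\<lambda>m. D m l w)" if "w \<in> cball z r" for l w
    proof (rule summable_comparison_test')
      show "summable (\<lambda>m. V * (L ^ m / fact m))" by (intro summable_mult sumL)
      show "cmod (D m l w) \<le> V * (L ^ m / fact m)" for m
        using bound[OF that, of 1 m l] by simp
    qed
    have der: "((\<lambda>w. \<Sum>m. D m k w) has_field_derivative (\<Sum>m. f' m z)) (at z)"
    proof (rule has_field_derivative_series'(2))
      show "convex (cball z r)" by simp
      show "(D m k has_field_derivative f' m w) (at w within cball z r)" if "w \<in> cball z r" for m w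
        unfolding f'_def using Dder[OF subsetD[OF r(2) that]]
        by (cases m) (auto simp: D0 intro: has_field_derivative_at_within)
      show "uniformly_convergent_on (cball z r) (\<lambda>m w. \<Sum>i<m. f' i w)"
      proof (rule Weierstrass_m_test'_ev)
        let ?M = "\<lambda>m. case m of 0 \<Rightarrow> 0 | Suc m' \<Rightarrow> real (CARD('n)) * K * V * (L ^ m' / fact m')"
        have "cmod (f' m w) \<le> ?M m" if "w \<in> cball z r" for m w
          unfolding f'_def using Ebound[OF that, of 1 _ k] by (auto split: nat.split simp: mult_ac)
        then show "\<forall>\<^sub>F m in sequentially. \<forall>w\<in>cball z r. cmod (f' m w) \<le> ?M m" by auto
        have "summable (\<lambda>m. ?M (Suc m))" using summable_mult[OF sumL] by simp
        then show "summable ?M" by (subst (asm) summable_Suc_iff)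
      qed
      show "z \<in> cball z r" "z \<in> interior (cball z r)" using r(1) by auto
      show "summable (\<lambda>m. D m k z)" using Dsum[of z] r(1) by simp
    qed
    have "(\<Sum>m. f' m z) = (\<Sum>l\<in>UNIV. a z k l * y z l)"
    proof -
      have "(\<lambda>m. E m k z) sums (\<Sum>l\<in>UNIV. a z k l * y z l)"
        unfolding E_def y_def using Dsum[of z] r(1)
        by (intro sums_sum sums_mult summable_sums) auto
      then have "(\<lambda>m. f' (Suc m) z) sums (\<Sum>l\<in>UNIV. a z k l * y z l)" by (simp add: f'_def)
      then have "(\<lambda>m. f' m z) sums ((\<Sum>l\<in>UNIV. a z k l * y z l) + f' 0 z)" by (subst (asm) sums_Suc_iff)
      then show ?thesis by (simp add: sums_iff f'_def)
    qed
    then show ?thesis using der by (simp add: y_def)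
  qed
  then show ?thesis using y0 unfolding solves_system_def by blast
qed

section \<open>Growth of solutions at a simple pole\<close>

lemma sum_cross_bound:
  fixes f :: "'n::finite \<Rightarrow> real"
  assumes "\<And>k. f k \<ge> 0"
  shows "(\<Sum>k\<in>UNIV. \<Sum>l\<in>UNIV. f k * f l) \<le> real CARD('n) * (\<Sum>k\<in>UNIV. (f k)\<^sup>2)"
proof -
  have "(\<Sum>k\<in>UNIV. \<Sum>l\<in>UNIV. f k * f l) \<le> (\<Sum>k\<in>UNIV. \<Sum>l\<in>UNIV. ((f k)\<^sup>2 + (f l)\<^sup>2) / 2)"
  proof (intro sum_mono)
    fix k l
    have "0 \<le> (f k - f l)\<^sup>2" by simp
    then show "f k * f l \<le> ((f k)\<^sup>2 + (f l)\<^sup>2) / 2" by (simp add: power2_diff)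
  qed
  also have "\<dots> = real CARD('n) * (\<Sum>k\<in>UNIV. (f k)\<^sup>2)"
    by (simp add: add_divide_distrib sum.distrib sum_divide_distrib[symmetric] sum_distrib_left[symmetric])
  finally show ?thesis .
qed

text \<open>Along a ray into the pole the squared norm \<open>\<phi>\<close> of a solution satisfies \<open>s \<phi>' \<ge> - 2 q \<phi>\<close>, so
  \<open>s\<^sup>2\<^sup>q \<phi>(s)\<close> increases with the distance \<open>s\<close> and is bounded by its values on a fixed circle.
  Only a solution on a full punctured disc is bounded on that circle; this is where single-valuedness enters.\<close>

lemma moderate_growth:
  fixes a :: "complex \<Rightarrow> 'n::finite \<Rightarrow> 'n \<Rightarrow> complex"
  assumes "r > 0" and sol: "solves_system a y (ball c r - {c})"
    and lim: "\<And>k l. ((\<lambda>z. (z - c) * a z k l) \<longlongrightarrow> B k l) (at c)"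
  shows "\<exists>m M. \<forall>\<^sub>F z in at c. \<forall>k. cmod ((z - c) ^ m * y z k) \<le> M"
proof -
  obtain K0 :: real where "\<forall>\<^sub>F z in at c. \<forall>k l. cmod ((z - c) * a z k l) \<le> K0"
  proof -
    define K0 where "K0 = (\<Sum>k\<in>UNIV. \<Sum>l\<in>UNIV. cmod (B k l) + 1)"
    have "\<forall>\<^sub>F z in at c. cmod ((z - c) * a z k l) \<le> K0" for k l
    proof -
      have "cmod (B k l) + 1 \<le> (\<Sum>l\<in>UNIV. cmod (B k l) + 1)" by (rule member_le_sum) auto
      also have "\<dots> \<le> K0" unfolding K0_def by (rule member_le_sum) (auto intro!: sum_nonneg)
      finally have "cmod (B k l) < K0" by simp
      from order_tendstoD(2)[OF tendsto_norm[OF lim] this] show ?thesis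
        by eventually_elim simp
    qed
    then show ?thesis by (intro that[of K0]) (simp add: eventually_all_finite)
  qed
  moreover obtain K where K: "K0 \<le> real K" using real_arch_simple by blast
  ultimately have "\<forall>\<^sub>F z in at c. \<forall>k l. cmod ((z - c) * a z k l) \<le> real K"
    by (auto elim!: eventually_mono intro: order_trans)
  then obtain d where d: "d > 0"
    "\<And>z k l. z \<noteq> c \<Longrightarrow> dist z c < d \<Longrightarrow> cmod ((z - c) * a z k l) \<le> real K"
    unfolding eventually_at by blast
  define \<rho> where "\<rho> = min d r / 2"
  have \<rho>: "\<rho> > 0" "\<rho> < d" "\<rho> < r" using d(1) \<open>r > 0\<close> by (auto simp: \<rho>_def)
  define q where "q = CARD('n) * K"
  define \<phi> where "\<phi> z = (\<Sum>k\<in>UNIV. (cmod (y z k))\<^sup>2)" for z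
  have ycont: "continuous_on (ball c r - {c}) (\<lambda>z. y z k)" for k
    using sol unfolding solves_system_def
    by (intro continuous_at_imp_continuous_on ballI) (blast intro: DERIV_isCont)
  have "compact (\<phi> ` sphere c \<rho>)"
    using \<rho> unfolding \<phi>_def
    by (intro compact_continuous_image continuous_intros continuous_on_subset[OF ycont]) auto
  then obtain C where C: "\<And>z. z \<in> sphere c \<rho> \<Longrightarrow> \<phi> z \<le> C"
    using compact_imp_bounded[of "\<phi> ` sphere c \<rho>"] unfolding bounded_iff
    by (metis imageI real_norm_def abs_le_D1)
  have key: "(cmod (z - c) ^ q)\<^sup>2 * \<phi> z \<le> (\<rho> ^ q)\<^sup>2 * C" if z: "z \<noteq> c" "dist z c < \<rho>" for z
  proof -
    define R where "R = cmod (z - c)"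
    have R: "0 < R" "R < \<rho>" using z by (auto simp: R_def dist_norm)
    define u where "u = (z - c) / of_real R"
    have u: "cmod u = 1" using R by (simp add: u_def R_def norm_divide)
    define p where "p s = c + of_real s * u" for s :: real
    have zp: "z = p R" using R by (simp add: p_def u_def)
    have inb: "p s \<in> ball c r - {c}" "dist (p s) c < d" "cmod (p s - c) = s" if "0 < s" "s \<le> \<rho>" for s
      using that \<rho> u by (auto simp: p_def dist_norm norm_mult)
    define y' where "y' s k = u * (\<Sum>l\<in>UNIV. a (p s) k l * y (p s) l)" for s k
    have dy: "((\<lambda>s. y (p s) k) has_vector_derivative y' s k) (at s)" if s: "0 < s" "s \<le> \<rho>" for s k
    proof -
      have 1: "(p has_vector_derivative u) (at s)"
        unfolding p_def
        by (auto intro!: derivative_eq_intros simp: has_vector_derivative_def scaleR_conv_of_real)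
      have "((\<lambda>w. y w k) has_field_derivative (\<Sum>l\<in>UNIV. a (p s) k l * y (p s) l)) (at (p s))"
        using sol inb(1)[OF s] unfolding solves_system_def by blast
      from field_vector_diff_chain_at[OF 1 this] show ?thesis by (simp add: o_def y'_def)
    qed
    define G where "G s k = 2 * (y (p s) k \<bullet> y' s k)" for s k
    have d\<phi>: "((\<lambda>s. \<phi> (p s)) has_real_derivative (\<Sum>k\<in>UNIV. G s k)) (at s)" if s: "0 < s" "s \<le> \<rho>" for s
    proof -
      have "((\<lambda>s. (cmod (y (p s) k))\<^sup>2) has_real_derivative G s k) (at s)" for k
      proof -
        have "((\<lambda>s. y (p s) k \<bullet> y (p s) k) has_derivative
               (\<lambda>h. y (p s) k \<bullet> (h *\<^sub>R y' s k) + (h *\<^sub>R y' s k) \<bullet> y (p s) k)) (at s)"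
          using dy[OF s, of k] unfolding has_vector_derivative_def by (rule has_derivative_inner[OF _ ]) (use dy[OF s, of k] in \<open>simp add: has_vector_derivative_def\<close>)
        also have "(\<lambda>h. y (p s) k \<bullet> (h *\<^sub>R y' s k) + (h *\<^sub>R y' s k) \<bullet> y (p s) k) = (*) (G s k)"
          by (auto simp: G_def inner_commute algebra_simps)
        finally show ?thesis by (simp add: has_field_derivative_def power2_norm_eq_inner)
      qed
      then show ?thesis unfolding \<phi>_def by (intro DERIV_sum)
    qed
    have Gbound: "(\<Sum>k\<in>UNIV. G s k) \<ge> - (2 * real q / s * \<phi> (p s))" if s: "0 < s" "s \<le> \<rho>" for s
    proof -
      have a: "cmod (a (p s) k l) \<le> real K / s" for k l
      proof -
        have "s * cmod (a (p s) k l) \<le> real K"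
          using d(2)[of "p s" k l] inb[OF s] by (simp add: norm_mult)
        then show ?thesis using s by (simp add: pos_le_divide_eq mult.commute)
      qed
      have "(\<Sum>k\<in>UNIV. - G s k) \<le> (\<Sum>k\<in>UNIV. \<Sum>l\<in>UNIV. 2 * (real K / s) * (cmod (y (p s) k) * cmod (y (p s) l)))"
      proof (rule sum_mono)
        fix k
        have "cmod (y' s k) \<le> (\<Sum>l\<in>UNIV. (real K / s) * cmod (y (p s) l))"
          unfolding y'_def norm_mult u mult_1
          by (rule sum_norm_le, unfold norm_mult) (intro mult_right_mono a norm_ge_zero)
        then have "cmod (y (p s) k) * cmod (y' s k)
            \<le> cmod (y (p s) k) * (\<Sum>l\<in>UNIV. (real K / s) * cmod (y (p s) l))"
          by (intro mult_left_mono) auto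
        moreover have "- G s k \<le> 2 * (cmod (y (p s) k) * cmod (y' s k))"
          using Cauchy_Schwarz_ineq2[of "y (p s) k" "y' s k"] unfolding G_def by linarith
        ultimately have "- G s k \<le> 2 * (cmod (y (p s) k) * (\<Sum>l\<in>UNIV. (real K / s) * cmod (y (p s) l)))"
          by linarith
        also have "\<dots> = (\<Sum>l\<in>UNIV. 2 * (real K / s) * (cmod (y (p s) k) * cmod (y (p s) l)))"
          by (simp add: sum_distrib_left mult_ac)
        finally show "- G s k \<le> (\<Sum>l\<in>UNIV. 2 * (real K / s) * (cmod (y (p s) k) * cmod (y (p s) l)))" .
      qed
      also have "\<dots> = 2 * (real K / s) * (\<Sum>k\<in>UNIV. \<Sum>l\<in>UNIV. cmod (y (p s) k) * cmod (y (p s) l))"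
        by (simp add: sum_distrib_left)
      also have "\<dots> \<le> 2 * (real K / s) * (real CARD('n) * \<phi> (p s))"
        unfolding \<phi>_def using s by (intro mult_left_mono sum_cross_bound) auto
      also have "\<dots> = 2 * real q / s * \<phi> (p s)" by (simp add: q_def field_simps)
      finally show ?thesis by (simp add: sum_negf)
    qed
    have "(R ^ q)\<^sup>2 * \<phi> (p R) \<le> (\<rho> ^ q)\<^sup>2 * \<phi> (p \<rho>)"
    proof (rule DERIV_nonneg_imp_nondecreasing[of R \<rho> "\<lambda>s. (s ^ q)\<^sup>2 * \<phi> (p s)"])
      fix s assume s: "R \<le> s" "s \<le> \<rho>"
      then have s0: "0 < s" using R by simp
      let ?D = "real (2 * q) * s ^ (2 * q - 1) * \<phi> (p s) + s ^ (2 * q) * (\<Sum>k\<in>UNIV. G s k)"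
      have "((\<lambda>s. s ^ (2 * q) * \<phi> (p s)) has_real_derivative ?D) (at s)"
        using DERIV_mult[OF DERIV_pow[of "2 * q" s] d\<phi>[OF s0 s(2)]] by (simp add: mult_ac add.commute)
      then have "((\<lambda>s. (s ^ q)\<^sup>2 * \<phi> (p s)) has_real_derivative ?D) (at s)"
        by (simp add: power_mult[symmetric] mult.commute)
      moreover have "?D \<ge> 0"
      proof -
        have "real (2 * q) * s ^ (2 * q - 1) = s ^ (2 * q) * (2 * real q / s)"
          using s0 by (cases "q = 0") (auto simp: power_diff field_simps)
        then have "?D = s ^ (2 * q) * (2 * real q / s * \<phi> (p s) + (\<Sum>k\<in>UNIV. G s k))"
          by (simp add: algebra_simps)
        then show ?thesis using Gbound[OF s0 s(2)] s0 by (simp add: zero_le_mult_iff)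
      qed
      ultimately show "\<exists>D. ((\<lambda>s. (s ^ q)\<^sup>2 * \<phi> (p s)) has_real_derivative D) (at s) \<and> D \<ge> 0" by blast
    qed (use R in auto)
    also have "\<dots> \<le> (\<rho> ^ q)\<^sup>2 * C"
      using inb(3)[of \<rho>] \<rho> by (intro mult_left_mono C) (auto simp: dist_norm norm_minus_commute)
    finally show ?thesis unfolding zp[symmetric] by (simp only: R_def)
  qed
  have "cmod ((z - c) ^ q * y z k) \<le> sqrt ((\<rho> ^ q)\<^sup>2 * C)" if z: "z \<noteq> c" "dist z c < \<rho>" for z k
  proof -
    have "(cmod (y z k))\<^sup>2 \<le> \<phi> z" unfolding \<phi>_def by (rule member_le_sum) auto
    then have "(cmod (z - c) ^ q)\<^sup>2 * (cmod (y z k))\<^sup>2 \<le> (\<rho> ^ q)\<^sup>2 * C"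
      using key[OF z] by (meson mult_left_mono order_trans zero_le_power2)
    then show ?thesis
      by (intro real_le_rsqrt) (simp add: norm_mult norm_power power_mult_distrib)
  qed
  then show ?thesis unfolding eventually_at using \<rho>(1) by blast
qed

text \<open>By moderate growth the solution has at most a pole.  Comparing the terms of lowest order in the
  equation shows that the leading coefficient of a pole of order \<open>m\<close> is an eigenvector of the residue
  \<open>B\<close> for the eigenvalue \<open>-m\<close>; hence the order of the pole can be lowered step by step.\<close>

lemma bounded_near_regular_singularity:
  fixes a :: "complex \<Rightarrow> 'n::finite \<Rightarrow> 'n \<Rightarrow> complex"
  assumes "r > 0" and sol: "solves_system a y (ball c r - {c})"
    and lim: "\<And>k l. ((\<lambda>z. (z - c) * a z k l) \<longlongrightarrow> B k l) (at c)"
    and no_eigen: "\<And>m v. m \<ge> 1 \<Longrightarrow> (\<And>k. (\<Sum>l\<in>UNIV. B k l * v l) = - of_nat m * v k) \<Longrightarrow> v = (\<lambda>_. 0)"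
  shows "\<exists>M. \<forall>\<^sub>F z in at c. \<forall>k. cmod (y z k) \<le> M"
proof -
  have step: "\<exists>M. \<forall>\<^sub>F z in at c. \<forall>k. cmod ((z - c) ^ m * y z k) \<le> M"
    if bd: "\<forall>\<^sub>F z in at c. \<forall>k. cmod ((z - c) ^ Suc m * y z k) \<le> M" for m M
  proof -
    have ydiff: "((\<lambda>w. y w k) has_field_derivative (\<Sum>l\<in>UNIV. a z k l * y z l)) (at z)"
      if "z \<in> ball c r - {c}" for z k using sol that unfolding solves_system_def by blast
    have yhol: "(\<lambda>z. y z k) holomorphic_on ball c r - {c}" for k
      using ydiff unfolding holomorphic_on_def field_differentiable_def
      by (meson has_field_derivative_at_within)
    have "\<exists>g. g holomorphic_on ball c r \<and> (\<forall>z\<in>ball c r - {c}. g z = (z - c) ^ Suc m * y z k)" for k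
    proof (subst holomorphic_on_extend_bounded)
      show "(\<lambda>z. (z - c) ^ Suc m * y z k) holomorphic_on ball c r - {c}"
        by (intro holomorphic_intros yhol)
      show "c \<in> interior (ball c r)" using \<open>r > 0\<close> by simp
      show "\<exists>M. \<forall>\<^sub>F z in at c. cmod ((z - c) ^ Suc m * y z k) \<le> M"
        using bd by (intro exI[of _ M]) (auto elim: eventually_mono)
    qed
    \<comment> \<open>The extended functions \<open>h k\<close> have the leading coefficients as their values at \<open>c\<close>, and these vanish.\<close>
    then obtain h where h: "\<And>k. h k holomorphic_on ball c r"
      "\<And>k z. z \<in> ball c r - {c} \<Longrightarrow> h k z = (z - c) ^ Suc m * y z k" by metis
    have near: "\<forall>\<^sub>F z in at c. z \<in> ball c r - {c}"
      using \<open>r > 0\<close> by (intro eventually_at_in_open) auto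
    have hc: "(h k \<longlongrightarrow> h k c) (at c)" for k
      using h(1)[of k] \<open>r > 0\<close> holomorphic_on_imp_differentiable_at field_differentiable_imp_continuous_at
      by (metis centre_in_ball continuous_at open_ball)
    have hdc: "(deriv (h k) \<longlongrightarrow> deriv (h k) c) (at c)" for k
      using holomorphic_deriv[OF h(1)[of k] open_ball] \<open>r > 0\<close> holomorphic_on_imp_differentiable_at
        field_differentiable_imp_continuous_at
      by (metis centre_in_ball continuous_at open_ball)
    have "(\<Sum>l\<in>UNIV. B k l * h l c) = - of_nat (Suc m) * h k c" for k
    proof -
      have eq: "(z - c) * deriv (h k) z = of_nat (Suc m) * h k z + (\<Sum>l\<in>UNIV. (z - c) * a z k l * h l z)"
        if z: "z \<in> ball c r - {c}" for z
      proof -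
        let ?d = "of_nat (Suc m) * (z - c) ^ m * y z k + (\<Sum>l\<in>UNIV. a z k l * y z l) * (z - c) ^ Suc m"
        have "((\<lambda>w. (w - c) ^ Suc m) has_field_derivative of_nat (Suc m) * (z - c) ^ m) (at z)"
          by (rule derivative_eq_intros | simp)+
        from DERIV_mult[OF this ydiff[OF z, of k]]
        have "((\<lambda>w. (w - c) ^ Suc m * y w k) has_field_derivative ?d) (at z)" .
        then have "(h k has_field_derivative ?d) (at z)"
          by (rule has_field_derivative_transform_within_open[of _ _ _ "ball c r - {c}"])
             (use z h(2) in \<open>auto intro!: open_delete\<close>)
        then have dh: "deriv (h k) z = ?d" by (rule DERIV_imp_deriv)
        have e: "(\<Sum>l\<in>UNIV. (z - c) * a z k l * h l z)
            = (z - c) * ((\<Sum>l\<in>UNIV. a z k l * y z l) * (z - c) ^ Suc m)"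
          unfolding sum_distrib_left sum_distrib_right h(2)[OF z] by (simp add: mult_ac)
        show ?thesis unfolding dh e unfolding h(2)[OF z] distrib_left by (simp only: power_Suc mult_ac)
      qed
      have "((\<lambda>z. (z - c) * deriv (h k) z) \<longlongrightarrow> (c - c) * deriv (h k) c) (at c)"
        by (intro tendsto_intros hdc)
      moreover have "\<forall>\<^sub>F z in at c. (z - c) * deriv (h k) z
            = of_nat (Suc m) * h k z + (\<Sum>l\<in>UNIV. (z - c) * a z k l * h l z)"
        using near by eventually_elim (rule eq)
      ultimately have "((\<lambda>z. of_nat (Suc m) * h k z + (\<Sum>l\<in>UNIV. (z - c) * a z k l * h l z))
            \<longlongrightarrow> (c - c) * deriv (h k) c) (at c)"
        by (rule Lim_transform_eventually)
      moreover have "((\<lambda>z. of_nat (Suc m) * h k z + (\<Sum>l\<in>UNIV. (z - c) * a z k l * h l z))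
            \<longlongrightarrow> of_nat (Suc m) * h k c + (\<Sum>l\<in>UNIV. B k l * h l c)) (at c)"
        by (intro tendsto_intros hc lim)
      ultimately have "(c - c) * deriv (h k) c = of_nat (Suc m) * h k c + (\<Sum>l\<in>UNIV. B k l * h l c)"
        by (rule tendsto_unique[OF trivial_limit_at])
      then have "(\<Sum>l\<in>UNIV. B k l * h l c) + of_nat (Suc m) * h k c = 0" by (simp only: diff_self mult_zero_left add.commute)
      then show ?thesis by (simp only: add_eq_0_iff minus_mult_left mult_minus_left minus_minus)
    qed
    from no_eigen[OF _ this] have h0: "h k c = 0" for k by (auto simp: fun_eq_iff)
    have "\<forall>\<^sub>F z in at c. \<forall>k. cmod ((z - c) ^ m * y z k) \<le> cmod (deriv (h k) c) + 1"
    proof (intro eventually_all_finite)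
      fix k
      have "(h k has_field_derivative deriv (h k) c) (at c)"
        using h(1)[of k] \<open>r > 0\<close> holomorphic_derivI by (metis centre_in_ball open_ball)
      then have "((\<lambda>z. (h k z - h k c) / (z - c)) \<longlongrightarrow> deriv (h k) c) (at c)"
        by (simp add: has_field_derivative_iff DERIV_def LIM_offset_zero_iff)
      from order_tendstoD(2)[OF tendsto_norm[OF this], of "cmod (deriv (h k) c) + 1"]
      have "\<forall>\<^sub>F z in at c. cmod ((h k z - h k c) / (z - c)) < cmod (deriv (h k) c) + 1" by simp
      with near show "\<forall>\<^sub>F z in at c. cmod ((z - c) ^ m * y z k) \<le> cmod (deriv (h k) c) + 1"
      proof eventually_elim
        case (elim z)
        have "(h k z - h k c) / (z - c) = (z - c) ^ m * y z k"
          using elim(1) unfolding h(2)[OF elim(1)] h0 by simp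
        then show ?case using elim(2) by simp
      qed
    qed
    moreover have "cmod (deriv (h k) c) + 1 \<le> (\<Sum>k\<in>UNIV. cmod (deriv (h k) c) + 1)" for k
      by (rule member_le_sum) auto
    ultimately show ?thesis
      by (intro exI[of _ "\<Sum>k\<in>UNIV. cmod (deriv (h k) c) + 1"])
         (auto elim!: eventually_mono intro: order_trans)
  qed
  have "(\<exists>M. \<forall>\<^sub>F z in at c. \<forall>k. cmod ((z - c) ^ m * y z k) \<le> M) \<Longrightarrow> ?thesis" for m
  proof (induction m)
    case 0 then show ?case by simp
  next
    case (Suc m) then show ?case using step by blast
  qed
  then show ?thesis using moderate_growth[OF \<open>r > 0\<close> sol lim] by blast
qed

section \<open>Single-valued solutions of Fuchsian systems\<close>

lemma simple_pole_limit:
  fixes b :: "complex \<Rightarrow> complex"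
  assumes "finite F" "c \<in> F"
  shows "((\<lambda>z. (z - c) * (\<Sum>i\<in>F. b i / (z - i))) \<longlongrightarrow> b c) (at c)"
proof -
  have "((\<lambda>z. \<Sum>i\<in>F. (z - c) * (b i / (z - i))) \<longlongrightarrow> (\<Sum>i\<in>F. if i = c then b c else 0)) (at c)"
  proof (rule tendsto_sum)
    fix i assume "i \<in> F"
    show "((\<lambda>z. (z - c) * (b i / (z - i))) \<longlongrightarrow> (if i = c then b c else 0)) (at c)"
    proof (cases "i = c")
      case True
      have "\<forall>\<^sub>F z in at c. (z - c) * (b c / (z - c)) = b c"
        unfolding eventually_at by (rule exI[of _ 1]) auto
      then show ?thesis using True by (simp add: tendsto_eventually)
    next
      case False
      have "((\<lambda>z. (z - c) * (b i / (z - i))) \<longlongrightarrow> (c - c) * (b i / (c - i))) (at c)"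
        using False by (intro tendsto_intros) auto
      then show ?thesis using False by simp
    qed
  qed
  then show ?thesis using assms by (simp add: sum_distrib_left)
qed

text \<open>No pole can occur at a finite singular point, and after the substitution \<open>w = 1/z\<close>, under which the
  residue at infinity becomes minus the sum of the others, none at infinity.  So the solution is entire
  and bounded.  Inserting the constant into the equation and taking residues gives the second claim.\<close>

lemma single_valued_solution_constant:
  fixes B :: "complex \<Rightarrow> 'n::finite \<Rightarrow> 'n \<Rightarrow> complex"
  assumes F: "finite F"
    and sol: "solves_system (\<lambda>z k l. \<Sum>i\<in>F. B i k l / (z - i)) y (- F)"
    and no_eigen: "\<And>i m v. i \<in> F \<Longrightarrow> m \<ge> 1 \<Longrightarrow>
          (\<And>k. (\<Sum>l\<in>UNIV. B i k l * v l) = - of_nat m * v k) \<Longrightarrow> v = (\<lambda>_. 0)"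
    and no_eigen_inf: "\<And>m v. m \<ge> 1 \<Longrightarrow>
          (\<And>k. (\<Sum>l\<in>UNIV. (\<Sum>i\<in>F. B i k l) * v l) = of_nat m * v k) \<Longrightarrow> v = (\<lambda>_. 0)"
  shows "\<exists>c. (\<forall>z\<in>-F. y z = c) \<and> (\<forall>i\<in>F. \<forall>k. (\<Sum>l\<in>UNIV. B i k l * c l) = 0)"
proof -
  let ?a = "\<lambda>z k l. \<Sum>i\<in>F. B i k l / (z - i)"
  have yder: "((\<lambda>w. y w k) has_field_derivative (\<Sum>l\<in>UNIV. ?a z k l * y z l)) (at z)" if "z \<notin> F" for z k
    using sol that unfolding solves_system_def by blast
  have yhol: "(\<lambda>z. y z k) holomorphic_on - F" for k
    using yder unfolding holomorphic_on_def field_differentiable_def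
    by (meson ComplD has_field_derivative_at_within)
  have local: "(\<lambda>z. y z k) \<in> O[at c](\<lambda>_. 1)" if "c \<in> F" for c k
  proof -
    have "open (- (F - {c}))" by (intro open_Compl finite_imp_closed finite_Diff F)
    then obtain r where r: "r > 0" "ball c r \<subseteq> - (F - {c})"
      by (metis ComplI Diff_iff insertI1 open_contains_ball)
    have loc: "solves_system ?a y (ball c r - {c})"
      using sol r(2) unfolding solves_system_def by blast
    have "\<exists>M. \<forall>\<^sub>F z in at c. \<forall>k. cmod (y z k) \<le> M"
      by (rule bounded_near_regular_singularity[OF r(1) loc simple_pole_limit[OF F that]])
         (rule no_eigen[OF that])
    then obtain M where "\<forall>\<^sub>F z in at c. \<forall>k. cmod (y z k) \<le> M" by blast
    then show ?thesis by (intro bigoI[of _ M]) (auto elim: eventually_mono)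
  qed
  have "\<exists>g. g holomorphic_on UNIV \<and> (\<forall>z\<in>UNIV-F. g z = y z k)" for k
    by (rule removable_singularities[OF F]) (use yhol local in \<open>auto simp: Compl_eq_Diff_UNIV\<close>)
  then obtain g where g: "\<And>k. g k holomorphic_on UNIV" "\<And>k z. z \<notin> F \<Longrightarrow> g k z = y z k"
    by (metis DiffI UNIV_I)
  define u where "u w k = y (inverse w) k" for w k
  define b where "b w k l = - (inverse w)\<^sup>2 * ?a (inverse w) k l" for w k l
  define R where "R = 1 + (\<Sum>i\<in>F. cmod i)"
  have R: "R > 0" "\<And>i. i \<in> F \<Longrightarrow> cmod i < R"
  proof -
    show "R > 0" unfolding R_def by (intro add_pos_nonneg sum_nonneg) auto
    show "cmod i < R" if "i \<in> F" for i
      using member_le_sum[OF that, of cmod] F unfolding R_def by simp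
  qed
  have inv_notin: "inverse (w::complex) \<notin> F" if "(w::complex) \<in> ball 0 (inverse R) - {0}" for w
  proof
    assume "inverse w \<in> F"
    then have "inverse (cmod w) < R" using R(2) by (metis norm_inverse)
    moreover have "0 < cmod w" "cmod w < inverse R" using that by auto
    then have "inverse (cmod w) > R" using R(1) by (metis inverse_inverse_eq less_imp_inverse_less)
    ultimately show False by simp
  qed
  have u_sol: "solves_system b u (ball 0 (inverse R) - {0})"
    unfolding solves_system_def
  proof (intro ballI allI)
    fix w :: complex and k assume w: "w \<in> ball 0 (inverse R) - {0}"
    have "(inverse has_field_derivative - (inverse w)\<^sup>2) (at w)"
      using w by (auto intro!: derivative_eq_intros simp: power2_eq_square)
    from DERIV_chain2[OF yder[OF inv_notin[OF w]] this]
    show "((\<lambda>w. u w k) has_field_derivative (\<Sum>l\<in>UNIV. b w k l * u w l)) (at w)"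
      unfolding u_def b_def by (simp add: sum_distrib_left sum_distrib_right mult_ac)
  qed
  have b_lim: "((\<lambda>w. (w - 0) * b w k l) \<longlongrightarrow> - (\<Sum>i\<in>F. B i k l)) (at 0)" for k l
  proof -
    have "((\<lambda>w. - (\<Sum>i\<in>F. B i k l / (1 - i * w))) \<longlongrightarrow> - (\<Sum>i\<in>F. B i k l / (1 - i * 0))) (at 0)"
      by (intro tendsto_intros) auto
    moreover have "\<forall>\<^sub>F w in at 0. - (\<Sum>i\<in>F. B i k l / (1 - i * w)) = (w - 0) * b w k l"
    proof -
      have "\<forall>\<^sub>F w in at 0. w \<in> ball 0 (inverse R) - {0}"
        using R(1) by (intro eventually_at_in_open) auto
      then show ?thesis
      proof eventually_elim
        case (elim w)
        then have w: "w \<noteq> 0" by simp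
        have "w * (inverse w)\<^sup>2 * (B i k l / (inverse w - i)) = B i k l / (1 - i * w)" for i
        proof -
          have "w * (inverse w - i) = 1 - i * w" using w by (simp add: algebra_simps)
          then have "B i k l / (1 - i * w) = inverse w * (B i k l / (inverse w - i))"
            using w by (metis (no_types, lifting) divide_divide_eq_left' inverse_eq_divide mult.commute mult.left_neutral times_divide_eq_left)
          moreover have "w * (inverse w)\<^sup>2 = inverse w" using w by (simp add: power2_eq_square)
          ultimately show ?thesis by simp
        qed
        then show ?case by (simp add: b_def sum_distrib_left sum_negf mult.assoc[symmetric])
      qed
    qed
    ultimately have "((\<lambda>w. (w - 0) * b w k l) \<longlongrightarrow> - (\<Sum>i\<in>F. B i k l / (1 - i * 0))) (at 0)"
      by (rule Lim_transform_eventually)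
    then show ?thesis by simp
  qed
  have "\<exists>M. \<forall>\<^sub>F w in at 0. \<forall>k. cmod (u w k) \<le> M"
  proof (rule bounded_near_regular_singularity[OF _ u_sol b_lim])
    show "inverse R > 0" using R(1) by simp
    show "v = (\<lambda>_. 0)" if "m \<ge> 1" "\<And>k. (\<Sum>l\<in>UNIV. - (\<Sum>i\<in>F. B i k l) * v l) = - of_nat m * v k" for m v
      using that by (intro no_eigen_inf[of m]) (auto simp: sum_negf)
  qed
  then obtain M d where M: "d > 0" "\<And>w k. w \<noteq> 0 \<Longrightarrow> cmod w < d \<Longrightarrow> cmod (u w k) \<le> M"
    unfolding eventually_at by auto
  define A where "A = R + inverse d + 1"
  have const: "g k z = g k 0" for k z
  proof -
    have "cmod (g k w) \<le> M * cmod w ^ 0" if "A \<le> cmod w" for w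
    proof -
      have w: "cmod w > R" "cmod w > inverse d" 
        using that R(1) positive_imp_inverse_positive[OF M(1)] unfolding A_def by linarith+
      then have "w \<noteq> 0" "w \<notin> F" using R by force+
      moreover have "cmod (inverse w) < d"
        using w(2) M(1) by (metis inverse_inverse_eq inverse_positive_iff_positive less_imp_inverse_less norm_inverse)
      ultimately show ?thesis using M(2)[of "inverse w" k] g(2)[of w k] by (simp add: u_def)
    qed
    from Liouville_polynomial[OF g(1) this, where \<xi> = z] show ?thesis by simp
  qed
  define c where "c k = g k 0" for k
  have yc: "y z = c" if "z \<notin> F" for z
    using g(2)[OF that] const[of _ z] unfolding c_def fun_eq_iff by metis
  have zero: "(\<Sum>l\<in>UNIV. ?a z k l * c l) = 0" if z: "z \<notin> F" for z k
  proof -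
    have "((\<lambda>w. c k) has_field_derivative (\<Sum>l\<in>UNIV. ?a z k l * y z l)) (at z)"
    proof (rule has_field_derivative_transform_within_open[OF yder[OF z], of "- F"])
      show "open (- F)" by (intro open_Compl finite_imp_closed F)
      show "y w k = c k" if "w \<in> - F" for w using yc[of w] that by simp
    qed (use z in simp)
    from DERIV_unique[OF this DERIV_const] show ?thesis unfolding yc[OF z] .
  qed
  have "(\<Sum>l\<in>UNIV. B i k l * c l) = 0" if i: "i \<in> F" for i k
  proof -
    have "((\<lambda>z. \<Sum>l\<in>UNIV. ((z - i) * ?a z k l) * c l) \<longlongrightarrow> (\<Sum>l\<in>UNIV. B i k l * c l)) (at i)"
      by (intro tendsto_intros simple_pole_limit F i)
    moreover have "\<forall>\<^sub>F z in at i. (\<Sum>l\<in>UNIV. ((z - i) * ?a z k l) * c l) = 0"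
    proof -
      have "\<forall>\<^sub>F z in at i. z \<in> - (F - {i}) - {i}"
        by (intro eventually_at_in_open open_Compl finite_imp_closed finite_Diff F) simp
      then show ?thesis
      proof eventually_elim
        case (elim z)
        then have "(z - i) * (\<Sum>l\<in>UNIV. ?a z k l * c l) = 0" using zero[of z k] by auto
        then show ?case
          unfolding sum_distrib_left[where r = "z - i" and f = "\<lambda>l. ?a z k l * c l"] by (simp only: mult.assoc)
      qed
    qed
    ultimately have "((\<lambda>z. 0) \<longlongrightarrow> (\<Sum>l\<in>UNIV. B i k l * c l)) (at i)"
      by (rule Lim_transform_eventually)
    then show ?thesis using tendsto_unique[OF trivial_limit_at tendsto_const] by metis
  qed
  then show ?thesis using yc by (intro exI[of _ c]) auto
qed

section \<open>Two by two matrices\<close>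

lemma mat2_nth [simp]:
  "mat2 a b c d $ 1 $ 1 = a" "mat2 a b c d $ 1 $ 2 = b"
  "mat2 a b c d $ 2 $ 1 = c" "mat2 a b c d $ 2 $ 2 = d"
  by (simp_all add: mat2_def)

lemma matrix2_eq_iff:
  fixes X Y :: "complex^2^2"
  shows "X = Y \<longleftrightarrow> X $ 1 $ 1 = Y $ 1 $ 1 \<and> X $ 1 $ 2 = Y $ 1 $ 2 \<and>
                   X $ 2 $ 1 = Y $ 2 $ 1 \<and> X $ 2 $ 2 = Y $ 2 $ 2"
  by (auto simp: vec_eq_iff forall_2)

lemma matrix2_mult_nth:
  fixes X Y :: "complex^2^2"
  shows "(X ** Y) $ k $ l = X $ k $ 1 * Y $ 1 $ l + X $ k $ 2 * Y $ 2 $ l"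
  by (simp add: matrix_matrix_mult_def sum_2)

lemma matrix2_mult_zero [simp]: "(0::complex^2^2) ** X = 0" "X ** (0::complex^2^2) = 0"
  by (simp_all add: vec_eq_iff matrix2_mult_nth)

lemma map_matrix_cnj_mult:
  fixes X Y :: "complex^2^2"
  shows "map_matrix cnj (X ** Y) = map_matrix cnj X ** map_matrix cnj Y"
  by (simp add: vec_eq_iff matrix2_mult_nth)

lemma map_matrix_cnj_mat_1 [simp]: "map_matrix cnj (mat 1) = (mat 1 :: complex^2^2)"
  by (simp add: vec_eq_iff mat_def)

lemma matrix_inv_unique: "X ** Y = mat 1 \<Longrightarrow> matrix_inv Y = (X::complex^2^2)"
  unfolding matrix_inv_def
  by (rule some_equality) (metis matrix_left_right_inverse matrix_mul_assoc matrix_mul_lid matrix_mul_rid)+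

lemma matrix2_minus_mult [simp]:
  fixes X Y :: "complex^2^2"
  shows "(- X) ** Y = - (X ** Y)" "X ** (- Y) = - (X ** Y)"
  by (simp_all add: vec_eq_iff matrix2_mult_nth)

lemma matrix2_inverse_sym:
  fixes X Y :: "complex^2^2"
  shows "X ** Y = mat 1 \<Longrightarrow> Y ** X = mat 1"
  by (simp only: matrix_left_right_inverse)

lemma matrix2_cancel_left:
  fixes X Y Z :: "complex^2^2"
  shows "X ** Y = mat 1 \<Longrightarrow> X ** (Y ** Z) = Z"
  by (simp add: matrix_mul_assoc)

lemma matrix2_sum_mult:
  fixes M :: "'i \<Rightarrow> complex^2^2"
  shows "(\<Sum>i\<in>S. M i) ** C = (\<Sum>i\<in>S. M i ** C)" "C ** (\<Sum>i\<in>S. M i) = (\<Sum>i\<in>S. C ** M i)"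
  by (simp_all add: vec_eq_iff matrix2_mult_nth sum_distrib_left sum_distrib_right sum.distrib)

lemma map_matrix_cnj_sum:
  fixes M :: "'i \<Rightarrow> complex^2^2"
  shows "map_matrix cnj (\<Sum>i\<in>S. M i) = (\<Sum>i\<in>S. map_matrix cnj (M i))"
  by (simp add: vec_eq_iff)

definition mat_deriv :: "(complex \<Rightarrow> complex^2^2) \<Rightarrow> complex^2^2 \<Rightarrow> complex \<Rightarrow> bool" where
  "mat_deriv F D z \<longleftrightarrow> (\<forall>k l. ((\<lambda>w. F w $ k $ l) has_field_derivative D $ k $ l) (at z))"

lemma mat_deriv_const: "mat_deriv (\<lambda>_. C) 0 z"
  by (simp add: mat_deriv_def)

lemma mat_deriv_mult:
  assumes "mat_deriv F D z" "mat_deriv G E z"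
  shows "mat_deriv (\<lambda>w. F w ** G w) (D ** G z + F z ** E) z"
  unfolding mat_deriv_def
proof (intro allI)
  fix k l
  have F: "((\<lambda>w. F w $ i $ j) has_field_derivative D $ i $ j) (at z)"
    and G: "((\<lambda>w. G w $ i $ j) has_field_derivative E $ i $ j) (at z)" for i j
    using assms by (auto simp: mat_deriv_def)
  show "((\<lambda>w. (F w ** G w) $ k $ l) has_field_derivative (D ** G z + F z ** E) $ k $ l) (at z)"
    using DERIV_add[OF DERIV_mult[OF F[of k 1] G[of 1 l]] DERIV_mult[OF F[of k 2] G[of 2 l]]]
    by (simp add: matrix2_mult_nth algebra_simps)
qed

lemma mat_deriv_mult_right: "mat_deriv F D z \<Longrightarrow> mat_deriv (\<lambda>w. F w ** C) (D ** C) z"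
  using mat_deriv_mult[OF _ mat_deriv_const, of F D z C] by simp

lemma mat_deriv_mult_left: "mat_deriv F D z \<Longrightarrow> mat_deriv (\<lambda>w. C ** F w) (C ** D) z"
  using mat_deriv_mult[OF mat_deriv_const, of F D z C] by simp

text \<open>Conjugation of the argument and of the value turns holomorphic functions into holomorphic ones.\<close>

lemma mat_deriv_cnj:
  assumes "mat_deriv F D (cnj z)"
  shows "mat_deriv (\<lambda>w. map_matrix cnj (F (cnj w))) (map_matrix cnj D) z"
  unfolding mat_deriv_def
proof (intro allI)
  fix k l
  have "((\<lambda>w. F w $ k $ l) has_field_derivative D $ k $ l) (at (cnj z))"
    using assms by (simp add: mat_deriv_def)
  from has_field_derivative_cnj_cnj[OF this]
  show "((\<lambda>w. map_matrix cnj (F (cnj w)) $ k $ l) has_field_derivative map_matrix cnj D $ k $ l) (at z)"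
    by (simp add: o_def)
qed

lemma mat_deriv_transform:
  assumes "mat_deriv F D z" "\<forall>\<^sub>F w in nhds z. F w = G w"
  shows "mat_deriv G D z"
  unfolding mat_deriv_def
proof (intro allI)
  fix k l
  have "\<forall>\<^sub>F w in nhds z. F w $ k $ l = G w $ k $ l"
    using assms(2) by eventually_elim simp
  from DERIV_cong_ev[OF refl this refl]
  show "((\<lambda>w. G w $ k $ l) has_field_derivative D $ k $ l) (at z)"
    using assms(1) unfolding mat_deriv_def by blast
qed

lemma mat_deriv_zero_constant:
  assumes "open U" "connected U" "\<And>z. z \<in> U \<Longrightarrow> mat_deriv F 0 z"
  shows "\<exists>C. \<forall>z\<in>U. F z = C"
proof -
  have "(\<lambda>z. F z $ k $ l) constant_on U" for k l
    using assms by (intro has_field_derivative_0_imp_constant_on) (auto simp: mat_deriv_def)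
  then obtain c where "\<And>k l z. z \<in> U \<Longrightarrow> F z $ k $ l = c k l"
    unfolding constant_on_def by metis
  then show ?thesis by (intro exI[of _ "\<chi> k l. c k l"]) (simp add: vec_eq_iff)
qed

lemma mat_deriv_holomorphic:
  assumes "\<And>z. z \<in> U \<Longrightarrow> mat_deriv F (D z) z"
  shows "(\<lambda>z. F z $ k $ l) holomorphic_on U"
  using assms unfolding holomorphic_on_def field_differentiable_def mat_deriv_def
  by (meson has_field_derivative_at_within)

text \<open>The matrix, indexed by pairs, of the linear map \<open>X \<mapsto> P X - X R\<close>.  It makes the results on linear
  systems available for matrix equations.\<close>

definition sylvester :: "complex^2^2 \<Rightarrow> complex^2^2 \<Rightarrow> 2 \<times> 2 \<Rightarrow> 2 \<times> 2 \<Rightarrow> complex" where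
  "sylvester P R = (\<lambda>(k, l) (p, q). (if q = l then P $ k $ p else 0) - (if p = k then R $ q $ l else 0))"

lemma sum_sylvester:
  "(\<Sum>x\<in>UNIV. sylvester P R (k, l) x * X $ fst x $ snd x) = (P ** X - X ** R) $ k $ l"
proof -
  have "(\<Sum>x\<in>UNIV. sylvester P R (k, l) x * X $ fst x $ snd x)
        = (\<Sum>p\<in>UNIV. \<Sum>q\<in>UNIV. sylvester P R (k, l) (p, q) * X $ p $ q)"
    by (simp add: sum.cartesian_product UNIV_Times_UNIV[symmetric] case_prod_unfold del: UNIV_Times_UNIV)
  then show ?thesis
    using exhaust_2[of k] exhaust_2[of l] by (auto simp: sylvester_def matrix2_mult_nth sum_2 algebra_simps)
qed

lemma sylvester_equation_exists:
  assumes "open U" "z0 \<in> U" "\<And>z. z \<in> U \<Longrightarrow> closed_segment z0 z \<subseteq> U"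
    and "\<And>k l. (\<lambda>z. P z $ k $ l) holomorphic_on U" "\<And>k l. (\<lambda>z. R z $ k $ l) holomorphic_on U"
  shows "\<exists>X. X z0 = C \<and> (\<forall>z\<in>U. mat_deriv X (P z ** X z - X z ** R z) z)"
proof -
  have hol: "(\<lambda>z. sylvester (P z) (R z) x w) holomorphic_on U" for x w
  proof -
    obtain k l p q where "x = (k, l)" "w = (p, q)" by (cases x; cases w)
    then show ?thesis
      using assms(4)[of k p] assms(5)[of q l] unfolding sylvester_def
      by (cases "q = l"; cases "p = k") (auto intro!: holomorphic_intros)
  qed
  have "\<exists>y. y z0 = (\<lambda>(k, l). C $ k $ l) \<and> solves_system (\<lambda>z. sylvester (P z) (R z)) y U"
    by (rule linear_system_exists[OF assms(1,2) _ hol]) (rule assms(3))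
  then obtain y where y0: "y z0 = (\<lambda>(k, l). C $ k $ l)"
    and y: "solves_system (\<lambda>z. sylvester (P z) (R z)) y U"
    by blast
  define X where "X z = (\<chi> k l. y z (k, l))" for z
  have X: "y z x = X z $ fst x $ snd x" for x z by (simp add: X_def)
  have "mat_deriv X (P z ** X z - X z ** R z) z" if "z \<in> U" for z
    unfolding mat_deriv_def
  proof (intro allI)
    fix k l
    have "((\<lambda>w. y w (k, l)) has_field_derivative (\<Sum>x\<in>UNIV. sylvester (P z) (R z) (k, l) x * y z x)) (at z)"
      using y that unfolding solves_system_def by blast
    then show "((\<lambda>w. X w $ k $ l) has_field_derivative (P z ** X z - X z ** R z) $ k $ l) (at z)"
      by (simp only: X sum_sylvester fst_conv snd_conv)
  qed
  moreover have "X z0 = C" by (simp add: X_def y0 vec_eq_iff)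
  ultimately show ?thesis by blast
qed

text \<open>A fundamental matrix \<open>\<Phi>\<close> together with its inverse \<open>\<Psi>\<close>, which solves the adjoint equation.  Keeping
  both avoids differentiating the matrix inverse.\<close>

definition fundamental_pair ::
    "(complex \<Rightarrow> complex^2^2) \<Rightarrow> complex set \<Rightarrow> (complex \<Rightarrow> complex^2^2) \<Rightarrow> (complex \<Rightarrow> complex^2^2) \<Rightarrow> bool" where
  "fundamental_pair B V \<Phi> \<Psi> \<longleftrightarrow>
     (\<forall>z\<in>V. mat_deriv \<Phi> (B z ** \<Phi> z) z \<and> mat_deriv \<Psi> (- (\<Psi> z ** B z)) z \<and> \<Psi> z ** \<Phi> z = mat 1)"

text \<open>Solve the equation and its adjoint with initial value the unit matrix: the product \<open>\<Psi> \<Phi>\<close> is constant,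
  so \<open>\<Phi>\<close> is invertible everywhere.\<close>

lemma fundamental_solution_exists:
  assumes "open U" "z0 \<in> U" "\<And>z. z \<in> U \<Longrightarrow> closed_segment z0 z \<subseteq> U"
    and A: "\<And>k l. (\<lambda>z. A z $ k $ l) holomorphic_on U"
  shows "\<exists>\<Phi> \<Psi>. fundamental_pair A U \<Phi> \<Psi>"
proof -
  have 0: "(\<lambda>z. (0::complex^2^2) $ k $ l) holomorphic_on U" for k l by simp
  obtain \<Phi> where \<Phi>: "\<Phi> z0 = mat 1" "\<And>z. z \<in> U \<Longrightarrow> mat_deriv \<Phi> (A z ** \<Phi> z) z"
    using sylvester_equation_exists[OF assms(1-3) A 0, of "mat 1"] by auto
  obtain \<Psi> where \<Psi>: "\<Psi> z0 = mat 1" "\<And>z. z \<in> U \<Longrightarrow> mat_deriv \<Psi> (- (\<Psi> z ** A z)) z"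
    using sylvester_equation_exists[OF assms(1-3) 0 A, of "mat 1"] by auto
  have "connected U"
    using assms(2,3) by (intro starlike_imp_connected) (auto simp: starlike_def)
  moreover have "mat_deriv (\<lambda>w. \<Psi> w ** \<Phi> w) 0 z" if "z \<in> U" for z
  proof -
    have "- (\<Psi> z ** A z) ** \<Phi> z + \<Psi> z ** (A z ** \<Phi> z) = 0"
      by (simp add: vec_eq_iff matrix2_mult_nth algebra_simps)
    then show ?thesis using mat_deriv_mult[OF \<Psi>(2) \<Phi>(2), OF that that] by simp
  qed
  ultimately obtain C where "\<And>z. z \<in> U \<Longrightarrow> \<Psi> z ** \<Phi> z = C"
    using mat_deriv_zero_constant[OF assms(1), of "\<lambda>w. \<Psi> w ** \<Phi> w"] by blast
  then have "\<Psi> z ** \<Phi> z = mat 1" if "z \<in> U" for z using that \<Phi>(1) \<Psi>(1) assms(2) by (metis matrix_mul_lid)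
  then have "fundamental_pair A U \<Phi> \<Psi>" using \<Phi>(2) \<Psi>(2) by (simp add: fundamental_pair_def)
  then show ?thesis by blast
qed

lemma has_eigenvalues_iff: "has_eigenvalues B u v \<longleftrightarrow> trace B = u + v \<and> det B = u * v"
proof
  assume "has_eigenvalues B u v"
  then have *: "det (mat z - B) = (z - u) * (z - v)" for z by (simp add: has_eigenvalues_def)
  show "trace B = u + v \<and> det B = u * v"
    using *[of 0] *[of 1] by (auto simp: det_2 mat_def trace_def sum_2 algebra_simps)
next
  assume *: "trace B = u + v \<and> det B = u * v"
  show "has_eigenvalues B u v"
    unfolding has_eigenvalues_def
  proof
    fix z
    have "det (mat z - B) = z * z - trace B * z + det B"
      by (simp add: det_2 mat_def trace_def sum_2 algebra_simps)
    then show "det (mat z - B) = (z - u) * (z - v)" using * by (simp add: algebra_simps)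
  qed
qed

text \<open>If \<open>P X - X R = \<mu> X\<close>, then \<open>(P - \<mu>) X = X R\<close>, so the characteristic polynomial of \<open>R\<close>, applied to
  \<open>P - \<mu>\<close>, annihilates \<open>X\<close>; but \<open>P - \<mu>\<close> and \<open>R\<close> have no common eigenvalue.\<close>

lemma sylvester_no_integer_eigenvalue:
  assumes P: "has_eigenvalues P u v" and R: "has_eigenvalues R u v"
    and uv: "u - v \<notin> \<int> - {0}"
    and \<mu>: "\<mu> \<in> \<int>" "\<mu> \<noteq> 0"
    and eq: "\<And>k l. (P ** X - X ** R) $ k $ l = \<mu> * X $ k $ l"
  shows "X = 0"
proof -
  define Q where "Q = P - mat \<mu>"
  have QX: "Q ** X = X ** R"
    using eq[of 1 1] eq[of 1 2] eq[of 2 1] eq[of 2 2]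
    by (simp add: matrix2_eq_iff matrix2_mult_nth Q_def mat_def algebra_simps)
  have uQ: "(mat w - Q) ** X = X ** (mat w - R)" for w
    using QX by (simp add: matrix2_eq_iff matrix2_mult_nth mat_def algebra_simps)
  have "(mat u - R) ** (mat v - R) = 0"
  proof -
    have u: "u = R $ 1 $ 1 + R $ 2 $ 2 - v" and d: "R $ 1 $ 1 * R $ 2 $ 2 - R $ 1 $ 2 * R $ 2 $ 1 = u * v"
      using R by (auto simp: has_eigenvalues_iff trace_def sum_2 det_2)
    show ?thesis using d unfolding u
      by (simp add: matrix2_eq_iff matrix2_mult_nth mat_def) (simp add: algebra_simps)
  qed
  moreover have "(mat u - Q) ** ((mat v - Q) ** X) = X ** ((mat u - R) ** (mat v - R))"
    by (simp add: uQ matrix_mul_assoc)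
  ultimately have 0: "(mat u - Q) ** ((mat v - Q) ** X) = 0"
    by (simp add: vec_eq_iff matrix2_mult_nth)
  have inv: "invertible (mat w - Q)" if "w + \<mu> \<noteq> u" "w + \<mu> \<noteq> v" for w
  proof -
    have "mat w - Q = mat (w + \<mu>) - P" by (simp add: Q_def vec_eq_iff mat_def)
    then have "det (mat w - Q) \<noteq> 0" using P that by (simp add: has_eigenvalues_def)
    then show ?thesis by (simp add: invertible_det_nz)
  qed
  have "u - v \<noteq> - \<mu>" "u - v \<noteq> \<mu>" using uv \<mu> by (metis DiffI Ints_minus empty_iff insert_iff neg_equal_0_iff_equal)+
  then have "u + \<mu> \<noteq> v" "v + \<mu> \<noteq> u" by (metis add_diff_cancel_left' minus_diff_eq, metis add_diff_cancel_left')
  with inv[of u] inv[of v] \<mu>(2) have "invertible (mat u - Q)" "invertible (mat v - Q)" by simp_all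
  moreover have "Z = 0" if Y: "invertible Y" and YZ: "Y ** Z = 0" for Y Z :: "complex^2^2"
  proof -
    obtain Y' where "Y' ** Y = mat 1" using Y unfolding invertible_left_inverse ..
    then have "Z = Y' ** (Y ** Z)" by (simp add: matrix_mul_assoc)
    then show ?thesis using YZ by simp
  qed
  ultimately show ?thesis using 0 by blast
qed

definition fuchs :: "complex set \<Rightarrow> (complex \<Rightarrow> complex^2^2) \<Rightarrow> complex \<Rightarrow> complex^2^2" where
  "fuchs F P z = (\<chi> k l. \<Sum>i\<in>F. P i $ k $ l / (z - i))"

text \<open>The same two eigenvalues, with a difference that is not a nonzero integer.  Equal eigenvalues \<open>u = v\<close> are admitted, so
  that the relation holds for two zero matrices, the residues at points that are not poles.\<close>

definition isospectral :: "complex^2^2 \<Rightarrow> complex^2^2 \<Rightarrow> bool" where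
  "isospectral P R \<longleftrightarrow> (\<exists>u v. has_eigenvalues P u v \<and> has_eigenvalues R u v \<and> u - v \<notin> \<int> - {0})"

text \<open>The equation for \<open>T\<close> is a linear system with residues \<open>X \<mapsto> P\<^sub>i X - X R\<^sub>i\<close>, and none of them, infinity
  included, has a nonzero integer eigenvalue.\<close>

lemma rigidity:
  assumes F: "finite F"
    and T: "\<And>z. z \<notin> F \<Longrightarrow> mat_deriv T (fuchs F P z ** T z - T z ** fuchs F R z) z"
    and loc: "\<And>i. i \<in> F \<Longrightarrow> isospectral (P i) (R i)"
    and inf: "isospectral (\<Sum>i\<in>F. P i) (\<Sum>i\<in>F. R i)"
  shows "\<exists>C. (\<forall>z\<in>-F. T z = C) \<and> (\<forall>i\<in>F. P i ** C = C ** R i)"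
proof -
  define y where "y z x = T z $ fst x $ snd x" for z and x :: "2 \<times> 2"
  have zero: "v = (\<lambda>_. 0)"
    if "isospectral P' R'" "\<mu> \<in> \<int>" "\<mu> \<noteq> 0"
      "\<And>x. (\<Sum>w\<in>UNIV. sylvester P' R' x w * v w) = \<mu> * v x" for P' R' \<mu> v
  proof -
    define X :: "complex^2^2" where "X = (\<chi> k l. v (k, l))"
    have X: "v = (\<lambda>x. X $ fst x $ snd x)" by (simp add: X_def)
    have "(P' ** X - X ** R') $ k $ l = \<mu> * X $ k $ l" for k l
      using that(4)[of "(k, l)"] by (simp only: X sum_sylvester fst_conv snd_conv)
    then have "X = 0"
      using that(1-3) sylvester_no_integer_eigenvalue unfolding isospectral_def by blast
    then show ?thesis by (simp add: X)
  qed
  have sylv_fuchs: "(\<Sum>i\<in>F. sylvester (P i) (R i) x w / (z - i)) = sylvester (fuchs F P z) (fuchs F R z) x w" for z x w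
    by (cases x; cases w) (auto simp: sylvester_def fuchs_def diff_divide_distrib sum_subtractf sum_negf)
  have sylv_sum: "(\<Sum>i\<in>F. sylvester (P i) (R i) x w) = sylvester (\<Sum>i\<in>F. P i) (\<Sum>i\<in>F. R i) x w" for x w
    by (cases x; cases w) (auto simp: sylvester_def sum_subtractf sum_negf)
  have "\<exists>c. (\<forall>z\<in>-F. y z = c) \<and> (\<forall>i\<in>F. \<forall>x. (\<Sum>w\<in>UNIV. sylvester (P i) (R i) x w * c w) = 0)"
  proof (rule single_valued_solution_constant[OF F, where B = "\<lambda>i. sylvester (P i) (R i)"])
    show "solves_system (\<lambda>z x w. \<Sum>i\<in>F. sylvester (P i) (R i) x w / (z - i)) y (- F)"
      unfolding solves_system_def sylv_fuchs
      using T by (auto simp: y_def sum_sylvester mat_deriv_def)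
    show "v = (\<lambda>_. 0)" if "i \<in> F" "m \<ge> 1"
      "\<And>x. (\<Sum>w\<in>UNIV. sylvester (P i) (R i) x w * v w) = - of_nat m * v x" for i m v
      by (rule zero[OF loc[OF that(1)] _ _ that(3)]) (use that(2) in auto)
    show "v = (\<lambda>_. 0)" if "m \<ge> 1"
      "\<And>x. (\<Sum>w\<in>UNIV. (\<Sum>i\<in>F. sylvester (P i) (R i) x w) * v w) = of_nat m * v x" for m v
      by (rule zero[OF inf, of "of_nat m"]) (use that in \<open>auto simp: sylv_sum\<close>)
  qed
  then obtain c where c: "\<And>z. z \<notin> F \<Longrightarrow> y z = c"
    "\<And>i x. i \<in> F \<Longrightarrow> (\<Sum>w\<in>UNIV. sylvester (P i) (R i) x w * c w) = 0" by auto
  define C where "C = (\<chi> k l. c (k, l))"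
  have cC: "c = (\<lambda>x. C $ fst x $ snd x)" by (simp add: C_def)
  have "P i ** C = C ** R i" if "i \<in> F" for i
  proof -
    have "(P i ** C - C ** R i) $ k $ l = 0" for k l
      using c(2)[OF that, of "(k, l)"] by (simp only: cC sum_sylvester fst_conv snd_conv)
    then have "P i ** C - C ** R i = 0" by (simp only: vec_eq_iff zero_index) simp
    then show ?thesis by simp
  qed
  moreover have "T z = C" if "z \<notin> F" for z
  proof -
    have "y z x = C $ fst x $ snd x" for x using c(1)[OF that] by (simp add: cC)
    then have "T z $ k $ l = C $ k $ l" for k l using y_def[of z "(k, l)"] by (metis fst_conv snd_conv)
    then show ?thesis by (simp add: vec_eq_iff)
  qed
  ultimately show ?thesis by blast
qed

section \<open>Fuchsian systems with a real pole set\<close>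

locale fuchsian_system =
  fixes n :: nat and t :: "nat \<Rightarrow> real" and A :: "nat \<Rightarrow> complex^2^2" and \<theta>p \<theta>m :: "nat \<Rightarrow> complex"
  assumes positions: "t \<in> positions n" and t0: "t (n+1) = 0" and t1: "t (n+2) = 1"
    and eigenvalues: "\<forall>i\<in>{1..n+2}. has_eigenvalues (A i) (\<theta>p i) (\<theta>m i)"
    and normalized: "A_infinity n A = mat2 (\<theta>p (n+3)) 0 0 (\<theta>m (n+3))"
    and non_resonant: "\<forall>i\<in>{1..n+3}. \<theta>p i - \<theta>m i \<notin> \<int>"
    and conj_closed: "\<forall>i\<in>{1..n+2}. (\<theta>p i \<in> \<real> \<and> \<theta>m i \<in> \<real>) \<or> \<theta>m i = cnj (\<theta>p i)"
    and real_infinity: "\<theta>p (n+3) \<in> \<real>" "\<theta>m (n+3) \<in> \<real>"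
    and A12_nonzero: "\<exists>x. x \<notin> sing n t \<and> system_matrix n t A x $ 1 $ 2 \<noteq> 0"
begin

abbreviation \<Sigma> :: "complex set" where "\<Sigma> \<equiv> sing n t"
abbreviation B :: "complex \<Rightarrow> complex^2^2" where "B \<equiv> system_matrix n t A"
abbreviation Ac :: "nat \<Rightarrow> complex^2^2" where "Ac \<equiv> \<lambda>i. map_matrix cnj (A i)"
abbreviation Bc :: "complex \<Rightarrow> complex^2^2" where "Bc \<equiv> system_matrix n t Ac"

lemma t_strict_mono: "1 \<le> i \<Longrightarrow> i < j \<Longrightarrow> j \<le> n + 2 \<Longrightarrow> t i < t j"
proof -
  assume ij: "1 \<le> i" "i < j" "j \<le> n + 2"
  have neg: "t k < 0" if "1 \<le> k" "k \<le> n" for k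
    using positions that by (auto simp: positions_def)
  consider "j \<le> n" | "j = n + 1" "i \<le> n" | "j = n + 2" "i \<le> n" | "j = n + 2" "i = n + 1"
    using ij by linarith
  then show "t i < t j"
  proof cases
    case 1
    then show ?thesis using positions ij by (auto simp: positions_def strict_mono_on_def)
  next
    case 2
    then show ?thesis using neg[of i] ij(1) t0 by simp
  next
    case 3
    then show ?thesis using neg[of i] ij(1) t1 by simp
  qed (use t0 t1 in simp)
qed

lemma inj_t: "inj_on (\<lambda>i. complex_of_real (t i)) {1..n+2}"
proof (rule inj_onI)
  fix i j assume "i \<in> {1..n+2}" "j \<in> {1..n+2}" "complex_of_real (t i) = complex_of_real (t j)"
  then show "i = j" using t_strict_mono[of i j] t_strict_mono[of j i] by (cases i j rule: linorder_cases) auto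
qed

lemma finite_sing [simp]: "finite \<Sigma>" by (simp add: sing_def)

lemma cnj_sing: "cnj z \<in> \<Sigma> \<longleftrightarrow> z \<in> \<Sigma>"
  unfolding sing_def by (metis (no_types, lifting) complex_cnj_cnj complex_cnj_complex_of_real image_iff)

text \<open>The residue as a function of the point.  Being a sum over the indices of the poles at \<open>z\<close>, it vanishes
  where there are none, so finitely many further points may be added to the set of poles.\<close>

definition residue_at :: "(nat \<Rightarrow> complex^2^2) \<Rightarrow> complex \<Rightarrow> complex^2^2" where
  "residue_at M z = (\<Sum>i\<in>{i\<in>{1..n+2}. of_real (t i) = z}. M i)"

lemma residue_at_pole: "i \<in> {1..n+2} \<Longrightarrow> residue_at M (of_real (t i)) = M i"
proof -
  assume i: "i \<in> {1..n+2}"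
  then have "{j\<in>{1..n+2}. complex_of_real (t j) = of_real (t i)} = {i}"
    using inj_t unfolding inj_on_def by auto
  then show ?thesis by (simp add: residue_at_def)
qed

lemma residue_at_outside: "z \<notin> \<Sigma> \<Longrightarrow> residue_at M z = 0"
  unfolding residue_at_def sing_def by (rule sum.neutral) auto

lemma sum_residue_at:
  assumes "finite F" "\<Sigma> \<subseteq> F"
  shows "(\<Sum>z\<in>F. residue_at M z) = (\<Sum>i=1..n+2. M i)"
  unfolding residue_at_def using assms by (intro sum.group) (auto simp: sing_def)

lemma fuchs_residue_at:
  assumes "finite F" "\<Sigma> \<subseteq> F"
  shows "fuchs F (residue_at M) = system_matrix n t M"
proof
  fix x
  have "(\<Sum>z\<in>F. residue_at M z $ k $ l / (x - z)) = (\<Sum>i=1..n+2. M i $ k $ l / (x - of_real (t i)))" for k l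
  proof -
    have "(\<Sum>z\<in>F. residue_at M z $ k $ l / (x - z))
        = (\<Sum>z\<in>F. \<Sum>i\<in>{i\<in>{1..n+2}. of_real (t i) = z}. M i $ k $ l / (x - of_real (t i)))"
      unfolding residue_at_def by (simp add: sum_divide_distrib)
    also have "\<dots> = (\<Sum>i=1..n+2. M i $ k $ l / (x - of_real (t i)))"
      using assms by (intro sum.group) (auto simp: sing_def)
    finally show ?thesis .
  qed
  then show "fuchs F (residue_at M) x = system_matrix n t M x"
    by (simp add: fuchs_def system_matrix_def)
qed

lemma Bc_eq: "Bc z = map_matrix cnj (B (cnj z))"
  by (simp add: vec_eq_iff system_matrix_def)

text \<open>The spectrum is stable under conjugation, as a set, in both of the admitted cases.\<close>

lemma isospectral_cnj:
  assumes "has_eigenvalues M u v" "(u \<in> \<real> \<and> v \<in> \<real>) \<or> v = cnj u" "u - v \<notin> \<int>"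
  shows "isospectral (map_matrix cnj M) M"
proof -
  have "trace (map_matrix cnj M) = cnj (trace M)" "det (map_matrix cnj M) = cnj (det M)"
    by (simp_all add: trace_def det_2 sum_2)
  then have "has_eigenvalues (map_matrix cnj M) u v"
    using assms(1,2) unfolding has_eigenvalues_iff by (auto simp: Reals_cnj_iff)
  then show ?thesis using assms unfolding isospectral_def by blast
qed

lemma sum_A: "(\<Sum>i=1..n+2. A i) = mat2 (- \<theta>p (n+3)) 0 0 (- \<theta>m (n+3))"
proof -
  have "(\<Sum>i=1..n+2. A i) = - A_infinity n A" by (simp only: A_infinity_def minus_minus)
  then show ?thesis unfolding normalized by (simp add: matrix2_eq_iff)
qed

text \<open>The set \<open>F\<close> may contain points that are not poles: there \<open>T\<close> is allowed an isolated singularity,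
  which the rigidity removes.\<close>

lemma gauge_constant:
  assumes F: "finite F" "\<Sigma> \<subseteq> F"
    and T: "\<And>z. z \<notin> F \<Longrightarrow> mat_deriv T (Bc z ** T z - T z ** B z) z"
  shows "\<exists>C. (\<forall>z\<in>-F. T z = C) \<and> (\<forall>i\<in>{1..n+2}. Ac i ** C = C ** A i)"
proof -
  have iso: "isospectral (Ac i) (A i)" if "i \<in> {1..n+2}" for i
    using that eigenvalues conj_closed non_resonant by (intro isospectral_cnj) auto
  have "\<exists>C. (\<forall>z\<in>-F. T z = C) \<and> (\<forall>z\<in>F. residue_at Ac z ** C = C ** residue_at A z)"
  proof (rule rigidity[OF F(1)])
    show "mat_deriv T (fuchs F (residue_at Ac) z ** T z - T z ** fuchs F (residue_at A) z) z" if "z \<notin> F" for z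
      unfolding fuchs_residue_at[OF F] by (rule T[OF that])
    show "isospectral (residue_at Ac z) (residue_at A z)" for z
    proof (cases "z \<in> \<Sigma>")
      case True
      then obtain i where "i \<in> {1..n+2}" "z = of_real (t i)" by (auto simp: sing_def)
      then show ?thesis using iso residue_at_pole[of i Ac] residue_at_pole[of i A] by simp
    next
      case False
      have "has_eigenvalues 0 0 0" by (simp add: has_eigenvalues_iff trace_def det_2)
      then show ?thesis using False by (auto simp: residue_at_outside isospectral_def)
    qed
    show "isospectral (\<Sum>z\<in>F. residue_at Ac z) (\<Sum>z\<in>F. residue_at A z)"
    proof -
      have "(\<Sum>i=1..n+2. Ac i) = map_matrix cnj (\<Sum>i=1..n+2. A i)"
        by (rule map_matrix_cnj_sum[symmetric])
      moreover have "has_eigenvalues (\<Sum>i=1..n+2. A i) (- \<theta>p (n+3)) (- \<theta>m (n+3))"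
        unfolding sum_A by (simp add: has_eigenvalues_iff trace_def sum_2 det_2)
      moreover have "- \<theta>p (n+3) - - \<theta>m (n+3) \<notin> \<int>"
      proof
        assume "- \<theta>p (n+3) - - \<theta>m (n+3) \<in> \<int>"
        then have "- (- \<theta>p (n+3) - - \<theta>m (n+3)) \<in> \<int>" by (rule Ints_minus)
        then show False using non_resonant by auto
      qed
      ultimately show ?thesis
        using isospectral_cnj real_infinity unfolding sum_residue_at[OF F] by (metis Reals_minus)
    qed
  qed
  then obtain C where C: "\<forall>z\<in>-F. T z = C" "\<forall>z\<in>F. residue_at Ac z ** C = C ** residue_at A z" by blast
  have "Ac i ** C = C ** A i" if "i \<in> {1..n+2}" for i
  proof -
    have "of_real (t i) \<in> F" using that F(2) by (auto simp: sing_def)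
    then show ?thesis using C(2) residue_at_pole[OF that, of Ac] residue_at_pole[OF that, of A] by metis
  qed
  then show ?thesis using C(1) by blast
qed

lemma ex_A12_nonzero: "\<exists>i\<in>{1..n+2}. A i $ 1 $ 2 \<noteq> 0"
proof (rule ccontr)
  assume "\<not> ?thesis"
  then have "B x $ 1 $ 2 = 0" for x by (simp add: system_matrix_def)
  then show False using A12_nonzero by blast
qed

text \<open>The matrix \<open>diag(e\<^sup>-\<^sup>i\<^sup>\<eta>, e\<^sup>i\<^sup>\<eta>)\<close> intertwines the residues with their conjugates.  Conversely an intertwining
  matrix commutes with the real diagonal residue at infinity and is therefore diagonal; a nonzero
  upper right entry shows that its diagonal entries have the same modulus.\<close>

lemma real_up_to_phase_iff:
  "real_up_to_phase n A \<longleftrightarrow> (\<exists>C. invertible C \<and> (\<forall>i\<in>{1..n+2}. Ac i ** C = C ** A i))"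
proof
  assume "real_up_to_phase n A"
  then obtain \<eta> where \<eta>: "\<forall>i\<in>{1..n+2}. \<exists>a b c d :: real.
        A i = mat2 (of_real a) (of_real b * cis \<eta>) (of_real c * cis (- \<eta>)) (of_real d)"
    unfolding real_up_to_phase_def by blast
  define C where "C = mat2 (cis (- \<eta>)) 0 0 (cis \<eta>)"
  have cc: "cis \<eta> * cis (- \<eta>) = 1" by (simp add: cis_mult)
  have "det C \<noteq> 0" by (simp add: C_def det_2 cis_mult)
  then have "invertible C" by (simp add: invertible_det_nz)
  moreover have "Ac i ** C = C ** A i" if i: "i \<in> {1..n+2}" for i
  proof -
    obtain a b c d :: real where
      "A i = mat2 (of_real a) (of_real b * cis \<eta>) (of_real c * cis (- \<eta>)) (of_real d)"
      using \<eta> i by blast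
    then show ?thesis by (simp add: C_def matrix2_eq_iff matrix2_mult_nth cis_cnj)
  qed
  ultimately show "\<exists>C. invertible C \<and> (\<forall>i\<in>{1..n+2}. Ac i ** C = C ** A i)" by blast
next
  assume "\<exists>C. invertible C \<and> (\<forall>i\<in>{1..n+2}. Ac i ** C = C ** A i)"
  then obtain C where C: "invertible C" "\<And>i. i \<in> {1..n+2} \<Longrightarrow> Ac i ** C = C ** A i" by blast
  define u v where "u = \<theta>p (n+3)" and "v = \<theta>m (n+3)"
  have uv: "cnj u = u" "cnj v = v" "u \<noteq> v"
    using real_infinity bspec[OF non_resonant, of "n+3"] by (auto simp: u_def v_def Reals_cnj_iff)
  have "map_matrix cnj (\<Sum>i=1..n+2. A i) ** C = (\<Sum>i=1..n+2. Ac i ** C)"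
    by (simp only: map_matrix_cnj_sum matrix2_sum_mult)
  also have "\<dots> = (\<Sum>i=1..n+2. C ** A i)" using C(2) by (intro sum.cong) auto
  also have "\<dots> = C ** (\<Sum>i=1..n+2. A i)"
    by (simp only: matrix2_sum_mult)
  finally have "map_matrix cnj (mat2 (- u) 0 0 (- v)) ** C = C ** mat2 (- u) 0 0 (- v)"
    unfolding sum_A u_def v_def .
  then have off: "C $ 1 $ 2 = 0" "C $ 2 $ 1 = 0"
    using uv by (auto simp: matrix2_eq_iff matrix2_mult_nth)
  define \<alpha> \<beta> where "\<alpha> = C $ 1 $ 1" and "\<beta> = C $ 2 $ 2"
  have \<alpha>\<beta>: "\<alpha> \<noteq> 0" "\<beta> \<noteq> 0"
    using C(1) off by (auto simp: invertible_det_nz det_2 \<alpha>_def \<beta>_def)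
  have rel: "cnj (A i $ 1 $ 1) = A i $ 1 $ 1" "cnj (A i $ 2 $ 2) = A i $ 2 $ 2"
    "cnj (A i $ 1 $ 2) * \<beta> = \<alpha> * A i $ 1 $ 2" "cnj (A i $ 2 $ 1) * \<alpha> = \<beta> * A i $ 2 $ 1"
    if "i \<in> {1..n+2}" for i
    using C(2)[OF that] off \<alpha>\<beta> by (auto simp: matrix2_eq_iff matrix2_mult_nth \<alpha>_def[symmetric] \<beta>_def[symmetric])
  obtain i0 where i0: "i0 \<in> {1..n+2}" "A i0 $ 1 $ 2 \<noteq> 0" using ex_A12_nonzero by blast
  have "cmod (cnj (A i0 $ 1 $ 2) * \<beta>) = cmod (\<alpha> * A i0 $ 1 $ 2)" using rel(3)[OF i0(1)] by simp
  then have "cmod \<beta> = cmod \<alpha>" using i0(2) by (simp add: norm_mult)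
  then have "cmod (\<beta> / \<alpha>) = 1" using \<alpha>\<beta> by (simp add: norm_divide)
  then obtain \<phi> where \<phi>: "\<beta> / \<alpha> = cis \<phi>" by (metis complex_norm_eq_1_exp_eq cis_conv_exp)
  define \<eta> where "\<eta> = \<phi> / 2"
  have \<beta>: "\<beta> = cis \<eta> * cis \<eta> * \<alpha>" using \<phi> \<alpha>\<beta> by (simp add: \<eta>_def cis_mult field_simps)
  have cc: "cis \<eta> * cis (- \<eta>) = 1" by (simp add: cis_mult)
  have real: "\<exists>r::real. z = of_real r * w'" if zw: "cnj (z * w) = z * w" and ww: "w * w' = 1" for z w w'
  proof -
    obtain r where "z * w = of_real r" using zw Reals_cnj_iff by (metis Reals_cases)
    then have "z * (w * w') = of_real r * w'" by (simp add: mult.assoc[symmetric])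
    then show ?thesis using ww by auto
  qed
  have "\<exists>a b c d :: real. A i = mat2 (of_real a) (of_real b * cis \<eta>) (of_real c * cis (- \<eta>)) (of_real d)"
    if i: "i \<in> {1..n+2}" for i
  proof -
    have e: "cnj (A i $ 1 $ 2) * (cis \<eta> * cis \<eta>) = A i $ 1 $ 2"
      using rel(3)[OF i] \<alpha>\<beta>(1) unfolding \<beta> by (simp add: mult_ac)
    have "cnj (A i $ 1 $ 2) * cis \<eta> * (cis \<eta> * cis (- \<eta>))
        = cnj (A i $ 1 $ 2) * (cis \<eta> * cis \<eta>) * cis (- \<eta>)"
      by (simp only: mult_ac)
    then have "cnj (A i $ 1 $ 2) * cis \<eta> * (cis \<eta> * cis (- \<eta>)) = A i $ 1 $ 2 * cis (- \<eta>)"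
      unfolding e .
    then have b: "cnj (A i $ 1 $ 2 * cis (- \<eta>)) = A i $ 1 $ 2 * cis (- \<eta>)"
      unfolding cc by (simp add: cis_cnj)
    have "cnj (A i $ 2 $ 1) = cis \<eta> * cis \<eta> * A i $ 2 $ 1"
      using rel(4)[OF i] \<alpha>\<beta>(1) unfolding \<beta> by (simp add: mult_ac)
    then have "cnj (A i $ 2 $ 1) * cis (- \<eta>) = A i $ 2 $ 1 * cis \<eta> * (cis \<eta> * cis (- \<eta>))"
      by (simp add: mult_ac)
    then have c: "cnj (A i $ 2 $ 1 * cis \<eta>) = A i $ 2 $ 1 * cis \<eta>"
      unfolding cc by (simp add: cis_cnj)
    obtain a where a: "A i $ 1 $ 1 = complex_of_real a" using rel(1)[OF i] Reals_cnj_iff by (metis Reals_cases)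
    obtain d where d: "A i $ 2 $ 2 = complex_of_real d" using rel(2)[OF i] Reals_cnj_iff by (metis Reals_cases)
    obtain b' where b': "A i $ 1 $ 2 = complex_of_real b' * cis \<eta>"
      using real[OF b, of "cis \<eta>"] cc by (auto simp: mult.commute)
    obtain c' where c': "A i $ 2 $ 1 = complex_of_real c' * cis (- \<eta>)"
      using real[OF c cc] by blast
    show ?thesis
      by (rule exI[of _ a], rule exI[of _ b'], rule exI[of _ c'], rule exI[of _ d])
         (simp add: matrix2_eq_iff a d b' c')
  qed
  then show "real_up_to_phase n A" unfolding real_up_to_phase_def by blast
qed

end

section \<open>Reality of the associated second-order equation\<close>

definition system_matrix_deriv ::
    "nat \<Rightarrow> (nat \<Rightarrow> real) \<Rightarrow> (nat \<Rightarrow> complex^2^2) \<Rightarrow> complex \<Rightarrow> complex^2^2" where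
  "system_matrix_deriv n t A x = (\<chi> k l. \<Sum>i=1..n+2. - A i $ k $ l / (x - of_real (t i))\<^sup>2)"

lemma mat_deriv_system_matrix:
  assumes "z \<notin> sing n t"
  shows "mat_deriv (system_matrix n t A) (system_matrix_deriv n t A z) z"
proof -
  have ne: "z \<noteq> of_real (t i)" if "i \<in> {1..n+2}" for i
    using assms that by (auto simp: sing_def)
  have "((\<lambda>x. \<Sum>i=1..n+2. A i $ k $ l / (x - of_real (t i))) has_field_derivative
        (\<Sum>i=1..n+2. - A i $ k $ l / (z - of_real (t i))\<^sup>2)) (at z)" for k l
  proof (rule DERIV_sum)
    fix i assume "i \<in> {1..n+2}"
    then show "((\<lambda>x. A i $ k $ l / (x - of_real (t i))) has_field_derivative
        - A i $ k $ l / (z - of_real (t i))\<^sup>2) (at z)"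
      using ne by (auto intro!: derivative_eq_intros simp: power2_eq_square)
  qed
  then show ?thesis by (simp add: mat_deriv_def system_matrix_def system_matrix_deriv_def)
qed

lemma deriv_system_matrix:
  "z \<notin> sing n t \<Longrightarrow> deriv (\<lambda>x. system_matrix n t A x $ k $ l) z = system_matrix_deriv n t A z $ k $ l"
  using mat_deriv_system_matrix[of z n t A] unfolding mat_deriv_def by (blast intro: DERIV_imp_deriv)

context fuchsian_system
begin

lemma open_minus_finite: "finite F \<Longrightarrow> open (- F :: complex set)"
  by (intro open_Compl finite_imp_closed)

lemma holomorphic_system_matrix: "(\<lambda>z. system_matrix n t M z $ k $ l) holomorphic_on - \<Sigma>"
  by (rule mat_deriv_holomorphic[where D = "system_matrix_deriv n t M"]) (simp add: mat_deriv_system_matrix)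

text \<open>The sum of the eigenvalues of each residue is real.\<close>

lemma trace_Bc: "trace (Bc z) = trace (B z)"
proof -
  have "cnj (trace (A i)) = trace (A i)" if "i \<in> {1..n+2}" for i
    using bspec[OF eigenvalues that] bspec[OF conj_closed that]
    by (auto simp: has_eigenvalues_iff Reals_cnj_iff)
  then have "trace (Ac i) / (z - of_real (t i)) = trace (A i) / (z - of_real (t i))" if "i \<in> {1..n+2}" for i
    using that by (simp add: trace_def sum_2)
  then have "(\<Sum>i=1..n+2. trace (Ac i) / (z - of_real (t i))) = (\<Sum>i=1..n+2. trace (A i) / (z - of_real (t i)))"
    by (rule sum.cong[OF refl])
  then show ?thesis
    by (simp only: trace_def sum_2 system_matrix_def vec_lambda_beta nth_map_matrix add_divide_distrib sum.distrib)
qed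

text \<open>Off the poles, the entry is a polynomial divided by the product of the \<open>x - t\<^sub>i\<close>.\<close>

lemma finite_zeros_A12: "finite {x. x \<notin> \<Sigma> \<and> B x $ 1 $ 2 = 0}"
proof -
  define N where "N = (\<Sum>i=1..n+2. smult (A i $ 1 $ 2) (\<Prod>j\<in>{1..n+2}-{i}. [:- of_real (t j), 1:]))"
  have N: "poly N x = B x $ 1 $ 2 * (\<Prod>j=1..n+2. x - of_real (t j))" if "x \<notin> \<Sigma>" for x
  proof -
    have "poly N x = (\<Sum>i=1..n+2. A i $ 1 $ 2 * (\<Prod>j\<in>{1..n+2}-{i}. x - of_real (t j)))"
      by (simp add: N_def poly_sum poly_prod)
    also have "\<dots> = (\<Sum>i=1..n+2. A i $ 1 $ 2 / (x - of_real (t i)) * (\<Prod>j=1..n+2. x - of_real (t j)))"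
    proof (rule sum.cong[OF refl])
      fix i assume i: "i \<in> {1..n+2}"
      then have "x - of_real (t i) \<noteq> 0" using that by (auto simp: sing_def)
      then show "A i $ 1 $ 2 * (\<Prod>j\<in>{1..n+2}-{i}. x - of_real (t j))
          = A i $ 1 $ 2 / (x - of_real (t i)) * (\<Prod>j=1..n+2. x - of_real (t j))"
        by (subst prod.remove[OF _ i, of "\<lambda>j. x - of_real (t j)"]) auto
    qed
    also have "\<dots> = B x $ 1 $ 2 * (\<Prod>j=1..n+2. x - of_real (t j))"
      by (simp only: sum_distrib_right[symmetric] system_matrix_def vec_lambda_beta)
    finally show ?thesis .
  qed
  obtain x where x: "x \<notin> \<Sigma>" "B x $ 1 $ 2 \<noteq> 0" using A12_nonzero by blast
  have "(\<Prod>j=1..n+2. x - of_real (t j)) \<noteq> 0"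
    using x(1) by (subst prod_zero_iff) (auto simp: sing_def)
  then have "N \<noteq> 0" using N[OF x(1)] x(2) by auto
  then have "finite {x. poly N x = 0}" by (rule poly_roots_finite)
  then show ?thesis by (rule rev_finite_subset) (auto simp: N)
qed

text \<open>The complement of a finite set is connected, and a real point of it is a limit of further real
  points of it, so the identity theorem applies.\<close>

lemma real_identity:
  assumes F: "finite F" and f: "f holomorphic_on - F" "g holomorphic_on - F"
    and eq: "\<And>x::real. of_real x \<notin> F \<Longrightarrow> f (of_real x) = g (of_real x)"
    and z: "z \<notin> F"
  shows "f z = g z"
proof -
  have "infinite (range complex_of_real)"
    by (metis finite_imageD infinite_UNIV_char_0 inj_of_real)
  then obtain \<xi> :: real where \<xi>: "of_real \<xi> \<notin> F" using F by (metis finite_subset image_subset_iff)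
  have "complex_of_real \<xi> islimpt range complex_of_real"
    unfolding islimpt_approachable
  proof (intro allI impI)
    fix e :: real assume "e > 0"
    then show "\<exists>x'\<in>range complex_of_real. x' \<noteq> of_real \<xi> \<and> dist x' (of_real \<xi>) < e"
      by (intro bexI[of _ "of_real (\<xi> + e/2)"]) (auto simp: dist_norm simp del: of_real_add of_real_divide
            simp flip: of_real_diff)
  qed
  then have "complex_of_real \<xi> islimpt (range complex_of_real - F) \<union> (range complex_of_real \<inter> F)"
    by (simp add: Un_Diff_Int)
  then have "complex_of_real \<xi> islimpt (range complex_of_real - F)"
    using F by (simp add: islimpt_Un islimpt_finite)
  moreover have "connected (- F)"
    using connected_open_delete_finite[of "UNIV :: complex set" F] F
    by (simp add: Compl_eq_Diff_UNIV connected_UNIV)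
  ultimately have "f z - g z = 0"
    using F f z \<xi> eq
    by (intro analytic_continuation[of "\<lambda>z. f z - g z" "- F" "range complex_of_real - F" "of_real \<xi>" z])
       (auto intro!: holomorphic_intros open_minus_finite)
  then show ?thesis by simp
qed

lemma holomorphic_coefficients:
  assumes F: "finite F" "\<Sigma> \<subseteq> F" and nz: "\<And>z. z \<notin> F \<Longrightarrow> system_matrix n t M z $ 1 $ 2 \<noteq> 0"
  shows "coeff_p (system_matrix n t M) holomorphic_on - F" "coeff_q (system_matrix n t M) holomorphic_on - F"
proof -
  have h: "(\<lambda>z. system_matrix n t M z $ k $ l) holomorphic_on - F" for k l
    using holomorphic_on_subset[OF holomorphic_system_matrix] F(2) by blast
  have d: "deriv (\<lambda>z. system_matrix n t M z $ k $ l) holomorphic_on - F" for k l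
    by (intro holomorphic_deriv h open_minus_finite F)
  show "coeff_p (system_matrix n t M) holomorphic_on - F"
    unfolding coeff_p_def[abs_def] trace_def sum_2 by (intro holomorphic_intros h d) (use nz in auto)
  show "coeff_q (system_matrix n t M) holomorphic_on - F"
    unfolding coeff_q_def[abs_def] det_2 by (intro holomorphic_intros h d) (use nz in auto)
qed

lemma cnj_coefficients:
  assumes "x \<in> \<real>" "x \<notin> \<Sigma>"
  shows "coeff_p Bc x = cnj (coeff_p B x)" "coeff_q Bc x = cnj (coeff_q B x)"
proof -
  have x: "cnj x = x" using assms(1) by (simp add: Reals_cnj_iff)
  have d: "system_matrix_deriv n t Ac x = map_matrix cnj (system_matrix_deriv n t A x)"
    by (simp add: vec_eq_iff system_matrix_deriv_def x)
  show "coeff_p Bc x = cnj (coeff_p B x)" "coeff_q Bc x = cnj (coeff_q B x)"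
    unfolding coeff_p_def coeff_q_def deriv_system_matrix[OF assms(2)] d
    by (simp_all add: Bc_eq[of x] x trace_def sum_2 det_2)
qed

text \<open>If \<open>p\<close> and \<open>q\<close> are real on the real axis, then by the identity theorem they coincide with the
  coefficients of the conjugate system.  The two systems then have the same first components of solutions,
  and expressing the second component through the first one and its derivative in both systems
  gives the lower triangular gauge matrix \<open>T\<close> used in the proof.\<close>

lemma real_equation_imp_real_up_to_phase:
  assumes real: "real_second_order_equation n t A"
  shows "real_up_to_phase n A"
proof -
  define Z where "Z = {x. x \<notin> \<Sigma> \<and> B x $ 1 $ 2 = 0}"
  define F where "F = \<Sigma> \<union> Z \<union> cnj ` Z"
  have F: "finite F" "\<Sigma> \<subseteq> F" using finite_zeros_A12 by (auto simp: F_def Z_def)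
  have nzB: "B z $ 1 $ 2 \<noteq> 0" and nzBc: "Bc z $ 1 $ 2 \<noteq> 0" if "z \<notin> F" for z
  proof -
    show "B z $ 1 $ 2 \<noteq> 0" using that by (auto simp: F_def Z_def)
    have "cnj z \<notin> Z" using that unfolding F_def by (metis UnI2 complex_cnj_cnj image_eqI)
    moreover have "cnj z \<notin> \<Sigma>" using that by (auto simp: F_def cnj_sing)
    ultimately have "B (cnj z) $ 1 $ 2 \<noteq> 0" by (auto simp: Z_def)
    then show "Bc z $ 1 $ 2 \<noteq> 0" by (simp add: Bc_eq[of z])
  qed
  have pq: "coeff_p B z = coeff_p Bc z" "coeff_q B z = coeff_q Bc z" if z: "z \<notin> F" for z
  proof -
    have r: "coeff_p B (of_real x) = coeff_p Bc (of_real x)" "coeff_q B (of_real x) = coeff_q Bc (of_real x)"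
      if x: "of_real x \<notin> F" for x :: real
    proof -
      have xS: "complex_of_real x \<notin> \<Sigma>" using x F(2) by blast
      then have "coeff_p B (of_real x) \<in> \<real>" "coeff_q B (of_real x) \<in> \<real>"
        using real nzB[OF x] unfolding real_second_order_equation_def by auto
      then show "coeff_p B (of_real x) = coeff_p Bc (of_real x)" "coeff_q B (of_real x) = coeff_q Bc (of_real x)"
        using cnj_coefficients[of "of_real x"] xS by (simp_all add: Reals_cnj_iff)
    qed
    have h: "coeff_p B holomorphic_on - F" "coeff_q B holomorphic_on - F"
      by (rule holomorphic_coefficients[OF F], erule nzB)+
    have hc: "coeff_p Bc holomorphic_on - F" "coeff_q Bc holomorphic_on - F"
      by (rule holomorphic_coefficients[OF F], erule nzBc)+
    show "coeff_p B z = coeff_p Bc z"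
      by (rule real_identity[OF F(1) h(1) hc(1) _ z]) (rule r(1))
    show "coeff_q B z = coeff_q Bc z"
      by (rule real_identity[OF F(1) h(2) hc(2) _ z]) (rule r(2))
  qed
  define T where "T z = mat2 1 0 ((B z $ 1 $ 1 - Bc z $ 1 $ 1) / Bc z $ 1 $ 2) (B z $ 1 $ 2 / Bc z $ 1 $ 2)" for z
  have "mat_deriv T (Bc z ** T z - T z ** B z) z" if z: "z \<notin> F" for z
  proof -
    have zS: "z \<notin> \<Sigma>" using z F(2) by blast
    define a b c d a' b' where "a = B z $ 1 $ 1" and "b = B z $ 1 $ 2" and "c = B z $ 2 $ 1"
      and "d = B z $ 2 $ 2" and "a' = system_matrix_deriv n t A z $ 1 $ 1"
      and "b' = system_matrix_deriv n t A z $ 1 $ 2"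
    define e f g h e' f' where "e = Bc z $ 1 $ 1" and "f = Bc z $ 1 $ 2" and "g = Bc z $ 2 $ 1"
      and "h = Bc z $ 2 $ 2" and "e' = system_matrix_deriv n t Ac z $ 1 $ 1"
      and "f' = system_matrix_deriv n t Ac z $ 1 $ 2"
    have nz: "b \<noteq> 0" "f \<noteq> 0" using nzB[OF z] nzBc[OF z] by (auto simp: b_def f_def)
    have "trace (Bc z) = trace (B z)" by (rule trace_Bc)
    then have d: "d = e + h - a" by (simp add: trace_def sum_2 a_def d_def e_def h_def algebra_simps)
    have "coeff_p B z = coeff_p Bc z" by (rule pq[OF z])
    then have "b' / b = f' / f"
      using \<open>trace (Bc z) = trace (B z)\<close>
      by (simp add: coeff_p_def deriv_system_matrix[OF zS] b_def b'_def f_def f'_def)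
    \<comment> \<open>The common logarithmic derivative of the two upper right entries.\<close>
    then obtain l where l: "b' = l * b" "f' = l * f" using nz by (metis nonzero_eq_divide_eq)
    have "coeff_q B z = coeff_q Bc z" by (rule pq[OF z])
    then have "- a' + a * b' / b + (a * d - b * c) = - e' + e * f' / f + (e * h - f * g)"
      by (simp add: coeff_q_def deriv_system_matrix[OF zS] det_2 a_def b_def c_def d_def e_def f_def g_def h_def
          a'_def b'_def e'_def f'_def)
    then have q: "a' - e' = (a - e) * l + (a * d - b * c) - (e * h - f * g)"
      using nz by (simp add: l algebra_simps)
    have dB: "((\<lambda>z. B z $ k $ l) has_field_derivative system_matrix_deriv n t A z $ k $ l) (at z)"
      and dBc: "((\<lambda>z. Bc z $ k $ l) has_field_derivative system_matrix_deriv n t Ac z $ k $ l) (at z)" for k l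
      using mat_deriv_system_matrix[OF zS] by (auto simp: mat_deriv_def)
    have g21: "((\<lambda>z. (B z $ 1 $ 1 - Bc z $ 1 $ 1) / Bc z $ 1 $ 2) has_field_derivative
        ((a' - e') * f - (a - e) * f') / (f * f)) (at z)"
      using DERIV_divide[OF DERIV_diff[OF dB[of 1 1] dBc[of 1 1]] dBc[of 1 2]] nz
      by (simp add: a_def e_def f_def a'_def e'_def f'_def)
    have g22: "((\<lambda>z. B z $ 1 $ 2 / Bc z $ 1 $ 2) has_field_derivative (b' * f - b * f') / (f * f)) (at z)"
      using DERIV_divide[OF dB[of 1 2] dBc[of 1 2]] nz
      by (simp add: b_def f_def b'_def f'_def)
    define D where "D = Bc z ** T z - T z ** B z"
    have "D $ 1 $ 1 = 0" "D $ 1 $ 2 = 0"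
      using nz by (simp_all add: D_def matrix2_mult_nth T_def b_def f_def)
    moreover have "D $ 2 $ 1 = ((a' - e') * f - (a - e) * f') / (f * f)"
    proof -
      have "D $ 2 $ 1 = g + h * ((a - e) / f) - ((a - e) / f * a + b / f * c)"
        by (simp add: D_def matrix2_mult_nth T_def a_def b_def c_def e_def f_def g_def h_def)
      also have "\<dots> = ((a' - e') * f - (a - e) * f') / (f * f)"
        unfolding q d l using nz by (simp add: field_simps)
      finally show ?thesis .
    qed
    moreover have "D $ 2 $ 2 = (b' * f - b * f') / (f * f)"
    proof -
      have "D $ 2 $ 2 = h * (b / f) - ((a - e) / f * b + b / f * d)"
        by (simp add: D_def matrix2_mult_nth T_def a_def b_def d_def e_def f_def h_def)
      also have "\<dots> = (b' * f - b * f') / (f * f)"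
        unfolding d l using nz by (simp add: field_simps)
      finally show ?thesis .
    qed
    ultimately have "mat_deriv T D z"
      unfolding mat_deriv_def forall_2 T_def using g21 g22 by simp
    then show ?thesis by (simp add: D_def)
  qed
  from gauge_constant[OF F this] obtain C where
    C: "\<forall>z\<in>-F. T z = C" "\<forall>i\<in>{1..n+2}. Ac i ** C = C ** A i" by blast
  have "- F \<noteq> {}" using F(1) infinite_UNIV_char_0[where 'a = complex] by (metis Compl_empty_eq double_compl)
  then obtain z where z: "z \<notin> F" by blast
  have "det (T z) \<noteq> 0" using nzB[OF z] nzBc[OF z] by (simp add: T_def det_2)
  then have "invertible C" using C(1) z by (simp add: invertible_det_nz)
  then show ?thesis using C(2) unfolding real_up_to_phase_iff by blast
qed

text \<open>The phase cancels in the logarithmic derivative of the upper right entry and in the determinant.\<close>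

lemma real_up_to_phase_imp_real_equation:
  assumes "real_up_to_phase n A"
  shows "real_second_order_equation n t A"
proof -
  obtain \<eta> where "\<forall>i\<in>{1..n+2}. \<exists>a b c d :: real.
        A i = mat2 (of_real a) (of_real b * cis \<eta>) (of_real c * cis (- \<eta>)) (of_real d)"
    using assms unfolding real_up_to_phase_def by blast
  moreover define I where "I = {1..n+2}"
  ultimately obtain a b c d :: "nat \<Rightarrow> real" where abcd: "\<And>i. i \<in> I \<Longrightarrow>
      A i = mat2 (of_real (a i)) (of_real (b i) * cis \<eta>) (of_real (c i) * cis (- \<eta>)) (of_real (d i))"
    by metis
  have cc: "cis \<eta> * cis (- \<eta>) = 1" by (simp add: cis_mult)
  show ?thesis
    unfolding real_second_order_equation_def
  proof (intro allI impI)
    fix x :: real assume x: "complex_of_real x \<notin> \<Sigma>" "B (of_real x) $ 1 $ 2 \<noteq> 0"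
    define s where "s f = (\<Sum>i\<in>I. f i / (x - t i))" for f :: "nat \<Rightarrow> real"
    define s' where "s' f = (\<Sum>i\<in>I. - f i / (x - t i)\<^sup>2)" for f :: "nat \<Rightarrow> real"
    have sm: "B z $ k $ l = (\<Sum>i\<in>I. A i $ k $ l / (z - of_real (t i)))"
      "system_matrix_deriv n t A z $ k $ l = (\<Sum>i\<in>I. - A i $ k $ l / (z - of_real (t i))\<^sup>2)" for z k l
      by (simp_all only: system_matrix_def system_matrix_deriv_def I_def vec_lambda_beta)
    have B: "B (of_real x) = mat2 (of_real (s a)) (of_real (s b) * cis \<eta>) (of_real (s c) * cis (- \<eta>)) (of_real (s d))"
      by (simp add: matrix2_eq_iff sm s_def sum_distrib_right abcd cong: sum.cong)
    have B': "system_matrix_deriv n t A (of_real x) $ 1 $ 1 = of_real (s' a)"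
      "system_matrix_deriv n t A (of_real x) $ 1 $ 2 = of_real (s' b) * cis \<eta>"
      by (simp_all add: sm s'_def sum_distrib_right abcd cong: sum.cong)
    have "coeff_p B (of_real x) = of_real (- s' b / s b - (s a + s d))"
      unfolding coeff_p_def deriv_system_matrix[OF x(1)] B B' by (simp add: trace_def sum_2)
    moreover have "coeff_q B (of_real x) = of_real (- s' a + s a * s' b / s b + (s a * s d - s b * s c))"
    proof -
      have "of_real (s b) * cis \<eta> * (of_real (s c) * cis (- \<eta>)) = of_real (s b * s c) * (cis \<eta> * cis (- \<eta>))"
        by (simp add: mult_ac)
      then show ?thesis
        unfolding coeff_q_def deriv_system_matrix[OF x(1)] B B' cc by (simp add: det_2)
    qed
    ultimately show "coeff_p B (of_real x) \<in> \<real> \<and> coeff_q B (of_real x) \<in> \<real>" by simp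
  qed
qed

end

section \<open>Fundamental solutions and analytic continuation\<close>

lemma fundamental_pairD:
  assumes "fundamental_pair B V \<Phi> \<Psi>" "z \<in> V"
  shows "mat_deriv \<Phi> (B z ** \<Phi> z) z" "mat_deriv \<Psi> (- (\<Psi> z ** B z)) z"
    "\<Psi> z ** \<Phi> z = mat 1" "\<Phi> z ** \<Psi> z = mat 1"
  using assms matrix2_inverse_sym[of "\<Psi> z" "\<Phi> z"] by (auto simp: fundamental_pair_def)

lemma fundamental_pair_mult:
  assumes "fundamental_pair B V \<Phi> \<Psi>" "K' ** K = mat 1"
  shows "fundamental_pair B V (\<lambda>z. \<Phi> z ** K) (\<lambda>z. K' ** \<Psi> z)"
  unfolding fundamental_pair_def
proof (intro ballI conjI)
  fix z assume z: "z \<in> V"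
  note p = fundamental_pairD[OF assms(1) z]
  show "mat_deriv (\<lambda>z. \<Phi> z ** K) (B z ** (\<Phi> z ** K)) z"
    using mat_deriv_mult_right[OF p(1), of K] by (simp add: matrix_mul_assoc)
  show "mat_deriv (\<lambda>z. K' ** \<Psi> z) (- (K' ** \<Psi> z ** B z)) z"
    using mat_deriv_mult_left[OF p(2), of K'] by (simp add: matrix_mul_assoc)
  have "K' ** \<Psi> z ** (\<Phi> z ** K) = K' ** (\<Psi> z ** (\<Phi> z ** K))" by (rule matrix_mul_assoc[symmetric])
  then show "K' ** \<Psi> z ** (\<Phi> z ** K) = mat 1"
    using assms(2) p(3) by (simp add: matrix2_cancel_left)
qed

lemma fundamental_pair_cnj:
  assumes "fundamental_pair B V \<Phi> \<Psi>" "\<And>z. z \<in> V \<Longrightarrow> cnj z \<in> V"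
  shows "fundamental_pair (\<lambda>z. map_matrix cnj (B (cnj z))) V
           (\<lambda>z. map_matrix cnj (\<Phi> (cnj z))) (\<lambda>z. map_matrix cnj (\<Psi> (cnj z)))"
  unfolding fundamental_pair_def
proof (intro ballI conjI)
  fix z assume "z \<in> V"
  note p = fundamental_pairD[OF assms(1) assms(2)[OF this]]
  have m: "map_matrix cnj (- X) = - map_matrix cnj X" for X :: "complex^2^2" by (simp add: vec_eq_iff)
  show "mat_deriv (\<lambda>z. map_matrix cnj (\<Phi> (cnj z))) (map_matrix cnj (B (cnj z)) ** map_matrix cnj (\<Phi> (cnj z))) z"
    using mat_deriv_cnj[OF p(1)] by (simp add: map_matrix_cnj_mult)
  show "mat_deriv (\<lambda>z. map_matrix cnj (\<Psi> (cnj z))) (- (map_matrix cnj (\<Psi> (cnj z)) ** map_matrix cnj (B (cnj z)))) z"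
    using mat_deriv_cnj[OF p(2)] by (simp add: map_matrix_cnj_mult m)
  show "map_matrix cnj (\<Psi> (cnj z)) ** map_matrix cnj (\<Phi> (cnj z)) = mat 1"
    by (simp add: map_matrix_cnj_mult[symmetric] p(3))
qed

text \<open>The derivative of \<open>\<Psi> Y\<close> vanishes.\<close>

lemma solution_eq_fundamental_mult:
  assumes "fundamental_pair B V \<Phi> \<Psi>" "open W" "connected W" "W \<subseteq> V"
    and "\<And>z. z \<in> W \<Longrightarrow> mat_deriv Y (B z ** Y z) z"
  shows "\<exists>K. \<forall>z\<in>W. Y z = \<Phi> z ** K"
proof -
  have "mat_deriv (\<lambda>w. \<Psi> w ** Y w) 0 z" if z: "z \<in> W" for z
  proof -
    have "- (\<Psi> z ** B z) ** Y z + \<Psi> z ** (B z ** Y z) = 0" by (simp add: matrix_mul_assoc)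
    then show ?thesis
      using mat_deriv_mult[OF fundamental_pairD(2)[OF assms(1)] assms(5), of z] z assms(4) by auto
  qed
  then obtain K where K: "\<And>z. z \<in> W \<Longrightarrow> \<Psi> z ** Y z = K"
    using mat_deriv_zero_constant[OF assms(2,3), of "\<lambda>w. \<Psi> w ** Y w"] by blast
  have "Y z = \<Phi> z ** K" if "z \<in> W" for z
    using K[OF that, symmetric] fundamental_pairD(4)[OF assms(1), of z] that assms(4)
    by (auto simp: matrix2_cancel_left)
  then show ?thesis by blast
qed

lemma mat_deriv_gauge:
  assumes "fundamental_pair B V \<Phi> \<Psi>" "fundamental_pair B' V \<Phi>' \<Psi>'" "z \<in> V"
  shows "mat_deriv (\<lambda>w. \<Phi>' w ** L ** \<Psi> w)
           (B' z ** (\<Phi>' z ** L ** \<Psi> z) - (\<Phi>' z ** L ** \<Psi> z) ** B z) z"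
proof -
  have "mat_deriv (\<lambda>w. \<Phi>' w ** L ** \<Psi> w)
      (B' z ** \<Phi>' z ** L ** \<Psi> z + \<Phi>' z ** L ** (- (\<Psi> z ** B z))) z"
    by (intro mat_deriv_mult mat_deriv_mult_right fundamental_pairD[OF assms(1,3)] fundamental_pairD[OF assms(2,3)])
  then show ?thesis by (simp add: matrix_mul_assoc)
qed

lemma matrix_identity_theorem:
  assumes "\<And>k l. (\<lambda>x. F x $ k $ l) holomorphic_on ball c r" "\<And>k l. (\<lambda>x. G x $ k $ l) holomorphic_on ball c r"
    and "w \<in> ball c r" "w' \<in> ball c r" and eq: "\<forall>\<^sub>F x in nhds w. F x = (G x :: complex^2^2)"
  shows "\<forall>\<^sub>F x in nhds w'. F x = G x"
proof -
  obtain S where S: "open S" "w \<in> S" "\<And>x. x \<in> S \<Longrightarrow> F x = G x"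
    using eq unfolding eventually_nhds by blast
  have "F x $ k $ l = G x $ k $ l" if "x \<in> ball c r" for x k l
  proof (rule analytic_continuation_open[of "S \<inter> ball c r" "ball c r" "\<lambda>x. F x $ k $ l" "\<lambda>x. G x $ k $ l"])
    show "S \<inter> ball c r \<noteq> {}" using S(2) assms(3) by blast
  qed (use S assms(1,2) that in \<open>auto intro: open_Int\<close>)
  then have "F x = G x" if "x \<in> ball c r" for x using that by (simp add: vec_eq_iff)
  then show ?thesis using assms(4) unfolding eventually_nhds by (intro exI[of _ "ball c r"]) auto
qed

text \<open>The property that the two germs at parameter \<open>s\<close> coincide is locally constant in \<open>s\<close> by the identity
  theorem on a disc, and the unit interval is connected.\<close>

lemma continuation_unique:
  assumes g: "path g" and Z: "continues_along g Y Z" and Z': "continues_along g Y Z'"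
  shows "\<forall>\<^sub>F x in nhds (g 1). Z x = Z' x"
proof -
  obtain F where F: "\<And>s k l. s \<in> {0..1} \<Longrightarrow> (\<lambda>x. F s x $ k $ l) analytic_on {g s}"
    "\<And>s. s \<in> {0..1} \<Longrightarrow> \<forall>\<^sub>F s' in at s within {0..1}. \<forall>\<^sub>F x in nhds (g s'). F s' x = F s x"
    "\<forall>\<^sub>F x in nhds (g 0). F 0 x = Y x" "\<forall>\<^sub>F x in nhds (g 1). F 1 x = Z x"
    using Z unfolding continues_along_def by blast
  obtain G where G: "\<And>s k l. s \<in> {0..1} \<Longrightarrow> (\<lambda>x. G s x $ k $ l) analytic_on {g s}"
    "\<And>s. s \<in> {0..1} \<Longrightarrow> \<forall>\<^sub>F s' in at s within {0..1}. \<forall>\<^sub>F x in nhds (g s'). G s' x = G s x"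
    "\<forall>\<^sub>F x in nhds (g 0). G 0 x = Y x" "\<forall>\<^sub>F x in nhds (g 1). G 1 x = Z' x"
    using Z' unfolding continues_along_def by blast
  define E where "E s \<longleftrightarrow> (\<forall>\<^sub>F x in nhds (g s). F s x = G s x)" for s
  have loc: "\<forall>\<^sub>F s' in at s within {0..1}. E s = E s'" if s: "s \<in> {0..1}" for s
  proof -
    have "\<exists>r>0. (\<lambda>x. H s x $ k $ l) holomorphic_on ball (g s) r"
      if "(\<lambda>x. H s x $ k $ l) analytic_on {g s}" for H :: "real \<Rightarrow> complex \<Rightarrow> complex^2^2" and k l
      using that by (simp add: analytic_on_def)
    then obtain rF rG where rF: "\<And>k l. rF k l > 0 \<and> (\<lambda>x. F s x $ k $ l) holomorphic_on ball (g s) (rF k l)"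
      and rG: "\<And>k l. rG k l > 0 \<and> (\<lambda>x. G s x $ k $ l) holomorphic_on ball (g s) (rG k l)"
      using F(1)[OF s] G(1)[OF s] by metis
    define r where "r = Min ((\<lambda>(k, l). min (rF k l) (rG k l)) ` UNIV)"
    have r0: "r > 0" unfolding r_def using rF rG by (subst Min_gr_iff) auto
    have rle: "r \<le> rF k l" "r \<le> rG k l" for k l
    proof -
      have "r \<le> min (rF k l) (rG k l)" unfolding r_def by (rule Min_le) (auto intro!: image_eqI[of _ _ "(k, l)"])
      then show "r \<le> rF k l" "r \<le> rG k l" by auto
    qed
    have hF: "(\<lambda>x. F s x $ k $ l) holomorphic_on ball (g s) r" for k l
      using rF[of k l] rle(1)[of k l] by (meson holomorphic_on_subset subset_ball)
    have hG: "(\<lambda>x. G s x $ k $ l) holomorphic_on ball (g s) r" for k l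
      using rG[of k l] rle(2)[of k l] by (meson holomorphic_on_subset subset_ball)
    have "(g \<longlongrightarrow> g s) (at s within {0..1})"
      using g s unfolding path_def continuous_on_def by blast
    then have "\<forall>\<^sub>F s' in at s within {0..1}. g s' \<in> ball (g s) r"
      using r0 by (intro topological_tendstoD) auto
    with F(2)[OF s] G(2)[OF s] show ?thesis
    proof eventually_elim
      case (elim s')
      have c: "g s \<in> ball (g s) r" using r0 by simp
      have "E s' \<longleftrightarrow> (\<forall>\<^sub>F x in nhds (g s'). F s x = G s x)"
      proof
        assume "E s'"
        then show "\<forall>\<^sub>F x in nhds (g s'). F s x = G s x"
          unfolding E_def using elim(1,2) by eventually_elim simp
      next
        assume "\<forall>\<^sub>F x in nhds (g s'). F s x = G s x"
        then show "E s'" unfolding E_def using elim(1,2) by eventually_elim simp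
      qed
      also have "\<dots> \<longleftrightarrow> E s"
        unfolding E_def using matrix_identity_theorem[OF hF hG elim(3) c] matrix_identity_theorem[OF hF hG c elim(3)] by blast
      finally show ?case by simp
    qed
  qed
  have "E 0 = E 1"
    by (rule connected_local_const[of "{0..1::real}"]) (use loc in auto)
  moreover have "E 0" unfolding E_def using F(3) G(3) by eventually_elim simp
  ultimately have "\<forall>\<^sub>F x in nhds (g 1). F 1 x = G 1 x" by (simp add: E_def)
  with F(4) G(4) show ?thesis by eventually_elim simp
qed

section \<open>The slit planes and the connection matrices\<close>

context fuchsian_system
begin

abbreviation gap :: "nat \<Rightarrow> real set" where "gap \<equiv> arc_before n t"

text \<open>This description treats the bounded and the two unbounded intervals alike; disjointness and covering
  are then combinatorics of indices.\<close>

lemma mem_gap_iff: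
  assumes i: "i \<in> {1..n+3}"
  shows "p \<in> gap i \<longleftrightarrow> (\<forall>j\<in>{1..n+2}. (j < i \<longrightarrow> t j < p) \<and> (i \<le> j \<longrightarrow> p < t j))"
proof -
  have le: "t k \<le> t j" if "1 \<le> k" "k \<le> j" "j \<le> n + 2" for k j
    using t_strict_mono[of k j] that by (cases "k = j") auto
  consider "i = 1" | "i = n + 3" | "i \<noteq> 1" "i \<noteq> n + 3" by blast
  then show ?thesis
  proof cases
    case 1
    then show ?thesis using le[of 1] by (force simp: arc_before_def)
  next
    case 2
    then show ?thesis using le[of _ "n+2"] by (force simp: arc_before_def)
  next
    case 3
    then have i': "2 \<le> i" "i \<le> n + 2" using i by auto
    then have "gap i = {t (i-1)<..<t i}" by (auto simp: arc_before_def)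
    moreover have "t j < p" if "t (i - 1) < p" "j < i" "1 \<le> j" for j
    proof -
      have "t j \<le> t (i - 1)" by (rule le) (use that i' in auto)
      then show ?thesis using that(1) by linarith
    qed
    moreover have "p < t j" if "p < t i" "i \<le> j" "j \<le> n + 2" for j
      using le[of i j] that i' by simp
    moreover have "i - 1 \<in> {1..n+2}" "i \<in> {1..n+2}" "i - 1 < i" using i' by auto
    ultimately show ?thesis by (auto simp del: One_nat_def)
  qed
qed

lemma gap_cyclic: "gap (n+4) = gap 1"
  by (simp add: arc_before_def)

lemma gap_nonempty:
  assumes "i \<in> {1..n+4}"
  shows "\<exists>p. p \<in> gap i"
proof (cases "i = 1 \<or> i = n + 4 \<or> i = n + 3")
  case True
  then show ?thesis
    by (auto simp: arc_before_def intro: exI[of _ "t 1 - 1"] exI[of _ "t (n+2) + 1"] lt_ex gt_ex)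
next
  case False
  then show ?thesis using assms t_strict_mono[of "i - 1" i] dense[of "t (i - 1)" "t i"]
    by (auto simp: arc_before_def)
qed

lemma open_gap: "open (gap i)" and convex_gap: "convex (gap i)"
  by (simp_all add: arc_before_def)

lemma gap_disjoint:
  assumes "i \<in> {1..n+3}" "j \<in> {1..n+3}" "p \<in> gap i" "p \<in> gap j"
  shows "i = j"
proof -
  have False if "i < j" "i \<in> {1..n+3}" "j \<in> {1..n+3}" "p \<in> gap i" "p \<in> gap j" for i j
  proof -
    have "i \<in> {1..n+2}" using that by auto
    then have "p < t i" "t i < p"
      using mem_gap_iff[OF that(2), of p] mem_gap_iff[OF that(3), of p] that by auto
    then show False by simp
  qed
  from this[of i j] this[of j i] show ?thesis using assms by (meson linorder_neqE_nat)
qed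

lemma gap_cover:
  assumes "of_real p \<notin> \<Sigma>"
  shows "\<exists>i\<in>{1..n+3}. p \<in> gap i"
proof -
  define P where "P k \<longleftrightarrow> 1 \<le> k \<and> (k = n + 3 \<or> p < t k)" for k
  define i where "i = (LEAST k. P k)"
  have "P (n+3)" by (simp add: P_def)
  then have i: "P i" "i \<le> n + 3" unfolding i_def by (rule LeastI, rule Least_le)
  have ne: "p \<noteq> t j" if "j \<in> {1..n+2}" for j using assms that by (auto simp: sing_def)
  have lt: "t j < p" if "j < i" "j \<in> {1..n+2}" for j
    using not_less_Least[of j P] that ne[of j] unfolding i_def[symmetric] by (auto simp: P_def)
  have gt: "p < t j" if "i \<le> j" "j \<in> {1..n+2}" for j
    using i(1) t_strict_mono[of i j] that by (cases "i = j") (auto simp: P_def)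
  have "i \<in> {1..n+3}" using i by (auto simp: P_def)
  then show ?thesis using mem_gap_iff[of i p] lt gt by blast
qed

text \<open>The two open half-planes joined through one interval.  Paths in this set cross the real line only
  there, and it is starlike with respect to every point of the interval.\<close>

definition slit :: "nat \<Rightarrow> complex set" where
  "slit i = {z. Im z \<noteq> 0 \<or> Re z \<in> gap i}"

lemma slit_cyclic: "slit (n+4) = slit 1"
  by (simp add: slit_def gap_cyclic)

lemma open_slit: "open (slit i)"
proof -
  have "slit i = {z. Im z < 0} \<union> {z. Im z > 0} \<union> Re -` gap i" by (auto simp: slit_def)
  moreover have "open (Re -` gap i)" by (intro open_vimage open_gap continuous_intros)
  ultimately show ?thesis by (simp add: open_Un open_halfspace_Im_lt open_halfspace_Im_gt)
qed

lemma slit_avoids_sing: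
  assumes "i \<in> {1..n+4}" "z \<in> slit i"
  shows "z \<notin> \<Sigma>"
proof
  assume "z \<in> \<Sigma>"
  then obtain j where j: "j \<in> {1..n+2}" "z = of_real (t j)" by (auto simp: sing_def)
  then have tj: "t j \<in> gap i" using assms(2) by (simp add: slit_def)
  show False
  proof (cases "i = n + 4")
    case True
    then show ?thesis using tj mem_gap_iff[of 1 "t j"] j(1) unfolding True gap_cyclic by auto
  next
    case False
    then show ?thesis using assms(1) tj mem_gap_iff[of i "t j"] j(1) by (cases "j < i") auto
  qed
qed

lemma slit_cover:
  assumes "z \<notin> \<Sigma>"
  shows "\<exists>i\<in>{1..n+3}. z \<in> slit i"
proof (cases "Im z = 0")
  case True
  then have "z = of_real (Re z)" by (simp add: complex_eq_iff)
  then show ?thesis using gap_cover[of "Re z"] assms by (auto simp: slit_def)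
next
  case False
  then show ?thesis by (intro bexI[of _ 1]) (auto simp: slit_def)
qed

lemma slit_starlike:
  assumes "p \<in> gap i" "z \<in> slit i"
  shows "closed_segment (of_real p) z \<subseteq> slit i"
proof
  fix w assume "w \<in> closed_segment (of_real p) z"
  then obtain u where u: "0 \<le> u" "u \<le> 1" "w = (1 - u) *\<^sub>R of_real p + u *\<^sub>R z"
    by (auto simp: closed_segment_def)
  show "w \<in> slit i"
  proof (cases "u = 0 \<or> Im z \<noteq> 0")
    case True
    then show ?thesis using assms(1) u by (auto simp: slit_def)
  next
    case False
    then have "Re z \<in> gap i" using assms(2) by (simp add: slit_def)
    then have "(1 - u) *\<^sub>R p + u *\<^sub>R Re z \<in> gap i"
      using convex_gap assms(1) u(1,2) by (intro convexD) auto
    then show ?thesis using u(3) by (simp add: slit_def)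
  qed
qed

lemma fundamental_pair_on_slit:
  assumes "i \<in> {1..n+4}"
  shows "\<exists>\<Phi> \<Psi>. fundamental_pair B (slit i) \<Phi> \<Psi>"
proof -
  obtain p where p: "p \<in> gap i" using gap_nonempty[OF assms] by blast
  have "slit i \<subseteq> - \<Sigma>" using slit_avoids_sing[OF assms] by blast
  then have h: "(\<lambda>z. B z $ k $ l) holomorphic_on slit i" for k l
    using holomorphic_system_matrix holomorphic_on_subset by blast
  have "of_real p \<in> slit i" using p by (simp add: slit_def)
  from fundamental_solution_exists[OF open_slit this slit_starlike[OF p] h]
  show ?thesis .
qed

definition upper :: "complex set" where "upper = {z. Im z > 0}"
definition lower :: "complex set" where "lower = {z. Im z < 0}"

lemma half_planes:
  "open upper" "connected upper" "upper \<subseteq> slit i" "open lower" "connected lower" "lower \<subseteq> slit i"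
  by (auto simp: upper_def lower_def slit_def open_halfspace_Im_lt open_halfspace_Im_gt
      intro!: convex_connected convex_halfspace_Im_lt convex_halfspace_Im_gt)

text \<open>The extensions \<open>\<Phi> i\<close> of the germ \<open>Y\<close> across the intervals, with their inverses \<open>\<Psi> i\<close>, and the
  connection matrices \<open>N i\<close>, with their inverses \<open>N' i\<close>, that compare the extensions in the lower half-plane.
  The index \<open>n + 4\<close> repeats the index \<open>1\<close>, as the intervals are cyclically ordered.\<close>

definition connection_data ::
    "complex \<Rightarrow> (complex \<Rightarrow> complex^2^2) \<Rightarrow> (nat \<Rightarrow> complex \<Rightarrow> complex^2^2) \<Rightarrow>
     (nat \<Rightarrow> complex \<Rightarrow> complex^2^2) \<Rightarrow> (nat \<Rightarrow> complex^2^2) \<Rightarrow> (nat \<Rightarrow> complex^2^2) \<Rightarrow> bool" where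
  "connection_data x0 Y \<Phi> \<Psi> N N' \<longleftrightarrow>
     (\<forall>i\<in>{1..n+4}. fundamental_pair B (slit i) (\<Phi> i) (\<Psi> i) \<and>
        (\<forall>z\<in>upper. \<Phi> i z = \<Phi> 1 z \<and> \<Psi> i z = \<Psi> 1 z) \<and>
        (\<forall>z\<in>lower. \<Phi> i z = \<Phi> 1 z ** N i \<and> \<Psi> i z = N' i ** \<Psi> 1 z) \<and> N' i ** N i = mat 1) \<and>
     N 1 = mat 1 \<and> N (n+4) = mat 1 \<and>
     (\<forall>\<^sub>F z in nhds x0. \<Phi> 1 z = Y z)"

text \<open>Each extension is a fundamental matrix on its slit plane, multiplied by the constant that makes it
  equal to \<open>Y\<close> near the base point; two of them are related by a constant on each half-plane.\<close>

lemma connection_data_exists: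
  assumes x0: "Im x0 > 0" and Y: "fundamental_matrix_near B x0 Y"
  shows "\<exists>\<Phi> \<Psi> N N'. connection_data x0 Y \<Phi> \<Psi> N N'"
proof -
  have "\<forall>\<^sub>F x in nhds x0. x \<in> upper"
    using x0 by (intro eventually_nhds_in_open half_planes(1)) (simp add: upper_def)
  with Y[unfolded fundamental_matrix_near_def]
  have "\<forall>\<^sub>F x in nhds x0. x \<in> upper \<and> invertible (Y x) \<and> mat_deriv Y (B x ** Y x) x"
    by eventually_elim (simp add: mat_deriv_def)
  then obtain r where r: "r > 0"
    "\<And>x. dist x x0 < r \<Longrightarrow> x \<in> upper \<and> invertible (Y x) \<and> mat_deriv Y (B x ** Y x) x"
    unfolding eventually_nhds_metric by blast
  have W: "ball x0 r \<subseteq> upper" using r(2) by (auto simp: dist_commute)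
  have near: "\<forall>\<^sub>F z in nhds x0. z \<in> ball x0 r" using r(1) by (intro eventually_nhds_in_open) auto
  have "\<exists>\<Phi> \<Psi>. fundamental_pair B (slit i) \<Phi> \<Psi> \<and> (\<forall>z\<in>ball x0 r. \<Phi> z = Y z)" if i: "i \<in> {1..n+4}" for i
  proof -
    obtain \<Phi> \<Psi> where \<Phi>: "fundamental_pair B (slit i) \<Phi> \<Psi>" using fundamental_pair_on_slit[OF i] by blast
    have "ball x0 r \<subseteq> slit i" using W half_planes(3) by blast
    from solution_eq_fundamental_mult[OF \<Phi> open_ball connected_ball this, of Y] r(2)
    obtain K where K: "\<And>z. z \<in> ball x0 r \<Longrightarrow> Y z = \<Phi> z ** K" by (auto simp: dist_commute)
    have "invertible (Y x0)" using r by simp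
    then obtain Y' where "Y' ** Y x0 = mat 1" unfolding invertible_left_inverse ..
    then have "(Y' ** \<Phi> x0) ** K = mat 1" using K[of x0] r(1) by (simp add: matrix_mul_assoc)
    from fundamental_pair_mult[OF \<Phi> this] K show ?thesis by (intro exI conjI) auto
  qed
  then obtain \<Phi>0 \<Psi>0 where 0: "\<And>i. i \<in> {1..n+4} \<Longrightarrow> fundamental_pair B (slit i) (\<Phi>0 i) (\<Psi>0 i)"
    "\<And>i z. i \<in> {1..n+4} \<Longrightarrow> z \<in> ball x0 r \<Longrightarrow> \<Phi>0 i z = Y z"
    by metis
  define \<Phi> where "\<Phi> i = \<Phi>0 (if i = n + 4 then 1 else i)" for i
  define \<Psi> where "\<Psi> i = \<Psi>0 (if i = n + 4 then 1 else i)" for i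
  have fp: "fundamental_pair B (slit i) (\<Phi> i) (\<Psi> i)" if "i \<in> {1..n+4}" for i
    using 0(1)[of i] 0(1)[of 1] that by (cases "i = n + 4") (auto simp: \<Phi>_def \<Psi>_def slit_cyclic)
  have \<Phi>Y: "\<Phi> i z = Y z" if "i \<in> {1..n+4}" "z \<in> ball x0 r" for i z
    using 0(2)[of i z] 0(2)[of 1 z] that by (auto simp: \<Phi>_def)
  have one: "1 \<in> {1..n+4}" by simp
  have inv_unique: "Q = R" if "Q ** P = mat 1" "P ** R = mat 1" for P Q R :: "complex^2^2"
    using that by (metis matrix_mul_assoc matrix_mul_lid matrix_mul_rid)
  have up: "\<Phi> i z = \<Phi> 1 z \<and> \<Psi> i z = \<Psi> 1 z" if i: "i \<in> {1..n+4}" and z: "z \<in> upper" for i z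
  proof -
    have "\<exists>K. \<forall>z\<in>upper. \<Phi> i z = \<Phi> 1 z ** K"
      using fundamental_pairD(1)[OF fp[OF i]] half_planes(3)
      by (intro solution_eq_fundamental_mult[OF fp[OF one] half_planes(1-3)]) blast
    then obtain K where K: "\<And>z. z \<in> upper \<Longrightarrow> \<Phi> i z = \<Phi> 1 z ** K" by blast
    have x: "x0 \<in> ball x0 r" "x0 \<in> upper" using r(1) W by auto
    have "\<Phi> 1 x0 ** K = \<Phi> 1 x0" using K[OF x(2)] \<Phi>Y[OF i x(1)] \<Phi>Y[OF one x(1)] by simp
    moreover have "\<Psi> 1 x0 ** \<Phi> 1 x0 = mat 1"
      using fundamental_pairD(3)[OF fp[OF one]] x(2) half_planes(3) by blast
    ultimately have "K = mat 1" by (metis matrix2_cancel_left)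
    then have \<Phi>: "\<Phi> i z = \<Phi> 1 z" using K[OF z] by simp
    have zs: "z \<in> slit i" "z \<in> slit 1" using z half_planes(3) by blast+
    have "\<Psi> i z = \<Psi> 1 z"
      using inv_unique[of "\<Psi> i z" "\<Phi> i z" "\<Psi> 1 z"] fundamental_pairD(3)[OF fp[OF i] zs(1)]
        fundamental_pairD(4)[OF fp[OF one] zs(2)] \<Phi> by simp
    then show ?thesis using \<Phi> by simp
  qed
  have "\<exists>M M'. (\<forall>z\<in>lower. \<Phi> i z = \<Phi> 1 z ** M \<and> \<Psi> i z = M' ** \<Psi> 1 z) \<and> M' ** M = mat 1"
    if i: "i \<in> {1..n+4}" for i
  proof -
    have "\<exists>K. \<forall>z\<in>lower. \<Phi> i z = \<Phi> 1 z ** K"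
      using fundamental_pairD(1)[OF fp[OF i]] half_planes(6)
      by (intro solution_eq_fundamental_mult[OF fp[OF one] half_planes(4-6)]) blast
    then obtain K where K: "\<And>z. z \<in> lower \<Longrightarrow> \<Phi> i z = \<Phi> 1 z ** K" by blast
    \<comment> \<open>Any point of the lower half-plane would do to compute the inverse of \<open>K\<close>.\<close>
    define K' where "K' = \<Psi> i (- \<i>) ** \<Phi> 1 (- \<i>)"
    have il: "- \<i> \<in> lower" by (simp add: lower_def)
    have KK: "K' ** K = mat 1"
      using K[OF il] fundamental_pairD(3)[OF fp[OF i], of "- \<i>"] il half_planes(6)
      by (auto simp: K'_def matrix_mul_assoc[symmetric])
    have "\<Psi> i z = K' ** \<Psi> 1 z" if z: "z \<in> lower" for z
    proof (rule inv_unique)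
      have zs: "z \<in> slit i" "z \<in> slit 1" using z half_planes(6) by blast+
      show "\<Psi> i z ** (\<Phi> 1 z ** K) = mat 1"
        using fundamental_pairD(3)[OF fp[OF i] zs(1)] K[OF z] by simp
      have "\<Phi> 1 z ** K ** (K' ** \<Psi> 1 z) = \<Phi> 1 z ** (K ** (K' ** \<Psi> 1 z))" by (simp add: matrix_mul_assoc)
      then show "\<Phi> 1 z ** K ** (K' ** \<Psi> 1 z) = mat 1"
        using matrix2_cancel_left[OF matrix2_inverse_sym[OF KK], of "\<Psi> 1 z"]
          fundamental_pairD(4)[OF fp[OF one] zs(2)] by simp
    qed
    then show ?thesis using K KK by blast
  qed
  then obtain N0 N0' where N0: "\<And>i z. i \<in> {1..n+4} \<Longrightarrow> z \<in> lower \<Longrightarrow> \<Phi> i z = \<Phi> 1 z ** N0 i \<and> \<Psi> i z = N0' i ** \<Psi> 1 z"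
    "\<And>i. i \<in> {1..n+4} \<Longrightarrow> N0' i ** N0 i = mat 1" by metis
  have triv: "N0 i = mat 1" if "\<Phi> i = \<Phi> 1" "i \<in> {1..n+4}" for i
  proof -
    have il: "- \<i> \<in> lower" by (simp add: lower_def)
    have "\<Psi> 1 (- \<i>) ** \<Phi> 1 (- \<i>) = mat 1"
      using fundamental_pairD(3)[OF fp[OF one]] il half_planes(6) by blast
    moreover have "\<Phi> 1 (- \<i>) ** N0 i = \<Phi> 1 (- \<i>)" using N0(1)[OF that(2) il] that(1) by simp
    ultimately show ?thesis by (metis matrix2_cancel_left)
  qed
  have "N0 1 = mat 1" "N0 (n+4) = mat 1" by (rule triv; simp add: \<Phi>_def)+
  moreover have "\<forall>\<^sub>F z in nhds x0. \<Phi> 1 z = Y z" using near by eventually_elim (rule \<Phi>Y[OF one])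
  ultimately have "connection_data x0 Y \<Phi> \<Psi> N0 N0'"
    unfolding connection_data_def using fp up N0 by blast
  then show ?thesis by blast
qed

end

section \<open>Monodromy and the conjugation condition\<close>

text \<open>For \<open>M\<^sub>j = N\<^sub>j\<^sub>+\<^sub>1\<^sup>-\<^sup>1 N\<^sub>j\<close> the products telescope, \<open>M\<^sub>j \<dots> M\<^sub>1 = N\<^sub>j\<^sub>+\<^sub>1\<^sup>-\<^sup>1\<close>, and the condition on \<open>M\<^sub>j\<close> says that
  \<open>N\<^sup>c\<^sub>i C N\<^sub>i\<close>, with \<open>N\<^sup>c\<^sub>i\<close> the conjugate of \<open>N\<^sub>i\<close>, has the same value for \<open>i = j\<close> and \<open>i = j + 1\<close>.
  The common value is \<open>C\<close> as \<open>N\<^sub>1 = 1\<close>.\<close>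

lemma C1_condition_iff:
  fixes N N' M :: "nat \<Rightarrow> complex^2^2"
  assumes inv: "\<And>i. i \<in> {1..n+4} \<Longrightarrow> N' i ** N i = mat 1"
    and N1: "N 1 = mat 1"
    and M: "\<And>j. j \<in> {1..n+3} \<Longrightarrow> M j = N' (j+1) ** N j"
  shows "condition_C1 n M \<longleftrightarrow>
    (\<exists>C. invertible C \<and> (\<forall>i\<in>{1..n+4}. map_matrix cnj (N i) ** C ** N i = C))"
proof -
  have inv': "N i ** N' i = mat 1" if "i \<in> {1..n+4}" for i
    by (rule matrix2_inverse_sym[OF inv[OF that]])
  have N'1: "N' 1 = mat 1" using inv[of 1] N1 by simp
  have prod: "rev_prod M j = N' (j+1)" if "j \<le> n + 3" for j
    using that
  proof (induction j)
    case 0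
    then show ?case using N'1 by simp
  next
    case (Suc j)
    then have "rev_prod M (Suc j) = N' (Suc j + 1) ** N (Suc j) ** N' (Suc j)" using M[of "Suc j"] by simp
    also have "\<dots> = N' (Suc j + 1) ** (N (Suc j) ** N' (Suc j))" by (rule matrix_mul_assoc[symmetric])
    also have "\<dots> = N' (Suc j + 1)" using inv'[of "Suc j"] Suc.prems by simp
    finally show ?case .
  qed
  have cinv: "map_matrix cnj (N' i) ** map_matrix cnj (N i) = mat 1"
    "map_matrix cnj (N i) ** map_matrix cnj (N' i) = mat 1" if "i \<in> {1..n+4}" for i
    using inv[OF that] inv'[OF that] by (simp_all add: map_matrix_cnj_mult[symmetric])
  note cancel = inv inv' cinv matrix2_cancel_left[OF inv] matrix2_cancel_left[OF inv']
    matrix2_cancel_left[OF cinv(1)] matrix2_cancel_left[OF cinv(2)]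
  have rhs: "matrix_inv (rev_prod M j) ** matrix_inv (M j) ** rev_prod M j = N (j+1) ** N' j"
    if j: "j \<in> {1..n+3}" for j
  proof -
    have ij: "j \<in> {1..n+4}" "j + 1 \<in> {1..n+4}" using j by auto
    have "matrix_inv (N' (j+1)) = N (j+1)" using inv'[OF ij(2)] by (rule matrix_inv_unique)
    moreover have "matrix_inv (M j) = N' j ** N (j+1)"
      unfolding M[OF j] by (rule matrix_inv_unique) (simp only: matrix_mul_assoc[symmetric] cancel[OF ij(1)] cancel[OF ij(2)])
    moreover have "rev_prod M j = N' (j+1)" using prod[of j] j by simp
    ultimately show ?thesis
      by (simp only: matrix_mul_assoc[symmetric] cancel[OF ij(1)] cancel[OF ij(2)] matrix_mul_rid)
  qed
  have "condition_C1 n M \<longleftrightarrow> (\<exists>C. invertible C \<and> (\<forall>j\<in>{1..n+3}.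
      matrix_inv C ** (map_matrix cnj (N' (j+1)) ** map_matrix cnj (N j)) ** C = N (j+1) ** N' j))"
    unfolding condition_C1_def using rhs M by (simp add: map_matrix_cnj_mult)
  also have "\<dots> \<longleftrightarrow> (\<exists>C. invertible C \<and> (\<forall>i\<in>{1..n+4}. map_matrix cnj (N i) ** C ** N i = C))"
  proof (rule ex_cong1, rule conj_cong[OF refl])
    fix C :: "complex^2^2"
    assume "invertible C"
    then obtain C' where C': "C' ** C = mat 1" unfolding invertible_left_inverse ..
    note CC = C' matrix2_inverse_sym[OF C'] matrix2_cancel_left[OF C'] matrix2_cancel_left[OF matrix2_inverse_sym[OF C']]
    have iC: "matrix_inv C = C'" using C' by (rule matrix_inv_unique)
    show "(\<forall>j\<in>{1..n+3}. matrix_inv C ** (map_matrix cnj (N' (j+1)) ** map_matrix cnj (N j)) ** C = N (j+1) ** N' j)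
        \<longleftrightarrow> (\<forall>i\<in>{1..n+4}. map_matrix cnj (N i) ** C ** N i = C)"
    proof
      assume *: "\<forall>j\<in>{1..n+3}. matrix_inv C ** (map_matrix cnj (N' (j+1)) ** map_matrix cnj (N j)) ** C = N (j+1) ** N' j"
      have "map_matrix cnj (N (Suc i)) ** C ** N (Suc i) = C" if "i < n + 4" for i
        using that
      proof (induction i)
        case 0
        then show ?case using N1 by simp
      next
        case (Suc i)
        define j where "j = Suc i"
        have j: "j \<in> {1..n+3}" "j \<in> {1..n+4}" "j + 1 \<in> {1..n+4}" using Suc.prems by (auto simp: j_def)
        have IH: "map_matrix cnj (N j) ** C ** N j = C" using Suc by (simp add: j_def)
        have "C' ** (map_matrix cnj (N' (j+1)) ** map_matrix cnj (N j)) ** C = N (j+1) ** N' j"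
          using *[rule_format, OF j(1)] iC by simp
        then have "map_matrix cnj (N (j+1)) ** (C ** (C' ** (map_matrix cnj (N' (j+1)) ** map_matrix cnj (N j)) ** C)) ** N j
            = map_matrix cnj (N (j+1)) ** (C ** (N (j+1) ** N' j)) ** N j" by simp
        then have "map_matrix cnj (N j) ** C ** N j = map_matrix cnj (N (j+1)) ** C ** N (j+1)"
          by (simp only: matrix_mul_assoc[symmetric] CC cancel[OF j(2)] cancel[OF j(3)] matrix_mul_rid)
        then show ?case using IH by (simp add: j_def)
      qed
      then have "map_matrix cnj (N i) ** C ** N i = C" if "i \<in> {1..n+4}" for i
        using that by (cases i) auto
      then show "\<forall>i\<in>{1..n+4}. map_matrix cnj (N i) ** C ** N i = C" by blast
    next
      assume *: "\<forall>i\<in>{1..n+4}. map_matrix cnj (N i) ** C ** N i = C"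
      show "\<forall>j\<in>{1..n+3}. matrix_inv C ** (map_matrix cnj (N' (j+1)) ** map_matrix cnj (N j)) ** C = N (j+1) ** N' j"
      proof
        fix j assume "j \<in> {1..n+3}"
        then have j: "j \<in> {1..n+4}" "j + 1 \<in> {1..n+4}" by auto
        have "map_matrix cnj (N j) ** C = map_matrix cnj (N j) ** C ** N j ** N' j"
          by (simp only: matrix_mul_assoc[symmetric] cancel[OF j(1)] matrix_mul_rid)
        also have "\<dots> = C ** N' j" using * j(1) by simp
        finally have 1: "map_matrix cnj (N j) ** C = C ** N' j" .
        have "map_matrix cnj (N' (j+1)) ** C
            = map_matrix cnj (N' (j+1)) ** (map_matrix cnj (N (j+1)) ** C ** N (j+1))" using * j(2) by simp
        also have "\<dots> = C ** N (j+1)"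
          by (simp only: matrix_mul_assoc[symmetric] cancel[OF j(2)])
        finally have 2: "map_matrix cnj (N' (j+1)) ** C = C ** N (j+1)" .
        have "matrix_inv C ** (map_matrix cnj (N' (j+1)) ** map_matrix cnj (N j)) ** C
            = C' ** (map_matrix cnj (N' (j+1)) ** (map_matrix cnj (N j) ** C))"
          unfolding iC by (simp only: matrix_mul_assoc[symmetric])
        also have "\<dots> = C' ** ((map_matrix cnj (N' (j+1)) ** C) ** N' j)"
          unfolding 1 by (simp only: matrix_mul_assoc[symmetric])
        also have "\<dots> = N (j+1) ** N' j"
          unfolding 2 by (simp only: matrix_mul_assoc[symmetric] CC)
        finally show "matrix_inv C ** (map_matrix cnj (N' (j+1)) ** map_matrix cnj (N j)) ** C = N (j+1) ** N' j" .
      qed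
    qed
  qed
  finally show ?thesis .
qed

context fuchsian_system
begin

lemma connection_dataD:
  assumes "connection_data x0 Y \<Phi> \<Psi> N N'" "i \<in> {1..n+4}"
  shows "fundamental_pair B (slit i) (\<Phi> i) (\<Psi> i)"
    "\<And>z. z \<in> upper \<Longrightarrow> \<Phi> i z = \<Phi> 1 z" "\<And>z. z \<in> upper \<Longrightarrow> \<Psi> i z = \<Psi> 1 z"
    "\<And>z. z \<in> lower \<Longrightarrow> \<Phi> i z = \<Phi> 1 z ** N i" "\<And>z. z \<in> lower \<Longrightarrow> \<Psi> i z = N' i ** \<Psi> 1 z"
    "N' i ** N i = mat 1" "N i ** N' i = mat 1"
proof -
  have *: "fundamental_pair B (slit i) (\<Phi> i) (\<Psi> i) \<and>
        (\<forall>z\<in>upper. \<Phi> i z = \<Phi> 1 z \<and> \<Psi> i z = \<Psi> 1 z) \<and>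
        (\<forall>z\<in>lower. \<Phi> i z = \<Phi> 1 z ** N i \<and> \<Psi> i z = N' i ** \<Psi> 1 z) \<and> N' i ** N i = mat 1"
    using assms(1) unfolding connection_data_def by (elim conjE) (erule bspec, rule assms(2))
  show "fundamental_pair B (slit i) (\<Phi> i) (\<Psi> i)" by (rule *[THEN conjunct1])
  show inv: "N' i ** N i = mat 1" by (rule *[THEN conjunct2, THEN conjunct2, THEN conjunct2])
  show "N i ** N' i = mat 1" by (rule matrix2_inverse_sym[OF inv])
  fix z
  show "\<Phi> i z = \<Phi> 1 z" "\<Psi> i z = \<Psi> 1 z" if "z \<in> upper"
    by (rule *[THEN conjunct2, THEN conjunct1, THEN bspec, OF that, THEN conjunct1]
             *[THEN conjunct2, THEN conjunct1, THEN bspec, OF that, THEN conjunct2])+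
  show "\<Phi> i z = \<Phi> 1 z ** N i" "\<Psi> i z = N' i ** \<Psi> 1 z" if "z \<in> lower"
    by (rule *[THEN conjunct2, THEN conjunct2, THEN conjunct1, THEN bspec, OF that, THEN conjunct1]
             *[THEN conjunct2, THEN conjunct2, THEN conjunct1, THEN bspec, OF that, THEN conjunct2])+
qed

text \<open>Before the middle of the stay in the lower half-plane use the extension across the first interval,
  afterwards the one across the second interval, normalized so that both agree in the lower half-plane.\<close>

lemma continuation_along_gamma:
  assumes x0: "Im x0 > 0" and cd: "connection_data x0 Y \<Phi> \<Psi> N N'"
    and j: "j \<in> {1..n+3}" and g: "gamma_loop n t x0 j g"
  shows "continues_along g Y (\<lambda>x. Y x ** (N' (j+1) ** N j))"
proof -
  have j': "j \<in> {1..n+4}" "j + 1 \<in> {1..n+4}" using j by auto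
  obtain s1 s2 where s: "0 < s1" "s1 < s2" "s2 < 1"
    "g s1 \<in> of_real ` gap j" "g s2 \<in> of_real ` gap (j+1)"
    "\<And>s. s \<in> {0..<s1} \<union> {s2<..1} \<Longrightarrow> Im (g s) > 0" "\<And>s. s \<in> {s1<..<s2} \<Longrightarrow> Im (g s) < 0"
    and gp: "path g" "g 0 = x0" "g 1 = x0"
    using g unfolding gamma_loop_def pathstart_def pathfinish_def by blast
  define m where "m = (s1 + s2) / 2"
  have m: "s1 < m" "m < s2" using s by (auto simp: m_def)
  define K where "K = N' (j+1) ** N j"
  define F where "F s = (if s < m then \<Phi> j else (\<lambda>x. \<Phi> (j+1) x ** K))" for s :: real
  have gcont: "(g \<longlongrightarrow> g s) (at s within {0..1})" if "s \<in> {0..1}" for s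
    using gp(1) that unfolding path_def continuous_on_def by blast
  have near: "\<forall>\<^sub>F z in nhds x0. z \<in> upper \<and> \<Phi> 1 z = Y z"
    using x0 cd half_planes(1) unfolding connection_data_def
    by (intro eventually_conj eventually_nhds_in_open) (auto simp: upper_def)
  have "continues_along g Y (\<lambda>x. Y x ** K)"
    unfolding continues_along_def
  proof (intro exI[of _ F] conjI ballI allI)
    fix s k l assume s01: "s \<in> {0..1::real}"
    have an: "(\<lambda>x. G x $ k $ l) analytic_on {z}"
      if "\<And>z. z \<in> slit i \<Longrightarrow> mat_deriv G (D z) z" "z \<in> slit i" for G D z i
    proof -
      have "(\<lambda>x. G x $ k $ l) holomorphic_on slit i" by (rule mat_deriv_holomorphic) (rule that(1))
      then have "(\<lambda>x. G x $ k $ l) analytic_on slit i" by (simp add: analytic_on_open open_slit)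
      then show ?thesis by (rule analytic_on_subset) (use that(2) in simp)
    qed
    show "(\<lambda>x. F s x $ k $ l) analytic_on {g s}"
    proof (cases "s < m")
      case True
      have "g s \<in> slit j"
      proof (cases s s1 rule: linorder_cases)
        case less
        then show ?thesis using s(6)[of s] s01 by (simp add: slit_def)
      next
        case equal
        then show ?thesis using s(4) by (auto simp: slit_def)
      next
        case greater
        then show ?thesis using s(7)[of s] True m by (simp add: slit_def)
      qed
      then show ?thesis using an[of j "\<Phi> j", OF fundamental_pairD(1)[OF connection_dataD(1)[OF cd j'(1)]]] True
        by (simp add: F_def)
    next
      case False
      have "g s \<in> slit (j+1)"
      proof (cases s s2 rule: linorder_cases)
        case less
        then show ?thesis using s(7)[of s] False m by (simp add: slit_def)
      next
        case equal
        then show ?thesis using s(5) by (auto simp: slit_def)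
      next
        case greater
        then show ?thesis using s(6)[of s] s01 by (simp add: slit_def)
      qed
      then show ?thesis
        using an[of "j+1" "\<lambda>x. \<Phi> (j+1) x ** K", OF mat_deriv_mult_right[OF fundamental_pairD(1)[OF connection_dataD(1)[OF cd j'(2)]]]] False
        by (simp add: F_def)
    qed
  next
    fix s assume s01: "s \<in> {0..1::real}"
    consider "s < m" | "s = m" | "s > m" by linarith
    then show "\<forall>\<^sub>F s' in at s within {0..1}. \<forall>\<^sub>F x in nhds (g s'). F s' x = F s x"
    proof cases
      case 1
      have "\<forall>\<^sub>F s' in at s within {0..1}. s' < m" using 1 by (intro order_tendstoD(2)[OF tendsto_ident_at])
      then show ?thesis by eventually_elim (use 1 in \<open>simp add: F_def\<close>)
    next
      case 2
      have "g m \<in> lower" using s(7)[of m] m by (simp add: lower_def)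
      then have "\<forall>\<^sub>F s' in at s within {0..1}. g s' \<in> lower"
        using 2 by (intro topological_tendstoD[OF gcont[OF s01] half_planes(4)]) simp
      then show ?thesis
      proof eventually_elim
        case (elim s')
        have "\<forall>\<^sub>F x in nhds (g s'). x \<in> lower" using elim by (intro eventually_nhds_in_open half_planes(4))
        then show ?case
        proof eventually_elim
          case (elim x)
          have "\<Phi> (j+1) x ** K = \<Phi> 1 x ** (N (j+1) ** (N' (j+1) ** N j))"
            using connection_dataD(4)[OF cd j'(2) elim] by (simp add: K_def matrix_mul_assoc)
          also have "\<dots> = \<Phi> j x"
            using connection_dataD(4)[OF cd j'(1) elim] matrix2_cancel_left[OF connection_dataD(7)[OF cd j'(2)]] by simp
          finally show ?case by (simp add: F_def)
        qed
      qed
    next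
      case 3
      have "\<forall>\<^sub>F s' in at s within {0..1}. s' > m" using 3 by (intro order_tendstoD(1)[OF tendsto_ident_at])
      then show ?thesis by eventually_elim (use 3 in \<open>simp add: F_def\<close>)
    qed
  next
    show "\<forall>\<^sub>F x in nhds (g 0). F 0 x = Y x"
      unfolding gp(2) using near
    proof eventually_elim
      case (elim x)
      then show ?case using connection_dataD(2)[OF cd j'(1)] m s(1) by (simp add: F_def)
    qed
    show "\<forall>\<^sub>F x in nhds (g 1). F 1 x = Y x ** K"
      unfolding gp(3) using near
    proof eventually_elim
      case (elim x)
      then show ?case using connection_dataD(2)[OF cd j'(2)] m s(3) by (simp add: F_def)
    qed
  qed
  then show ?thesis by (simp add: K_def)
qed

text \<open>The quadrilateral through one point of each of the two intervals and the conjugate of the base point.\<close>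

lemma gamma_loop_exists:
  assumes x0: "Im x0 > 0" and j: "j \<in> {1..n+3}"
  shows "\<exists>g. gamma_loop n t x0 j g"
proof -
  obtain p where p: "p \<in> gap j" using gap_nonempty[of j] j by auto
  obtain p' where p': "p' \<in> gap (j+1)" using gap_nonempty[of "j+1"] j by auto
  define g where "g = (linepath x0 (of_real p) +++ linepath (of_real p) (cnj x0)) +++
      (linepath (cnj x0) (of_real p') +++ linepath (of_real p') x0)"
  have "path g" "pathstart g = x0" "pathfinish g = x0" by (simp_all add: g_def)
  moreover have "g (1/4) = of_real p" "g (3/4) = of_real p'"
    by (simp_all add: g_def joinpaths_def linepath_def)
  moreover have "Im (g s) > 0" if "s \<in> {0..<1/4} \<union> {3/4<..1}" for s
  proof (cases "s < 1/4")
    case True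
    then have "Im (g s) = (1 - 4 * s) * Im x0" by (simp add: g_def joinpaths_def linepath_def)
    then show ?thesis using True x0 by simp
  next
    case False
    then have "s > 3/4" using that by auto
    then have "Im (g s) = (4 * s - 3) * Im x0" by (simp add: g_def joinpaths_def linepath_def algebra_simps)
    then show ?thesis using \<open>s > 3/4\<close> x0 by simp
  qed
  moreover have "Im (g s) < 0" if "s \<in> {1/4<..<3/4}" for s
  proof (cases "s \<le> 1/2")
    case True
    then have "Im (g s) = - ((4 * s - 1) * Im x0)"
      using that by (simp add: g_def joinpaths_def linepath_def algebra_simps)
    then show ?thesis using that x0 by simp
  next
    case False
    then have "Im (g s) = - ((3 - 4 * s) * Im x0)"
      using that by (simp add: g_def joinpaths_def linepath_def algebra_simps)
    then show ?thesis using that x0 by simp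
  qed
  ultimately show ?thesis
    unfolding gamma_loop_def using p p' by (intro exI[of _ g] conjI exI[of _ "1/4"] exI[of _ "3/4"]) auto
qed

text \<open>Continuation along a loop depends only on the intervals that are crossed, so every choice of loops
  gives the matrices computed from the connection data.\<close>

lemma monodromy_matrices_iff:
  assumes x0: "Im x0 > 0" and Y: "fundamental_matrix_near B x0 Y" and cd: "connection_data x0 Y \<Phi> \<Psi> N N'"
  shows "(\<forall>j\<in>{1..n+3}. \<exists>g. gamma_loop n t x0 j g \<and> continues_along g Y (\<lambda>x. Y x ** M j)) \<longleftrightarrow>
         (\<forall>j\<in>{1..n+3}. M j = N' (j+1) ** N j)"
proof (intro iffI ballI)
  fix j assume j: "j \<in> {1..n+3}"
    and "\<forall>j\<in>{1..n+3}. \<exists>g. gamma_loop n t x0 j g \<and> continues_along g Y (\<lambda>x. Y x ** M j)"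
  then obtain g where g: "gamma_loop n t x0 j g" "continues_along g Y (\<lambda>x. Y x ** M j)" by blast
  have gp: "path g" "g 1 = x0" using g(1) by (auto simp: gamma_loop_def pathfinish_def)
  have "\<forall>\<^sub>F x in nhds x0. Y x ** M j = Y x ** (N' (j+1) ** N j)"
    using continuation_unique[OF gp(1) g(2) continuation_along_gamma[OF x0 cd j g(1)]] gp(2) by simp
  then have "Y x0 ** M j = Y x0 ** (N' (j+1) ** N j)" by (rule eventually_nhds_x_imp_x)
  moreover have "invertible (Y x0)"
    using eventually_nhds_x_imp_x[OF Y[unfolded fundamental_matrix_near_def]] by blast
  then obtain Y' where "Y' ** Y x0 = mat 1" unfolding invertible_left_inverse ..
  ultimately show "M j = N' (j+1) ** N j" by (metis matrix2_cancel_left)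
next
  fix j assume j: "j \<in> {1..n+3}" and M: "\<forall>j\<in>{1..n+3}. M j = N' (j+1) ** N j"
  then show "\<exists>g. gamma_loop n t x0 j g \<and> continues_along g Y (\<lambda>x. Y x ** M j)"
    using gamma_loop_exists[OF x0 j] continuation_along_gamma[OF x0 cd j] by auto
qed

text \<open>Conjugation exchanges the half-planes, so the conjugates \<open>\<Phi>\<^sup>c\<^sub>i\<close> of the extensions solve the conjugate system, agree
  in the lower half-plane, and differ by the conjugates of the \<open>N\<^sub>i\<close> in the upper one.  A constant
  intertwining matrix maps \<open>\<Phi>\<^sub>i\<close> to \<open>\<Phi>\<^sup>c\<^sub>i L\<^sub>i\<close>, and comparing in both half-planes relates the \<open>L\<^sub>i\<close>.
  Conversely \<open>\<Phi>\<^sup>c\<^sub>i C N\<^sub>i \<Phi>\<^sub>i\<^sup>-\<^sup>1\<close> is independent of \<open>i\<close> in both half-planes and so defines a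
  single-valued gauge transformation, which is constant.\<close>

lemma real_up_to_phase_iff_connection:
  assumes cd: "connection_data x0 Y \<Phi> \<Psi> N N'"
  shows "real_up_to_phase n A \<longleftrightarrow>
    (\<exists>C. invertible C \<and> (\<forall>i\<in>{1..n+4}. map_matrix cnj (N i) ** C ** N i = C))"
proof -
  note D = connection_dataD[OF cd]
  have cnj_slit: "cnj z \<in> slit i" if "z \<in> slit i" for z i using that by (simp add: slit_def)
  have cnj_half: "cnj z \<in> lower \<longleftrightarrow> z \<in> upper" "cnj z \<in> upper \<longleftrightarrow> z \<in> lower" for z
    by (simp_all add: upper_def lower_def)
  define \<Phi>c where "\<Phi>c i z = map_matrix cnj (\<Phi> i (cnj z))" for i z
  define \<Psi>c where "\<Psi>c i z = map_matrix cnj (\<Psi> i (cnj z))" for i z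
  have fpc: "fundamental_pair Bc (slit i) (\<Phi>c i) (\<Psi>c i)" if "i \<in> {1..n+4}" for i
    using fundamental_pair_cnj[OF D(1)[OF that] cnj_slit]
    by (simp add: \<Phi>c_def[abs_def] \<Psi>c_def[abs_def] Bc_eq[abs_def])
  have \<Phi>c_upper: "\<Phi>c i z = \<Phi>c 1 z ** map_matrix cnj (N i)" if "i \<in> {1..n+4}" "z \<in> upper" for i z
    using D(4)[OF that(1), of "cnj z"] that(2) cnj_half by (simp add: \<Phi>c_def map_matrix_cnj_mult)
  have \<Phi>c_lower: "\<Phi>c i z = \<Phi>c 1 z" if "i \<in> {1..n+4}" "z \<in> lower" for i z
    using D(2)[OF that(1), of "cnj z"] that(2) cnj_half by (simp add: \<Phi>c_def)
  have one: "1 \<in> {1..n+4}" by simp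
  have N1: "N 1 = mat 1" using cd by (simp add: connection_data_def)
  have iu: "\<i> \<in> upper" and il: "- \<i> \<in> lower" by (simp_all add: upper_def lower_def)
  show ?thesis
  proof
    assume "real_up_to_phase n A"
    then obtain C where C: "invertible C" "\<And>i. i \<in> {1..n+2} \<Longrightarrow> Ac i ** C = C ** A i"
      unfolding real_up_to_phase_iff by blast
    have BC: "Bc z ** C = C ** B z" for z
    proof -
      have "(Bc z ** C) $ k $ l = (C ** B z) $ k $ l" for k l
      proof -
        have "(Bc z ** C) $ k $ l = (\<Sum>i=1..n+2. (Ac i ** C) $ k $ l / (z - of_real (t i)))"
          by (simp only: matrix2_mult_nth system_matrix_def vec_lambda_beta sum_distrib_right
              sum.distrib[symmetric] add_divide_distrib times_divide_eq_left)
        also have "\<dots> = (\<Sum>i=1..n+2. (C ** A i) $ k $ l / (z - of_real (t i)))"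
          by (rule sum.cong[OF refl]) (simp only: C(2))
        also have "\<dots> = (C ** B z) $ k $ l"
          by (simp only: matrix2_mult_nth system_matrix_def vec_lambda_beta sum_distrib_left
              sum.distrib[symmetric] add_divide_distrib times_divide_eq_right)
        finally show ?thesis .
      qed
      then show ?thesis by (simp add: vec_eq_iff)
    qed
    have "\<exists>L. \<forall>z\<in>slit i. C ** \<Phi> i z = \<Phi>c i z ** L" if i: "i \<in> {1..n+4}" for i
    proof (rule solution_eq_fundamental_mult[OF fpc[OF i] open_slit])
      obtain p where "p \<in> gap i" using gap_nonempty[OF i] by blast
      then have "starlike (slit i)"
        unfolding starlike_def by (intro bexI[of _ "of_real p"] ballI slit_starlike) (auto simp: slit_def)
      then show "connected (slit i)" by (rule starlike_imp_connected)
      show "mat_deriv (\<lambda>z. C ** \<Phi> i z) (Bc z ** (C ** \<Phi> i z)) z" if "z \<in> slit i" for z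
        using mat_deriv_mult_left[OF fundamental_pairD(1)[OF D(1)[OF i] that], of C] BC[of z]
        by (simp add: matrix_mul_assoc)
    qed simp
    then obtain L where L: "\<And>i z. i \<in> {1..n+4} \<Longrightarrow> z \<in> slit i \<Longrightarrow> C ** \<Phi> i z = \<Phi>c i z ** L i" by metis
    have fp1: "\<Psi>c 1 z ** \<Phi>c 1 z = mat 1" if "z \<in> slit 1" for z using fundamental_pairD(3)[OF fpc[OF one] that] .
    have u: "map_matrix cnj (N i) ** L i = L 1" and l: "L 1 ** N i = L i" if i: "i \<in> {1..n+4}" for i
    proof -
      have ius: "\<i> \<in> slit i" "\<i> \<in> slit 1" "- \<i> \<in> slit i" "- \<i> \<in> slit 1" by (simp_all add: slit_def)
      have "\<Phi>c 1 \<i> ** (map_matrix cnj (N i) ** L i) = \<Phi>c 1 \<i> ** L 1"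
        using L[OF i ius(1)] L[OF one ius(2)] D(2)[OF i iu] \<Phi>c_upper[OF i iu] by (simp add: matrix_mul_assoc)
      then show "map_matrix cnj (N i) ** L i = L 1" using fp1[OF ius(2)] by (metis matrix2_cancel_left)
      have "\<Phi>c 1 (- \<i>) ** (L 1 ** N i) = C ** \<Phi> 1 (- \<i>) ** N i"
        using L[OF one ius(4)] by (simp add: matrix_mul_assoc)
      also have "\<dots> = \<Phi>c 1 (- \<i>) ** L i"
        using L[OF i ius(3)] D(4)[OF i il] \<Phi>c_lower[OF i il] by (simp add: matrix_mul_assoc)
      finally show "L 1 ** N i = L i" using fp1[OF ius(4)] by (metis matrix2_cancel_left)
    qed
    have "invertible (L 1)"
    proof -
      have is1: "\<i> \<in> slit 1" by (simp add: slit_def)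
      obtain C' where C': "C' ** C = mat 1" using C(1) unfolding invertible_left_inverse ..
      have "\<Psi> 1 \<i> ** C' ** \<Phi>c 1 \<i> ** L 1 = \<Psi> 1 \<i> ** (C' ** (C ** \<Phi> 1 \<i>))"
        using L[OF one is1] by (simp add: matrix_mul_assoc)
      also have "\<dots> = mat 1"
        using matrix2_cancel_left[OF C'] fundamental_pairD(3)[OF D(1)[OF one] is1] by simp
      finally show ?thesis unfolding invertible_left_inverse by blast
    qed
    moreover have "map_matrix cnj (N i) ** L 1 ** N i = L 1" if "i \<in> {1..n+4}" for i
      using u[OF that] l[OF that] by (simp add: matrix_mul_assoc[symmetric])
    ultimately show "\<exists>C. invertible C \<and> (\<forall>i\<in>{1..n+4}. map_matrix cnj (N i) ** C ** N i = C)" by blast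
  next
    assume "\<exists>C. invertible C \<and> (\<forall>i\<in>{1..n+4}. map_matrix cnj (N i) ** C ** N i = C)"
    then obtain C where C: "invertible C" "\<And>i. i \<in> {1..n+4} \<Longrightarrow> map_matrix cnj (N i) ** C ** N i = C" by blast
    define G where "G i z = \<Phi>c i z ** (C ** N i) ** \<Psi> i z" for i z
    have G_half: "G i z = G 1 z" if i: "i \<in> {1..n+4}" and "Im z \<noteq> 0" for i z
    proof -
      consider "z \<in> upper" | "z \<in> lower" using \<open>Im z \<noteq> 0\<close> by (fastforce simp: upper_def lower_def)
      then show ?thesis
      proof cases
        case 1
        have "G i z = \<Phi>c 1 z ** (map_matrix cnj (N i) ** C ** N i) ** \<Psi> 1 z"
          using \<Phi>c_upper[OF i 1] D(3)[OF i 1] by (simp add: G_def matrix_mul_assoc)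
        then show ?thesis using C(2)[OF i] N1 by (simp add: G_def)
      next
        case 2
        have "G i z = \<Phi>c 1 z ** (C ** (N i ** (N' i ** \<Psi> 1 z)))"
          using \<Phi>c_lower[OF i 2] D(5)[OF i 2] by (simp add: G_def matrix_mul_assoc)
        also have "\<dots> = \<Phi>c 1 z ** (C ** \<Psi> 1 z)" by (simp only: matrix2_cancel_left[OF D(7)[OF i]])
        also have "\<dots> = G 1 z" using N1 by (simp add: G_def matrix_mul_assoc)
        finally show ?thesis .
      qed
    qed
    define T where "T z = G (SOME i. i \<in> {1..n+3} \<and> z \<in> slit i) z" for z
    have T: "T z = G i z" if i: "i \<in> {1..n+3}" "z \<in> slit i" for i z
    proof -
      define k where "k = (SOME i. i \<in> {1..n+3} \<and> z \<in> slit i)"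
      have k: "k \<in> {1..n+3} \<and> z \<in> slit k" unfolding k_def by (rule someI[of _ i]) (use that in blast)
      have Tk: "T z = G k z" unfolding T_def k_def ..
      show ?thesis
      proof (cases "Im z = 0")
        case True
        then have "Re z \<in> gap i" "Re z \<in> gap k" using that k by (auto simp: slit_def)
        then have "k = i" using gap_disjoint i(1) k by blast
        then show ?thesis using Tk by simp
      next
        case False
        then show ?thesis using G_half[of i z] G_half[of k z] i(1) k unfolding Tk by simp
      qed
    qed
    have "mat_deriv T (Bc z ** T z - T z ** B z) z" if z: "z \<notin> \<Sigma>" for z
    proof -
      obtain i where i: "i \<in> {1..n+3}" "z \<in> slit i" using slit_cover[OF z] by blast
      then have i4: "i \<in> {1..n+4}" by simp
      have "mat_deriv (G i) (Bc z ** G i z - G i z ** B z) z"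
        unfolding G_def[abs_def] by (rule mat_deriv_gauge[OF D(1)[OF i4] fpc[OF i4] i(2)])
      moreover have "\<forall>\<^sub>F w in nhds z. G i w = T w"
        using eventually_nhds_in_open[OF open_slit i(2)] by eventually_elim (simp add: T[OF i(1)])
      ultimately show ?thesis using mat_deriv_transform T[OF i] by metis
    qed
    from gauge_constant[OF finite_sing subset_refl this] obtain C0 where
      C0: "\<And>z. z \<notin> \<Sigma> \<Longrightarrow> T z = C0" "\<And>i. i \<in> {1..n+2} \<Longrightarrow> Ac i ** C0 = C0 ** A i" by auto
    have is1: "\<i> \<in> slit 1" by (simp add: slit_def)
    have "C0 = \<Phi>c 1 \<i> ** C ** \<Psi> 1 \<i>"
      using C0(1)[OF slit_avoids_sing[OF one is1]] T[of 1, OF _ is1] N1 by (simp add: G_def)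
    moreover have "invertible (\<Phi>c 1 \<i>)" "invertible (\<Psi> 1 \<i>)"
      using fundamental_pairD[OF fpc[OF one] is1] fundamental_pairD[OF D(1)[OF one] is1]
      unfolding invertible_def by blast+
    ultimately have "invertible C0" using C(1) by (simp add: invertible_mult)
    then show "real_up_to_phase n A" unfolding real_up_to_phase_iff using C0(2) by blast
  qed
qed

lemma fundamental_matrix_near_exists:
  assumes "Im x0 > 0"
  shows "\<exists>Y. fundamental_matrix_near B x0 Y"
proof -
  obtain \<Phi> \<Psi> where p: "fundamental_pair B (slit 1) \<Phi> \<Psi>" using fundamental_pair_on_slit[of 1] by auto
  have "x0 \<in> slit 1" using assms by (simp add: slit_def)
  from eventually_nhds_in_open[OF open_slit this]
  have "\<forall>\<^sub>F x in nhds x0. invertible (\<Phi> x) \<and> mat_deriv \<Phi> (B x ** \<Phi> x) x"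
  proof eventually_elim
    case (elim x)
    then show ?case using fundamental_pairD[OF p elim] unfolding invertible_left_inverse by blast
  qed
  then show ?thesis unfolding fundamental_matrix_near_def mat_deriv_def by blast
qed

text \<open>For one fundamental germ the condition on its monodromy matrices is equivalent to the normal form, whatever the germ.
  Existence of such a germ and of the loops makes the quantification over all generators non-vacuous.\<close>

lemma real_up_to_phase_iff_C1:
  assumes x0: "Im x0 > 0"
  shows "real_up_to_phase n A \<longleftrightarrow> (\<forall>M. monodromy_generators n t A x0 M \<longrightarrow> condition_C1 n M)"
proof -
  have key: "condition_C1 n M \<longleftrightarrow> real_up_to_phase n A"
    if cd: "connection_data x0 Y \<Phi> \<Psi> N N'" and M: "\<forall>j\<in>{1..n+3}. M j = N' (j+1) ** N j"
    for Y \<Phi> \<Psi> N N' M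
  proof -
    show ?thesis
      unfolding real_up_to_phase_iff_connection[OF cd]
    proof (rule C1_condition_iff)
      show "N' i ** N i = mat 1" if "i \<in> {1..n+4}" for i by (rule connection_dataD(6)[OF cd that])
      show "N 1 = mat 1" using cd by (simp add: connection_data_def)
      show "M j = N' (j+1) ** N j" if "j \<in> {1..n+3}" for j using M that by blast
    qed
  qed
  show ?thesis
  proof (intro iffI allI impI)
    fix M assume real: "real_up_to_phase n A" and "monodromy_generators n t A x0 M"
    then obtain Y where Y: "fundamental_matrix_near B x0 Y"
      "\<forall>j\<in>{1..n+3}. \<exists>g. gamma_loop n t x0 j g \<and> continues_along g Y (\<lambda>x. Y x ** M j)"
      unfolding monodromy_generators_def by blast
    obtain \<Phi> \<Psi> N N' where cd: "connection_data x0 Y \<Phi> \<Psi> N N'" using connection_data_exists[OF x0 Y(1)] by blast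
    from Y(2) have "\<forall>j\<in>{1..n+3}. M j = N' (j+1) ** N j" unfolding monodromy_matrices_iff[OF x0 Y(1) cd] .
    then show "condition_C1 n M" using key[OF cd] real by blast
  next
    assume C1: "\<forall>M. monodromy_generators n t A x0 M \<longrightarrow> condition_C1 n M"
    obtain Y where Y: "fundamental_matrix_near B x0 Y" using fundamental_matrix_near_exists[OF x0] by blast
    obtain \<Phi> \<Psi> N N' where cd: "connection_data x0 Y \<Phi> \<Psi> N N'" using connection_data_exists[OF x0 Y] by blast
    define M where "M j = N' (j+1) ** N j" for j
    have M: "\<forall>j\<in>{1..n+3}. M j = N' (j+1) ** N j" by (simp add: M_def)
    then have "monodromy_generators n t A x0 M"
      unfolding monodromy_generators_def using Y monodromy_matrices_iff[OF x0 Y cd, of M] by blast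
    then show "real_up_to_phase n A" using C1 key[OF cd M] by blast
  qed
qed

end

theorem proposition4p5:
  fixes n :: nat
    and t :: "nat \<Rightarrow> real"
    and A :: "nat \<Rightarrow> complex^2^2"
    and \<theta>p \<theta>m :: "nat \<Rightarrow> complex"
    and x0 :: complex
  assumes "n \<ge> 1"
    and "t \<in> positions n" and "t (n+1) = 0" and "t (n+2) = 1"
    and "\<forall>i\<in>{1..n+2}. has_eigenvalues (A i) (\<theta>p i) (\<theta>m i)"
    and normalized: "A_infinity n A = mat2 (\<theta>p (n+3)) 0 0 (\<theta>m (n+3))"
    and non_resonant: "\<forall>i\<in>{1..n+3}. \<theta>p i - \<theta>m i \<notin> \<int>"
    and "\<forall>i\<in>{1..n+2}. (\<theta>p i \<in> \<real> \<and> \<theta>m i \<in> \<real>) \<or> \<theta>m i = cnj (\<theta>p i)"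
    and "\<theta>p (n+3) \<in> \<real>" and "\<theta>m (n+3) \<in> \<real>"
    and A12_nonzero: "\<exists>x. x \<notin> sing n t \<and> system_matrix n t A x $ 1 $ 2 \<noteq> 0"
    and "Im x0 > 0"
  shows "(real_second_order_equation n t A \<longleftrightarrow> real_up_to_phase n A) \<and>
         (real_up_to_phase n A \<longleftrightarrow>
            (\<forall>M. monodromy_generators n t A x0 M \<longrightarrow> condition_C1 n M))"
proof -
  interpret fuchsian_system n t A \<theta>p \<theta>m
    by unfold_locales (fact assms)+
  show ?thesis
    using real_equation_imp_real_up_to_phase real_up_to_phase_imp_real_equation
      real_up_to_phase_iff_C1[OF \<open>Im x0 > 0\<close>] by blast
qed

end
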